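(* Let $\Omega$ be a (not necessarily bounded) domain in $\mathbb{R}^n$, $n\ge 3$. If the boundary $b\Omega$ is strongly minimally convex at a point $\mathbf{p}\in b\Omega$, then $\mathbf{p}$ is at infinite minimal distance from $\Omega$. In particular, every bounded strongly minimally convex domain is complete hyperbolic.
   Context: A domain is a nonempty connected open set. $\mathbb{D}=\{z=x+iy\in\mathbb{C}:|z|<1\}$. A $C^1$ map $f$ from an open subset of $\mathbb{R}^2=\mathbb{C}$ to $\mathbb{R}^n$ is conformal if $|f_x|=|f_y|$ and $f_x\cdot f_y=0$ at every point (it need not be an immersion). $\mathrm{CH}(\mathbb{D},\Omega)$ denotes the set of all conformal harmonic maps $\mathbb{D}\to\Omega$. $G_2(\mathbb{R}^n)$ is the Grassmann manifold of $2$-dimensional linear subspaces of $\mathbb{R}^n$. Minimal pseudometric: for $\mathbf{x}\in\Omega$, $\mathbf{v}\in\mathbb{R}^n$, $$g_\Omega(\mathbf{x},\mathbf{v})=\inf\{1/r>0:\exists f\in \mathrm{CH}(\mathbb{D},\Omega),\ f(0)=\mathbf{x},\ f_x(0)=r\mathbf{v}\}.$$ Minimal pseudodistance: $\rho_\Omega(\mathbf{x},\mathbf{y})=\inf_\gamma\int_0^1 g_\Omega(\gamma(t),\dot\gamma(t))\,dt$, the infimum over all piecewise smooth paths in $\Omega$ from $\mathbf{x}$ to $\mathbf{y}$. $\Omega$ is complete hyperbolic if $\rho_\Omega$ is a metric on $\Omega$ (positive for distinct points) and $(\Omega,\rho_\Omega)$ is a complete metric space. A point $\mathbf{p}\in b\Omega$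 is at infinite minimal distance from $\Omega$ if it is not in the closure (in $\mathbb{R}^n$) of any ball of finite radius of $\rho_\Omega$, i.e. $\rho_\Omega(\mathbf{x}_0,\mathbf{x})\to+\infty$ as $\mathbf{x}\in\Omega$ tends to $\mathbf{p}$, for every $\mathbf{x}_0\in\Omega$. A $C^2$ function $u$ on an open subset of $\mathbb{R}^n$ is strongly MPSH (strongly minimally plurisubharmonic) if for every $\mathbf{x}$ in its domain and every $\Lambda\in G_2(\mathbb{R}^n)$ the trace $\mathrm{tr}_\Lambda\mathrm{Hess}_u(\mathbf{x})$ of the restriction to $\Lambda$ of the Hessian form of $u$ at $\mathbf{x}$ is positive. A domain $\Omega$ with $C^2$ boundary is strongly minimally convex if it admits a $C^2$ defining function $u:U\to\mathbb{R}$ on a neighbourhood $U$ of $\overline\Omega$ (i.e. $\Omega=\{\mathbf{x}\in U:u(\mathbf{x})<0\}$ and $du\ne0$ on $b\Omega=\{u=0\}$) which is strongly MPSH on a neighbourhood of $b\Omega$. The boundary $b\Omega$ is strongly minimally convex at $\mathbf{p}\in b\Omega$ if there are a neighbourhood $U$ of $\mathbf{p}$ and a $C^2$ strongly MPSH function $u:U\to\mathbb{R}$ with $\Omega\cap U=\{u<0\}$ and $du\neq 0$ on $b\Omega\cap U=\{u=0\}$. *)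

theory Defs
  imports "HOL-Analysis.Analysis"
begin

definition is_domain :: "'a::topological_space set \<Rightarrow> bool" where
  "is_domain \<Omega> \<longleftrightarrow> open \<Omega> \<and> connected \<Omega> \<and> \<Omega> \<noteq> {}"


text \<open>The next two predicates are intended for open sets \<open>S\<close>.\<close>

definition C1_on :: "'a::real_normed_vector set \<Rightarrow> ('a \<Rightarrow> 'b::real_normed_vector) \<Rightarrow> bool" where
  "C1_on S f \<longleftrightarrow>
     (\<exists>f' :: 'a \<Rightarrow> 'a \<Rightarrow>\<^sub>L 'b.
        (\<forall>x\<in>S. (f has_derivative blinfun_apply (f' x)) (at x)) \<and> continuous_on S f')"

definition C2_on :: "'a::real_normed_vector set \<Rightarrow> ('a \<Rightarrow> 'b::real_normed_vector) \<Rightarrow> bool" where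
  "C2_on S f \<longleftrightarrow>
     (\<exists>f' :: 'a \<Rightarrow> 'a \<Rightarrow>\<^sub>L 'b.
        (\<forall>x\<in>S. (f has_derivative blinfun_apply (f' x)) (at x)) \<and> C1_on S f')"

definition hess ::
  "('a::real_normed_vector \<Rightarrow> 'b::real_normed_vector) \<Rightarrow> 'a \<Rightarrow> 'a \<Rightarrow> 'a \<Rightarrow> 'b" where
  "hess f x v w = frechet_derivative (\<lambda>y. frechet_derivative f (at y) v) (at x) w"


text \<open>For a map from (an open subset of) the complex plane, \<open>f\<^sub>x\<close> and \<open>f\<^sub>y\<close> are the derivatives
  in the directions \<open>1\<close> and \<open>\<i>\<close>.\<close>

definition pd_x :: "(complex \<Rightarrow> 'a::real_normed_vector) \<Rightarrow> complex \<Rightarrow> 'a" where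
  "pd_x f z = frechet_derivative f (at z) 1"

definition pd_y :: "(complex \<Rightarrow> 'a::real_normed_vector) \<Rightarrow> complex \<Rightarrow> 'a" where
  "pd_y f z = frechet_derivative f (at z) \<i>"

definition conformal_on :: "complex set \<Rightarrow> (complex \<Rightarrow> 'a::real_inner) \<Rightarrow> bool" where
  "conformal_on S f \<longleftrightarrow>
     C1_on S f \<and> (\<forall>z\<in>S. norm (pd_x f z) = norm (pd_y f z) \<and> pd_x f z \<bullet> pd_y f z = 0)"

definition harmonic_map_on :: "complex set \<Rightarrow> (complex \<Rightarrow> 'a::real_normed_vector) \<Rightarrow> bool" where
  "harmonic_map_on S f \<longleftrightarrow> C2_on S f \<and> (\<forall>z\<in>S. hess f z 1 1 + hess f z \<i> \<i> = 0)"

definition CH_disc :: "'a::euclidean_space set \<Rightarrow> (complex \<Rightarrow> 'a) set" where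
  "CH_disc \<Omega> =
     {f. harmonic_map_on (ball 0 1) f \<and> conformal_on (ball 0 1) f \<and> f ` ball 0 1 \<subseteq> \<Omega>}"


text \<open>The set below is nonempty when \<open>\<Omega>\<close> is open, \<open>x \<in> \<Omega>\<close> and the dimension is at least 2 (small
  affine conformal discs), so the infimum is then a genuine infimum of positive reals.\<close>

definition minimal_pseudometric :: "'a::euclidean_space set \<Rightarrow> 'a \<Rightarrow> 'a \<Rightarrow> real" where
  "minimal_pseudometric \<Omega> x v =
     Inf {1 / r | r. r > 0 \<and> (\<exists>f\<in>CH_disc \<Omega>. f 0 = x \<and> pd_x f 0 = r *\<^sub>R v)}"

text \<open>\<open>D k\<close> is the \<open>k\<close>-th derivative, one-sided at the endpoints of the interval.\<close>

definition smooth_on_interval :: "real \<Rightarrow> real \<Rightarrow> (real \<Rightarrow> 'a::real_normed_vector) \<Rightarrow> bool" where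
  "smooth_on_interval a b \<gamma> \<longleftrightarrow>
     (\<exists>D :: nat \<Rightarrow> real \<Rightarrow> 'a. D 0 = \<gamma> \<and>
        (\<forall>k. \<forall>t\<in>{a..b}. (D k has_vector_derivative D (Suc k) t) (at t within {a..b})))"

definition piecewise_smooth_path :: "(real \<Rightarrow> 'a::real_normed_vector) \<Rightarrow> bool" where
  "piecewise_smooth_path \<gamma> \<longleftrightarrow>
     (\<exists>N (s :: nat \<Rightarrow> real). s 0 = 0 \<and> s N = 1 \<and>
        (\<forall>i<N. s i < s (Suc i) \<and> smooth_on_interval (s i) (s (Suc i)) \<gamma>))"

text \<open>The integral is a Lebesgue integral with values in \<open>[0,\<infinity>]\<close>. On a domain of dimension at
  least 2 the infimum is finite, since the domain is connected by polygonal paths and the minimal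
  pseudometric is locally bounded, so the conversion to a real number loses nothing.\<close>

definition minimal_pseudodistance :: "'a::euclidean_space set \<Rightarrow> 'a \<Rightarrow> 'a \<Rightarrow> real" where
  "minimal_pseudodistance \<Omega> x y =
     enn2real (INF \<gamma>\<in>{\<gamma>. piecewise_smooth_path \<gamma> \<and> path_image \<gamma> \<subseteq> \<Omega> \<and>
                        pathstart \<gamma> = x \<and> pathfinish \<gamma> = y}.
       \<integral>\<^sup>+t\<in>{0..1}. ennreal (minimal_pseudometric \<Omega> (\<gamma> t)
                            (vector_derivative \<gamma> (at t within {0..1}))) \<partial>lborel)"

definition complete_hyperbolic :: "'a::euclidean_space set \<Rightarrow> bool" where
  "complete_hyperbolic \<Omega> \<longleftrightarrow>
     Metric_space \<Omega> (minimal_pseudodistance \<Omega>) \<and>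
     Metric_space.mcomplete \<Omega> (minimal_pseudodistance \<Omega>)"

definition at_infinite_minimal_distance :: "'a::euclidean_space \<Rightarrow> 'a set \<Rightarrow> bool" where
  "at_infinite_minimal_distance p \<Omega> \<longleftrightarrow>
     (\<forall>x\<^sub>0\<in>\<Omega>. \<forall>r. p \<notin> closure {x\<in>\<Omega>. minimal_pseudodistance \<Omega> x\<^sub>0 x < r})"

lemma at_infinite_minimal_distance_iff_tendsto:
  assumes "open \<Omega>" "p \<in> frontier \<Omega>"
  shows "at_infinite_minimal_distance p \<Omega> \<longleftrightarrow>
    (\<forall>x\<^sub>0\<in>\<Omega>. filterlim (minimal_pseudodistance \<Omega> x\<^sub>0) at_top (at p within \<Omega>))"
proof -
  have p: "p \<notin> \<Omega>"
    using assms by (simp add: frontier_def interior_open)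
  have "p \<notin> closure {x\<in>\<Omega>. f x < r} \<longleftrightarrow> eventually (\<lambda>x. r \<le> f x) (at p within \<Omega>)"
    for f :: "'a \<Rightarrow> real" and r
    unfolding closure_approachable eventually_at using p
    by (auto simp: not_less) (metis not_le)+
  then show ?thesis
    unfolding at_infinite_minimal_distance_def filterlim_at_top by blast
qed


definition grassmannian2 :: "'a::euclidean_space set set" where
  "grassmannian2 = {\<Lambda>. subspace \<Lambda> \<and> dim \<Lambda> = 2}"

definition orthonormal_basis_of :: "'a::euclidean_space set \<Rightarrow> 'a set \<Rightarrow> bool" where
  "orthonormal_basis_of \<Lambda> B \<longleftrightarrow>
     pairwise orthogonal B \<and> (\<forall>b\<in>B. norm b = 1) \<and> span B = \<Lambda>"

text \<open>The trace of the restriction of a bilinear form to a subspace; the choice of the orthonormal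
  basis is immaterial by the lemma that follows.\<close>

definition trace_on :: "'a::euclidean_space set \<Rightarrow> ('a \<Rightarrow> 'a \<Rightarrow> real) \<Rightarrow> real" where
  "trace_on \<Lambda> Q = (\<Sum>b\<in>(SOME B. orthonormal_basis_of \<Lambda> B). Q b b)"

lemma trace_on_eq:
  fixes Q :: "'a::euclidean_space \<Rightarrow> 'a \<Rightarrow> real"
  assumes Q: "bilinear Q" and B: "orthonormal_basis_of \<Lambda> B"
  shows "trace_on \<Lambda> Q = (\<Sum>b\<in>B. Q b b)"
proof -
  have fin: "finite B" if "orthonormal_basis_of \<Lambda> B" for B
    using that unfolding orthonormal_basis_of_def
    by (metis pairwise_orthogonal_imp_finite)
  have expand: "(\<Sum>b\<in>B. (x \<bullet> b) *\<^sub>R b) = x" if "orthonormal_basis_of \<Lambda> B" "x \<in> \<Lambda>" for B x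
    using that fin[OF that(1)] unfolding orthonormal_basis_of_def
    by (intro orthonormal_basis_expand) auto
  have eq: "(\<Sum>b\<in>B. Q b b) = (\<Sum>c\<in>C. Q c c)"
    if B: "orthonormal_basis_of \<Lambda> B" and C: "orthonormal_basis_of \<Lambda> C" for B C
  proof -
    have BL: "B \<subseteq> \<Lambda>" and CL: "C \<subseteq> \<Lambda>"
      using B C span_superset unfolding orthonormal_basis_of_def by blast+
    have "Q b b = (\<Sum>c\<in>C. \<Sum>d\<in>C. (b \<bullet> c) * (b \<bullet> d) * Q c d)" if "b \<in> B" for b
    proof -
      have b: "(\<Sum>c\<in>C. (b \<bullet> c) *\<^sub>R c) = b"
        using expand[OF C] BL that by blast
      have "Q b b = Q (\<Sum>c\<in>C. (b \<bullet> c) *\<^sub>R c) (\<Sum>c\<in>C. (b \<bullet> c) *\<^sub>R c)"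
        by (simp add: b)
      also have "\<dots> = (\<Sum>(c, d)\<in>C \<times> C. Q ((b \<bullet> c) *\<^sub>R c) ((b \<bullet> d) *\<^sub>R d))"
        by (rule bilinear_sum[OF Q])
      also have "\<dots> = (\<Sum>c\<in>C. \<Sum>d\<in>C. (b \<bullet> c) * (b \<bullet> d) * Q c d)"
        by (simp add: sum.cartesian_product bilinear_lmul[OF Q] bilinear_rmul[OF Q] mult_ac)
      finally show ?thesis .
    qed
    then have "(\<Sum>b\<in>B. Q b b) = (\<Sum>b\<in>B. \<Sum>c\<in>C. \<Sum>d\<in>C. (b \<bullet> c) * (b \<bullet> d) * Q c d)"
      by simp
    also have "\<dots> = (\<Sum>c\<in>C. \<Sum>b\<in>B. \<Sum>d\<in>C. (b \<bullet> c) * (b \<bullet> d) * Q c d)"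
      by (rule sum.swap)
    also have "\<dots> = (\<Sum>c\<in>C. \<Sum>d\<in>C. \<Sum>b\<in>B. (b \<bullet> c) * (b \<bullet> d) * Q c d)"
      by (intro sum.cong refl sum.swap)
    also have "\<dots> = (\<Sum>c\<in>C. \<Sum>d\<in>C. (c \<bullet> d) * Q c d)"
    proof (intro sum.cong refl)
      fix c d assume "c \<in> C" "d \<in> C"
      have "(\<Sum>b\<in>B. (b \<bullet> c) * (b \<bullet> d)) = (\<Sum>b\<in>B. (c \<bullet> b) *\<^sub>R b) \<bullet> d"
        by (simp add: inner_sum_left inner_commute[of c])
      also have "(\<Sum>b\<in>B. (c \<bullet> b) *\<^sub>R b) = c"
        using expand[OF B] CL \<open>c \<in> C\<close> by blast
      finally show "(\<Sum>b\<in>B. (b \<bullet> c) * (b \<bullet> d) * Q c d) = (c \<bullet> d) * Q c d"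
        by (simp flip: sum_distrib_right)
    qed
    also have "\<dots> = (\<Sum>c\<in>C. \<Sum>d\<in>C. if c = d then Q c d else 0)"
    proof (intro sum.cong refl)
      fix c d assume "c \<in> C" "d \<in> C"
      then show "(c \<bullet> d) * Q c d = (if c = d then Q c d else 0)"
        using C unfolding orthonormal_basis_of_def pairwise_def orthogonal_def norm_eq_1 by auto
    qed
    also have "\<dots> = (\<Sum>c\<in>C. Q c c)"
      using fin[OF C] by simp
    finally show ?thesis .
  qed
  show ?thesis
    unfolding trace_on_def by (rule eq[OF someI[of _ B] B]) (rule B)
qed

definition strongly_mpsh_on :: "'a::euclidean_space set \<Rightarrow> ('a \<Rightarrow> real) \<Rightarrow> bool" where
  "strongly_mpsh_on U u \<longleftrightarrow>
     open U \<and> C2_on U u \<and> (\<forall>x\<in>U. \<forall>\<Lambda>\<in>grassmannian2. trace_on \<Lambda> (hess u x) > 0)"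


definition C2_defining_function ::
  "'a::euclidean_space set \<Rightarrow> 'a set \<Rightarrow> ('a \<Rightarrow> real) \<Rightarrow> bool" where
  "C2_defining_function \<Omega> U u \<longleftrightarrow>
     open U \<and> C2_on U u \<and>
     \<Omega> \<inter> U = {x\<in>U. u x < 0} \<and>
     frontier \<Omega> \<inter> U = {x\<in>U. u x = 0} \<and>
     (\<forall>x\<in>frontier \<Omega> \<inter> U. frechet_derivative u (at x) \<noteq> (\<lambda>v. 0))"

definition has_C2_boundary :: "'a::euclidean_space set \<Rightarrow> bool" where
  "has_C2_boundary \<Omega> \<longleftrightarrow> (\<forall>p\<in>frontier \<Omega>. \<exists>U u. p \<in> U \<and> C2_defining_function \<Omega> U u)"

definition strongly_minimally_convex_at :: "'a::euclidean_space set \<Rightarrow> 'a \<Rightarrow> bool" where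
  "strongly_minimally_convex_at \<Omega> p \<longleftrightarrow>
     (\<exists>U u. p \<in> U \<and> C2_defining_function \<Omega> U u \<and> strongly_mpsh_on U u)"

definition strongly_minimally_convex :: "'a::euclidean_space set \<Rightarrow> bool" where
  "strongly_minimally_convex \<Omega> \<longleftrightarrow>
     is_domain \<Omega> \<and> has_C2_boundary \<Omega> \<and>
     (\<exists>U u. closure \<Omega> \<subseteq> U \<and> C2_defining_function \<Omega> U u \<and>
        (\<exists>V. frontier \<Omega> \<subseteq> V \<and> V \<subseteq> U \<and> strongly_mpsh_on V u))"

end

theory Submission
  imports Defs
begin

text \<open>Near \<open>p\<close> let \<open>\<phi> = u - \<epsilon> |y - p|\<^sup>2\<close>, which is strongly MPSH, vanishes at \<open>p\<close> and is negative on
  \<open>\<Omega>\<close>. A maximum principle for \<open>log |f - f(0)|\<^sup>2 + A \<phi>(f)\<close> shows that every conformal harmonic disc \<open>f\<close>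
  in \<open>\<Omega>\<close> with \<open>f(0)\<close> close to \<open>p\<close> maps a disc of a fixed radius \<open>r\<close> into the neighbourhood of \<open>p\<close>.
  With \<open>\<eta> = - \<phi>(f(0))\<close>, the mean value inequality for the subharmonic function
  \<open>\<phi>(f) - c |f - f(0)|\<^sup>2\<close> bounds the circle means of \<open>|\<phi>(f)|\<close> and \<open>|f - f(0)|\<^sup>2\<close> by multiples of \<open>\<eta>\<close>,
  hence, by Taylor's formula, those of the harmonic function \<open>d\<phi> (f - f(0))\<close>. So its gradient at \<open>0\<close> is
  \<open>O(\<eta>)\<close>, that is, \<open>|d\<phi>(v)| \<le> C |\<phi>| g\<^sub>\<Omega>(x, v)\<close>, and \<open>- log |\<phi>|\<close> is Lipschitz for the minimal distance
  near \<open>p\<close>. Since \<open>\<phi> \<le> - \<epsilon> d\<^sup>2\<close> on the sphere of radius \<open>d\<close> about \<open>p\<close>, which every path to \<open>p\<close> crosses,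
  the distance tends to infinity at \<open>p\<close>. On a bounded domain \<open>g\<^sub>\<Omega>\<close> also dominates a multiple of the
  Euclidean norm, so Cauchy sequences converge in the closure, and they cannot approach the boundary.\<close>

section \<open>Second derivatives\<close>

text \<open>For a conformal harmonic \<open>f\<close> the Laplacian of \<open>g o f\<close> is
  \<open>|f_x|^2\<close> times the trace of the Hessian of \<open>g\<close> on the plane of
  \<open>f_x\<close> and \<open>f_y\<close>: harmonicity removes the first-order term, conformality
  makes the frame orthogonal with equal lengths. The same two facts, with Bessel's inequality, make
  \<open>log |f - f(0)|^2\<close> subharmonic. The obstacle is that the barrier exists only near
  \<open>p\<close>, while a disc centred there may wander off in a possibly unbounded domain.
  Localisation must therefore precede every mean value argument; it works like a Schwarz lemma, with
  the logarithm supplying the singular weight. The decisive point afterwards is the power of \<eta>.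
  The mean of \<open>|f - f(0)|^2\<close> is \<open>O(\<eta>)\<close>, which allows tangential
  displacements of size \<open>sqrt \<eta>\<close>, but the component along the gradient is
  \<open>O(\<eta>)\<close>, because the quadratic Taylor error is itself \<open>O(\<eta>)\<close>. A
  gradient bound by \<open>sqrt \<eta>\<close> would only lead to the convergent integral of
  \<open>d\<eta> / sqrt \<eta>\<close>; the linear bound leads to that of
  \<open>d\<eta> / \<eta>\<close>, which diverges at the boundary.\<close>

lemma hess_eq:
  fixes f :: "'a::real_normed_vector \<Rightarrow> 'b::real_normed_vector" and f' :: "'a \<Rightarrow> 'a \<Rightarrow>\<^sub>L 'b"
  assumes S: "open S" "x \<in> S"
    and f': "\<And>y. y \<in> S \<Longrightarrow> (f has_derivative blinfun_apply (f' y)) (at y)"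
    and f'': "(f' has_derivative f'') (at x)"
  shows "hess f x v w = blinfun_apply (f'' w) v"
proof -
  have "((\<lambda>y. blinfun_apply (f' y) v) has_derivative (\<lambda>w. blinfun_apply (f'' w) v)) (at x)"
    using bounded_linear.has_derivative[OF blinfun.bounded_linear_left f''] by (simp add: o_def)
  then have *: "((\<lambda>y. frechet_derivative f (at y) v) has_derivative (\<lambda>w. blinfun_apply (f'' w) v)) (at x)"
    by (rule has_derivative_transform_within_open[OF _ S])
       (simp add: frechet_derivative_at[OF f', symmetric])
  show ?thesis
    unfolding hess_def using frechet_derivative_at[OF *] by metis
qed

text \<open>Explicit witnesses for \<open>C2_on\<close>, so that chain rules are computed with
  bounded linear maps. The first argument of \<open>f'' x\<close> is the direction of the second
  differentiation, whence the exchanged arguments in comparison with \<open>hess\<close>.\<close>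

definition C2_derivs ::
  "'a::real_normed_vector set \<Rightarrow> ('a \<Rightarrow> 'b::real_normed_vector) \<Rightarrow> ('a \<Rightarrow> 'a \<Rightarrow>\<^sub>L 'b) \<Rightarrow> ('a \<Rightarrow> 'a \<Rightarrow>\<^sub>L 'a \<Rightarrow>\<^sub>L 'b) \<Rightarrow> bool"
  where "C2_derivs S f f' f'' \<longleftrightarrow>
    (\<forall>x\<in>S. (f has_derivative blinfun_apply (f' x)) (at x)) \<and>
    (\<forall>x\<in>S. (f' has_derivative blinfun_apply (f'' x)) (at x)) \<and> continuous_on S f''"

lemma C2_on_iff: "C2_on S f \<longleftrightarrow> (\<exists>f' f''. C2_derivs S f f' f'')"
  unfolding C2_on_def C1_on_def C2_derivs_def by blast

lemma C2_derivsD: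
  assumes "C2_derivs S f f' f''"
  shows "x \<in> S \<Longrightarrow> (f has_derivative blinfun_apply (f' x)) (at x)"
    and "x \<in> S \<Longrightarrow> (f' has_derivative blinfun_apply (f'' x)) (at x)"
    and "continuous_on S f''" "continuous_on S f'" "continuous_on S f"
    and "x \<in> S \<Longrightarrow> frechet_derivative f (at x) = blinfun_apply (f' x)"
    and "open S \<Longrightarrow> x \<in> S \<Longrightarrow> hess f x v w = f'' x w v"
proof -
  from assms have f': "\<And>x. x \<in> S \<Longrightarrow> (f has_derivative blinfun_apply (f' x)) (at x)"
    and f'': "\<And>x. x \<in> S \<Longrightarrow> (f' has_derivative blinfun_apply (f'' x)) (at x)"
    unfolding C2_derivs_def by auto
  show "x \<in> S \<Longrightarrow> (f has_derivative blinfun_apply (f' x)) (at x)" by (rule f')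
  show "x \<in> S \<Longrightarrow> (f' has_derivative blinfun_apply (f'' x)) (at x)" by (rule f'')
  show "continuous_on S f''" using assms by (simp add: C2_derivs_def)
  show "continuous_on S f'"
    by (intro continuous_at_imp_continuous_on ballI) (rule has_derivative_continuous[OF f''])
  show "continuous_on S f"
    by (intro continuous_at_imp_continuous_on ballI) (rule has_derivative_continuous[OF f'])
  show "x \<in> S \<Longrightarrow> frechet_derivative f (at x) = blinfun_apply (f' x)"
    by (rule frechet_derivative_at[OF f', symmetric])
  show "open S \<Longrightarrow> x \<in> S \<Longrightarrow> hess f x v w = f'' x w v"
    by (rule hess_eq[OF _ _ f' f''])
qed

lemma C2_on_continuous: "C2_on S f \<Longrightarrow> continuous_on S f"
  unfolding C2_on_iff using C2_derivsD(5) by blast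

text \<open>Used in three ways: centred at \<open>p\<close> it isolates the zero of the barrier,
  centred at \<open>f 0\<close> it brings \<open>|f - f 0|^2\<close> into the maximum principle and
  the mean value inequality, and with \<open>u = 0\<close>, \<open>e = -1\<close> it yields the
  squared distance itself.\<close>

lemma C2_on_minus_dist:
  fixes u :: "'a::euclidean_space \<Rightarrow> real" and e :: real and x :: 'a
  assumes u: "C2_on V u" and V: "open V"
  defines "\<phi> \<equiv> \<lambda>y. u y - e * ((y - x) \<bullet> (y - x))"
  shows "C2_on V \<phi>"
    and "y \<in> V \<Longrightarrow> hess \<phi> y v w = hess u y v w - 2 * e * (v \<bullet> w)"
    and "y \<in> V \<Longrightarrow> frechet_derivative \<phi> (at y) v = frechet_derivative u (at y) v - 2 * e * ((y - x) \<bullet> v)"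
proof -
  obtain u' u'' where D: "C2_derivs V u u' u''" using u by (auto simp: C2_on_iff)
  note u' = C2_derivsD(1)[OF D] and u'' = C2_derivsD(2)[OF D] and cu = C2_derivsD(4,3)[OF D]
    and fru = C2_derivsD(6)[OF D] and heu = C2_derivsD(7)[OF D V]
  define L :: "'a \<Rightarrow>\<^sub>L ('a \<Rightarrow>\<^sub>L real)" where "L = Blinfun blinfun_inner_left"
  have L [simp]: "blinfun_apply (blinfun_apply L v) w = v \<bullet> w" for v w
    unfolding L_def
    by (subst bounded_linear_Blinfun_apply) (auto intro!: bounded_linear_blinfun_inner_left simp: inner_commute)
  define p' where "p' y = u' y - (2 * e) *\<^sub>R blinfun_apply L (y - x)" for y
  define p'' where "p'' y = u'' y - (2 * e) *\<^sub>R L" for y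
  have p': "(\<phi> has_derivative blinfun_apply (p' y)) (at y)" if "y \<in> V" for y
  proof -
    have "((\<lambda>y. (y - x) \<bullet> (y - x)) has_derivative (\<lambda>h. 2 * ((y - x) \<bullet> h))) (at y)"
      by (auto intro!: derivative_eq_intros simp: inner_commute)
    from has_derivative_diff[OF u'[OF that] has_derivative_mult_right[OF this, of e]]
    show ?thesis
      unfolding \<phi>_def by (rule has_derivative_eq_rhs) (simp add: p'_def fun_eq_iff blinfun.diff_left blinfun.scaleR_left)
  qed
  have p'': "(p' has_derivative blinfun_apply (p'' y)) (at y)" if "y \<in> V" for y
  proof -
    have "((\<lambda>y. blinfun_apply L (y - x)) has_derivative blinfun_apply L) (at y)"
      by (rule bounded_linear.has_derivative[OF blinfun.bounded_linear_right]) (auto intro!: derivative_eq_intros)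
    from has_derivative_diff[OF u''[OF that] has_derivative_scaleR_right[OF this, of "2 * e"]]
    show ?thesis
      unfolding p'_def by (rule has_derivative_eq_rhs) (simp add: p''_def fun_eq_iff blinfun.diff_left blinfun.scaleR_left)
  qed
  have "continuous_on V p''" unfolding p''_def by (intro continuous_intros cu(2))
  then show "C2_on V \<phi>" unfolding C2_on_iff C2_derivs_def using p' p'' by blast
  show "hess \<phi> y v w = hess u y v w - 2 * e * (v \<bullet> w)" if "y \<in> V"
    using hess_eq[OF V that p' p''[OF that]] heu[OF that]
    by (simp add: p''_def blinfun.diff_left blinfun.scaleR_left inner_commute)
  show "frechet_derivative \<phi> (at y) v = frechet_derivative u (at y) v - 2 * e * ((y - x) \<bullet> v)" if "y \<in> V"
    using frechet_derivative_at[OF p'[OF that], symmetric] fru[OF that]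
    by (simp add: p'_def blinfun.diff_left blinfun.scaleR_left)
qed

text \<open>First derivatives \<open>p, q\<close> and second derivatives \<open>a, b, c, d\<close> of a \<open>C\<^sup>2\<close> function of
  \<open>x + iy\<close>; the Laplacian is \<open>a + d\<close>.\<close>

definition C2_planar where
  "C2_planar S W p q a b c d \<longleftrightarrow> open S \<and>
    (\<forall>z\<in>S. (W has_derivative (\<lambda>k. Re k * p z + Im k * q z)) (at z)) \<and>
    (\<forall>z\<in>S. (p has_derivative (\<lambda>k. Re k * a z + Im k * b z)) (at z)) \<and>
    (\<forall>z\<in>S. (q has_derivative (\<lambda>k. Re k * c z + Im k * d z)) (at z)) \<and>
    continuous_on S a \<and> continuous_on S b \<and> continuous_on S c \<and> continuous_on S (d :: complex \<Rightarrow> real)"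

lemma linear_complex_eq:
  fixes f :: "complex \<Rightarrow> 'a::real_vector"
  assumes "linear f" shows "f k = Re k *\<^sub>R f 1 + Im k *\<^sub>R f \<i>"
proof -
  have "k = Re k *\<^sub>R 1 + Im k *\<^sub>R \<i>" by (simp add: complex_eq_iff)
  then have "f k = f (Re k *\<^sub>R 1 + Im k *\<^sub>R \<i>)" by (rule arg_cong)
  then show ?thesis by (simp add: linear_add[OF assms] linear_scale[OF assms])
qed

text \<open>By the chain rule the Laplacian of \<open>u o f\<close> is the Hessian of
  \<open>u\<close> on \<open>f_x\<close> and \<open>f_y\<close> plus \<open>du\<close> applied to
  the Laplacian of \<open>f\<close>, and the latter vanishes.\<close>

lemma CH_disc_compose:
  fixes u :: "'a::euclidean_space \<Rightarrow> real"
  assumes f: "f \<in> CH_disc \<Omega>" and u: "C2_on V u" and V: "open V"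
    and S: "open S" "S \<subseteq> ball 0 1" "f ` S \<subseteq> V"
  obtains p q a b c d where "C2_planar S (\<lambda>z. u (f z)) p q a b c d"
    "\<forall>z\<in>S. p z = frechet_derivative u (at (f z)) (pd_x f z)"
    "\<forall>z\<in>S. q z = frechet_derivative u (at (f z)) (pd_y f z)"
    "\<forall>z\<in>S. a z + d z = hess u (f z) (pd_x f z) (pd_x f z) + hess u (f z) (pd_y f z) (pd_y f z)"
proof -
  obtain u' u'' where D: "C2_derivs V u u' u''" using u by (auto simp: C2_on_iff)
  note u' = C2_derivsD(1)[OF D] and u'' = C2_derivsD(2)[OF D] and cu = C2_derivsD(4,3)[OF D]
    and fru = C2_derivsD(6)[OF D] and heu = C2_derivsD(7)[OF D V]
  have harm: "harmonic_map_on (ball 0 1) f" using f by (simp add: CH_disc_def)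
  then have "C2_on (ball 0 1) f" by (simp add: harmonic_map_on_def)
  then obtain f' f'' where F: "C2_derivs (ball 0 1) f f' f''" by (auto simp: C2_on_iff)
  note f' = C2_derivsD(1)[OF F] and f'' = C2_derivsD(2)[OF F] and cf = C2_derivsD(4,3)[OF F]
    and frf = C2_derivsD(6)[OF F] and hef = C2_derivsD(7)[OF F open_ball]
  have lap: "f'' z 1 1 + f'' z \<i> \<i> = 0" if "z \<in> S" for z
    using harm that S(2) hef unfolding harmonic_map_on_def by auto
  have inS: "z \<in> ball 0 1" "f z \<in> V" if "z \<in> S" for z using that S by auto
  \<comment> \<open>\<open>A z k v\<close> is the second derivative of \<open>u o f\<close> at
    \<open>z\<close>, first along \<open>v\<close> and then along \<open>k\<close>.\<close>
  define A where "A z k v = u'' (f z) (f' z k) (f' z v) + u' (f z) (f'' z k v)" for z k v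
  have lin: "linear (\<lambda>k. A z k v)" for z v
    unfolding A_def by (auto intro!: linearI simp: blinfun.add_right blinfun.add_left blinfun.scaleR_right blinfun.scaleR_left algebra_simps)
  have dW: "((\<lambda>z. u (f z)) has_derivative (\<lambda>k. Re k * u' (f z) (f' z 1) + Im k * u' (f z) (f' z \<i>))) (at z)"
    if z: "z \<in> S" for z
  proof -
    have *: "((\<lambda>z. u (f z)) has_derivative (\<lambda>k. u' (f z) (f' z k))) (at z)"
      using has_derivative_compose[OF f' u'] inS[OF z] by blast
    have "linear (\<lambda>k. u' (f z) (f' z k))"
      by (auto intro!: linearI simp: blinfun.add_right blinfun.scaleR_right)
    then have "u' (f z) (f' z k) = Re k * u' (f z) (f' z 1) + Im k * u' (f z) (f' z \<i>)" for k
      by (subst linear_complex_eq) auto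
    with * show ?thesis by (rule has_derivative_eq_rhs[OF _ ext])
  qed
  have dp: "((\<lambda>z. u' (f z) (f' z v)) has_derivative (\<lambda>k. Re k * A z 1 v + Im k * A z \<i> v)) (at z)"
    if z: "z \<in> S" for z v
  proof -
    have 1: "((\<lambda>z. u' (f z)) has_derivative (\<lambda>k. u'' (f z) (f' z k))) (at z)"
      using has_derivative_compose[OF f' u''] inS[OF z] by blast
    have "((\<lambda>z. blinfun_apply (f' z) v) has_derivative (\<lambda>k. f'' z k v)) (at z)"
      using bounded_linear.has_derivative[OF blinfun.bounded_linear_left f''[OF inS(1)[OF z]]]
      by (simp add: o_def)
    from bounded_bilinear.FDERIV[OF bounded_bilinear_blinfun_apply 1 this]
    have "((\<lambda>z. u' (f z) (f' z v)) has_derivative (\<lambda>k. A z k v)) (at z)"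
      unfolding A_def by (simp add: add.commute)
    moreover have "A z k v = Re k * A z 1 v + Im k * A z \<i> v" for k
      by (subst linear_complex_eq[OF lin[of z v]]) simp
    ultimately show ?thesis by (rule has_derivative_eq_rhs[OF _ ext])
  qed
  have ct: "continuous_on S f" using C2_derivsD(5)[OF F] S(2) by (rule continuous_on_subset)
  have cA: "continuous_on S (\<lambda>z. A z k v)" for k v
    unfolding A_def using S
    by (intro continuous_intros continuous_on_compose2[OF cu(1) ct] continuous_on_compose2[OF cu(2) ct]
        continuous_on_subset[OF cf(1)] continuous_on_subset[OF cf(2)]) auto
  show thesis
  proof (rule that; (rule ballI)?)
    show "C2_planar S (\<lambda>z. u (f z)) (\<lambda>z. u' (f z) (f' z 1)) (\<lambda>z. u' (f z) (f' z \<i>))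
       (\<lambda>z. A z 1 1) (\<lambda>z. A z \<i> 1) (\<lambda>z. A z 1 \<i>) (\<lambda>z. A z \<i> \<i>)"
      unfolding C2_planar_def using S dW dp cA by blast
    fix z assume z: "z \<in> S"
    note i = inS[OF z]
    \<comment> \<open>The only place where harmonicity of \<open>f\<close> enters.\<close>
    have L: "u' (f z) (f'' z 1 1) + u' (f z) (f'' z \<i> \<i>) = 0"
      using lap[OF z] by (simp flip: blinfun.add_right)
    show "u' (f z) (f' z 1) = frechet_derivative u (at (f z)) (pd_x f z)"
      "u' (f z) (f' z \<i>) = frechet_derivative u (at (f z)) (pd_y f z)"
      by (simp_all add: fru[OF i(2)] frf[OF i(1)] pd_x_def pd_y_def)
    show "A z 1 1 + A z \<i> \<i> = hess u (f z) (pd_x f z) (pd_x f z) + hess u (f z) (pd_y f z) (pd_y f z)"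
      using L by (simp add: heu[OF i(2)] frf[OF i(1)] pd_x_def pd_y_def A_def)
  qed
qed

lemma bilinear_hess:
  fixes u :: "'a::euclidean_space \<Rightarrow> real"
  assumes "C2_on V u" "open V" "x \<in> V" shows "bilinear (hess u x)"
proof -
  obtain u' u'' where D: "C2_derivs V u u' u''" using assms(1) by (auto simp: C2_on_iff)
  have "hess u x v w = u'' x w v" for v w using C2_derivsD(7)[OF D assms(2,3)] .
  then show ?thesis
    unfolding bilinear_def by (auto intro!: linearI simp: blinfun.add_right blinfun.add_left blinfun.scaleR_right blinfun.scaleR_left)
qed

lemma strongly_mpsh_hess_pos:
  fixes a b :: "'a::euclidean_space"
  assumes u: "strongly_mpsh_on U u" and x: "x \<in> U"
    and ab: "norm a = 1" "norm b = 1" "a \<bullet> b = 0"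
  shows "0 < hess u x a a + hess u x b b"
proof -
  have ne: "a \<noteq> b" using ab by (auto simp: norm_eq_1)
  have B: "orthonormal_basis_of (span {a, b}) {a, b}"
    using ab by (auto simp: orthonormal_basis_of_def pairwise_def orthogonal_def inner_commute)
  have "pairwise orthogonal {a, b}" "0 \<notin> {a, b}"
    using ab by (auto simp: pairwise_def orthogonal_def inner_commute)
  then have "independent {a, b}" by (rule pairwise_orthogonal_independent)
  then have "dim (span {a, b}) = 2" using ne by (simp add: dim_span dim_eq_card_independent)
  then have "span {a, b} \<in> grassmannian2" by (simp add: grassmannian2_def)
  then have "0 < trace_on (span {a, b}) (hess u x)" using u x by (auto simp: strongly_mpsh_on_def)
  also have "\<dots> = (\<Sum>c\<in>{a, b}. hess u x c c)"
    using u x by (intro trace_on_eq[OF bilinear_hess B]) (auto simp: strongly_mpsh_on_def)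
  finally show ?thesis using ne by simp
qed

text \<open>Orthonormal pairs over \<open>K\<close> form the compact set \<open>T\<close>, on which
  the continuous trace has a positive minimum; homogeneity extends the bound to conformal pairs. The
  slack \<kappa> is what later pays for subtracting multiples of squared distances.\<close>

lemma strongly_mpsh_uniform:
  fixes u :: "'a::euclidean_space \<Rightarrow> real"
  assumes u: "strongly_mpsh_on U u" and K: "compact K" "K \<subseteq> U"
  obtains \<kappa> where "\<kappa> > 0"
    "\<And>x a b. \<lbrakk>x \<in> K; norm a = norm b; a \<bullet> b = 0\<rbrakk> \<Longrightarrow> \<kappa> * (a \<bullet> a) \<le> hess u x a a + hess u x b b"
proof -
  have U: "open U" "C2_on U u" using u by (auto simp: strongly_mpsh_on_def)
  obtain u' u'' where D: "C2_derivs U u u' u''" using U by (auto simp: C2_on_iff)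
  note cu = C2_derivsD(3)[OF D] and he = C2_derivsD(7)[OF D U(1)]
  define Q where "Q = (\<lambda>(x, a, b). u'' x a a + u'' x b b)"
  define T where "T = (K \<times> sphere 0 1 \<times> sphere (0::'a) 1) \<inter> {(x, a, b). a \<bullet> b = 0}"
  have "closed {(x::'a, a::'a, b). a \<bullet> b = 0}"
    unfolding case_prod_beta by (intro closed_Collect_eq continuous_intros)
  then have T: "compact T" unfolding T_def by (intro compact_Int_closed compact_Times K compact_sphere)
  have "continuous_on T Q" unfolding Q_def case_prod_beta
    by (intro continuous_intros continuous_on_compose2[OF cu]) (use K T_def in auto)
  then obtain \<kappa> where \<kappa>: "\<kappa> > 0" "\<And>t. t \<in> T \<Longrightarrow> \<kappa> \<le> Q t"
  proof (cases "T = {}")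
    case True then show ?thesis using that[of 1] by auto
  next
    case False
    then obtain t where t: "t \<in> T" "\<And>t'. t' \<in> T \<Longrightarrow> Q t \<le> Q t'"
      using continuous_attains_inf[OF T _ \<open>continuous_on T Q\<close>] by blast
    obtain x a b where "t = (x, a, b)" by (cases t)
    then have "Q t > 0" using t(1) K strongly_mpsh_hess_pos[OF u, of x a b] he by (auto simp: T_def Q_def)
    with t that show ?thesis by blast
  qed
  show thesis
  proof (rule that[OF \<kappa>(1)])
    fix x a b assume *: "x \<in> K" "norm (a::'a) = norm b" "a \<bullet> b = 0"
    show "\<kappa> * (a \<bullet> a) \<le> hess u x a a + hess u x b b"
    proof (cases "a = 0")
      case True then show ?thesis using * K by (auto simp: he subset_iff)
    next
      case False
      define r where "r = norm a"
      have r: "r > 0" "a \<bullet> a = r^2" using False by (auto simp: r_def power2_norm_eq_inner)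
      have "(x, a /\<^sub>R r, b /\<^sub>R r) \<in> T" using * r False by (auto simp: T_def r_def)
      from \<kappa>(2)[OF this] have "\<kappa> \<le> (u'' x a a + u'' x b b) / r^2"
        by (simp add: Q_def blinfun.scaleR_left blinfun.scaleR_right power2_eq_square field_simps add_divide_distrib)
      then show ?thesis using r * K by (auto simp: he subset_iff field_simps)
    qed
  qed
qed

section \<open>Circle means\<close>

lemma continuous_on_circle:
  assumes "continuous_on (ball 0 \<rho>) g" "0 \<le> r" "r < \<rho>"
  shows "continuous_on A (\<lambda>t. g (of_real r * cis t))"
  by (rule continuous_on_compose2[OF assms(1)]) (use assms in \<open>auto intro!: continuous_intros simp: norm_mult\<close>)

lemma DERIV_along_ray:
  fixes g :: "complex \<Rightarrow> real"
  assumes "(g has_derivative (\<lambda>k. Re k * x + Im k * y)) (at (of_real s * cis t))"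
  shows "((\<lambda>s. g (of_real s * cis t)) has_real_derivative cos t * x + sin t * y) (at s within A)"
proof -
  have "((\<lambda>s. of_real s * cis t) has_derivative (\<lambda>h. of_real h * cis t)) (at s within A)"
    by (auto intro!: derivative_eq_intros)
  from has_derivative_compose[OF this assms] show ?thesis
    unfolding has_field_derivative_def by (rule has_derivative_eq_rhs) (auto simp: algebra_simps)
qed

lemma DERIV_along_circle:
  fixes g :: "complex \<Rightarrow> real"
  assumes "(g has_derivative (\<lambda>k. Re k * x + Im k * y)) (at (of_real s * cis t))"
  shows "((\<lambda>t. g (of_real s * cis t)) has_real_derivative s * (cos t * y - sin t * x)) (at t within A)"
proof -
  have "((\<lambda>t. of_real s * cis t) has_derivative (\<lambda>h. of_real s * (h *\<^sub>R (\<i> * cis t)))) (at t within A)"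
    by (auto intro!: derivative_eq_intros)
  from has_derivative_compose[OF this assms] show ?thesis
    unfolding has_field_derivative_def by (rule has_derivative_eq_rhs) (auto simp: algebra_simps)
qed

text \<open>For a weight with \<open>w'' = - \<nu> w\<close> the polar form of the Laplacian becomes an ordinary
  differential equation for the weighted circle means of \<open>W\<close>; \<open>w = 1\<close> gives the mean value
  inequality and \<open>w = cos\<close> the formula for the gradient.\<close>

lemma circle_means:
  fixes W :: "complex \<Rightarrow> real" and w w' :: "real \<Rightarrow> real"
  assumes P: "C2_planar (ball 0 \<rho>) W p q a b c d" and s0: "0 < s0" "s0 < \<rho>"
    and w: "\<And>t. (w has_real_derivative w' t) (at t)" "\<And>t. (w' has_real_derivative - (\<nu> * w t)) (at t)"
    and per: "w (2 * pi) = w 0" "w' (2 * pi) = w' 0"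
    and m_def: "m = (\<lambda>s. integral {0..2*pi} (\<lambda>t. W (of_real s * cis t) * w t))"
    and k_def: "k = (\<lambda>s. integral {0..2*pi} (\<lambda>t. s * (cos t * p (of_real s * cis t) + sin t * q (of_real s * cis t)) * w t))"
  obtains m1 k1 where
    "\<forall>s\<in>{0..s0}. (m has_real_derivative m1 s) (at s within {0..s0})"
    "\<forall>s\<in>{0..s0}. (k has_real_derivative k1 s) (at s within {0..s0})"
    "\<forall>s\<in>{0..s0}. s * m1 s = k s"
    "\<forall>s\<in>{0..s0}.
      s * k1 s = s^2 * integral {0..2*pi} (\<lambda>t. (a (of_real s * cis t) + d (of_real s * cis t)) * w t) + \<nu> * m s"
    "m1 0 = integral {0..2*pi} (\<lambda>t. (cos t * p 0 + sin t * q 0) * w t)"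
proof -
  let ?z = "\<lambda>s t. of_real s * cis t :: complex"
  have dW: "\<And>z. z \<in> ball 0 \<rho> \<Longrightarrow> (W has_derivative (\<lambda>k. Re k * p z + Im k * q z)) (at z)"
    and dp: "\<And>z. z \<in> ball 0 \<rho> \<Longrightarrow> (p has_derivative (\<lambda>k. Re k * a z + Im k * b z)) (at z)"
    and dq: "\<And>z. z \<in> ball 0 \<rho> \<Longrightarrow> (q has_derivative (\<lambda>k. Re k * c z + Im k * d z)) (at z)"
    and cont: "continuous_on (ball 0 \<rho>) a" "continuous_on (ball 0 \<rho>) b"
      "continuous_on (ball 0 \<rho>) c" "continuous_on (ball 0 \<rho>) d"
    using P unfolding C2_planar_def by auto
  have contW: "continuous_on (ball 0 \<rho>) W" "continuous_on (ball 0 \<rho>) p" "continuous_on (ball 0 \<rho>) q"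
    using dW dp dq by (auto intro!: continuous_at_imp_continuous_on has_derivative_continuous)
  have inb: "?z s t \<in> ball 0 \<rho>" if "s \<in> {0..s0}" for s t using that s0 by (simp add: norm_mult)
  have cw: "continuous_on UNIV w" "continuous_on UNIV w'"
    using w by (auto intro!: DERIV_continuous_on)
  have comp1: "continuous_on A (\<lambda>t. g (?z s t))" if "s \<in> {0..s0}" "continuous_on (ball 0 \<rho>) g"
    for g :: "complex \<Rightarrow> real" and A s
    using inb[OF that(1)] by (intro continuous_on_compose2[OF that(2)] continuous_intros) auto
  have comp2: "continuous_on ({0..s0} \<times> cbox 0 (2*pi)) (\<lambda>x. g (?z (fst x) (snd x)))"
    if "continuous_on (ball 0 \<rho>) g" for g :: "complex \<Rightarrow> real"
    using inb by (intro continuous_on_compose2[OF that] continuous_intros) auto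
  have w1: "continuous_on A (\<lambda>x. w (h x))" if "continuous_on A h" for A and h :: "'b::topological_space \<Rightarrow> real"
    by (rule continuous_on_compose2[OF cw(1) that]) simp
  \<comment> \<open>\<open>P1\<close> and \<open>R\<close> are the first and second radial
    derivatives of \<open>W\<close>. Hence \<open>m1\<close> is the derivative of \<open>m\<close>,
    \<open>k\<close> is \<open>s * m1\<close>, and \<open>k1\<close> is the derivative of
    \<open>k\<close>, all under the integral sign.\<close>
  define P1 where "P1 s t = cos t * p (?z s t) + sin t * q (?z s t)" for s t
  define R where "R s t = cos t * (cos t * a (?z s t) + sin t * b (?z s t)) + sin t * (cos t * c (?z s t) + sin t * d (?z s t))" for s t
  define m1 where "m1 s = integral (cbox 0 (2*pi)) (\<lambda>t. P1 s t * w t)" for s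
  define k1 where "k1 s = integral (cbox 0 (2*pi)) (\<lambda>t. (P1 s t + s * R s t) * w t)" for s
  have dP1: "((\<lambda>s. P1 s t) has_real_derivative R s t) (at s within A)" if "s \<in> {0..s0}" for s t A
    unfolding P1_def R_def using DERIV_along_ray[OF dp[OF inb[OF that]]] DERIV_along_ray[OF dq[OF inb[OF that]]]
    by (auto intro!: derivative_eq_intros)
  show thesis
  proof (rule that; (rule ballI)?)
    fix s assume s: "s \<in> {0..s0}"
    show "(m has_real_derivative m1 s) (at s within {0..s0})"
      unfolding m_def m1_def cbox_interval[of 0 "2*pi", symmetric]
    proof (rule leibniz_rule_field_derivative[where fx = "\<lambda>s t. P1 s t * w t"])
      show "((\<lambda>s. W (?z s t) * w t) has_real_derivative P1 s t * w t) (at s within {0..s0})" if "s \<in> {0..s0}" for s t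
        unfolding P1_def by (rule DERIV_cmult_right[OF DERIV_along_ray[OF dW[OF inb[OF that]]]])
      show "(\<lambda>t. W (?z s t) * w t) integrable_on cbox 0 (2 * pi)" if "s \<in> {0..s0}" for s
        by (intro integrable_continuous continuous_intros comp1 w1 that contW)
      show "continuous_on ({0..s0} \<times> cbox 0 (2 * pi)) (\<lambda>(s, t). P1 s t * w t)"
        unfolding P1_def case_prod_beta by (intro continuous_intros comp2 w1 contW)
    qed (use s in auto)
    show "(k has_real_derivative k1 s) (at s within {0..s0})"
      unfolding k_def k1_def cbox_interval[of 0 "2*pi", symmetric] P1_def[symmetric]
    proof (rule leibniz_rule_field_derivative[where fx = "\<lambda>s t. (P1 s t + s * R s t) * w t"])
      show "((\<lambda>s. s * P1 s t * w t) has_real_derivative (P1 s t + s * R s t) * w t) (at s within {0..s0})" if "s \<in> {0..s0}" for s t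
        using dP1[OF that] by (auto intro!: derivative_eq_intros simp: algebra_simps)
      show "(\<lambda>t. s * P1 s t * w t) integrable_on cbox 0 (2 * pi)" if "s \<in> {0..s0}" for s
        unfolding P1_def by (intro integrable_continuous continuous_intros comp1 w1 that contW)
      show "continuous_on ({0..s0} \<times> cbox 0 (2 * pi)) (\<lambda>(s, t). (P1 s t + s * R s t) * w t)"
        unfolding P1_def R_def case_prod_beta by (intro continuous_intros comp2 w1 contW cont)
    qed (use s in auto)
    show "s * m1 s = k s"
      unfolding m1_def k_def P1_def cbox_interval by (simp add: mult.assoc)
    \<comment> \<open>\<open>T\<close> and \<open>T'\<close> are the first and second angular
      derivatives of \<open>W\<close> on the circle of radius \<open>s\<close>.\<close>
    define T where "T t = s * (cos t * q (?z s t) - sin t * p (?z s t))" for t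
    define T' where "T' t = s * (cos t * (s * (cos t * d (?z s t) - sin t * c (?z s t))) - sin t * q (?z s t)
       - (sin t * (s * (cos t * b (?z s t) - sin t * a (?z s t))) + cos t * p (?z s t)))" for t
    have dT: "(T has_real_derivative T' t) (at t within A)" for t A
      unfolding T_def T'_def
      using DERIV_along_circle[OF dp[OF inb[OF s]]] DERIV_along_circle[OF dq[OF inb[OF s]]]
      by (auto intro!: derivative_eq_intros simp: algebra_simps)
    have dWt: "((\<lambda>t. W (?z s t)) has_real_derivative T t) (at t within A)" for t A
      unfolding T_def using DERIV_along_circle[OF dW[OF inb[OF s]]] .
    \<comment> \<open>Two integrations by parts at once: the boundary terms cancel by periodicity,
      and \<open>w'' = - \<nu> w\<close> turns the integral of \<open>T' w\<close> into
      \<open>- \<nu> m\<close>.\<close>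
    have "((\<lambda>t. T t * w t - W (?z s t) * w' t) has_real_derivative T' t * w t + \<nu> * (W (?z s t) * w t)) (at t within A)" for t A
      by (rule DERIV_cong[OF DERIV_diff[OF DERIV_mult[OF dT has_field_derivative_at_within[OF w(1)]]
            DERIV_mult[OF dWt has_field_derivative_at_within[OF w(2)]]]]) (simp add: algebra_simps)
    then have "((\<lambda>t. T' t * w t + \<nu> * (W (?z s t) * w t)) has_integral
        (T (2*pi) * w (2*pi) - W (?z s (2*pi)) * w' (2*pi)) - (T 0 * w 0 - W (?z s 0) * w' 0)) {0..2*pi}"
      by (intro fundamental_theorem_of_calculus) (auto simp: has_real_derivative_iff_has_vector_derivative)
    then have I: "((\<lambda>t. T' t * w t + \<nu> * (W (?z s t) * w t)) has_integral 0) {0..2*pi}"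
      by (simp add: per T_def)
    have i1: "(\<lambda>t. W (?z s t) * w t) integrable_on {0..2*pi}"
      by (intro integrable_continuous_interval continuous_intros comp1 w1 s contW)
    have i2: "(\<lambda>t. (a (?z s t) + d (?z s t)) * w t) integrable_on {0..2*pi}"
      by (intro integrable_continuous_interval continuous_intros comp1 w1 s cont)
    have pt: "s * ((P1 s t + s * R s t) * w t) = s^2 * ((a (?z s t) + d (?z s t)) * w t)
        - (T' t * w t + \<nu> * (W (?z s t) * w t)) + \<nu> * (W (?z s t) * w t)" for t
    proof -
      \<comment> \<open>The polar form of the Laplacian; the mixed terms in \<open>b\<close> and in
        \<open>c\<close> cancel between the radial and the angular part.\<close>
      have "s * (P1 s t + s * R s t) + T' t = s^2 * ((sin t^2 + cos t^2) * (a (?z s t) + d (?z s t)))"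
        unfolding P1_def R_def T'_def by (simp only: power2_eq_square) algebra
      then have "s * (P1 s t + s * R s t) + T' t = s^2 * (a (?z s t) + d (?z s t))" by simp
      then show ?thesis by algebra
    qed
    have "s * k1 s = integral {0..2*pi} (\<lambda>t. s * ((P1 s t + s * R s t) * w t))"
      unfolding k1_def cbox_interval by simp
    also have "\<dots> = s^2 * integral {0..2*pi} (\<lambda>t. (a (?z s t) + d (?z s t)) * w t) - 0 + \<nu> * m s"
      unfolding pt m_def
      by (intro integral_unique has_integral_add has_integral_diff I has_integral_mult_right integrable_integral i1 i2)
    finally show "s * k1 s = s^2 * integral {0..2*pi} (\<lambda>t. (a (?z s t) + d (?z s t)) * w t) + \<nu> * m s" by simp
  next
    show "m1 0 = integral {0..2*pi} (\<lambda>t. (cos t * p 0 + sin t * q 0) * w t)"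
      by (simp add: m1_def P1_def)
  qed
qed

text \<open>With \<open>\<nu> = 0\<close> the equation reads
  \<open>(s m')' = s * (integral of the Laplacian) >= 0\<close>. As \<open>s m'\<close> vanishes at
  0, \<open>m' >= 0\<close>, so \<open>m\<close> grows from \<open>m 0 = 2 pi W(0)\<close>.\<close>

lemma subharmonic_mean_le:
  assumes P: "C2_planar (ball 0 \<rho>) W p q a b c d" and s: "0 < s" "s < \<rho>"
    and sub: "\<And>z. z \<in> ball 0 \<rho> \<Longrightarrow> 0 \<le> a z + d z"
  shows "2 * pi * W 0 \<le> integral {0..2*pi} (\<lambda>t. W (of_real s * cis t))"
proof -
  define m where "m = (\<lambda>s. integral {0..2*pi} (\<lambda>t. W (of_real s * cis t) * 1))"
  define k where "k = (\<lambda>s. integral {0..2*pi} (\<lambda>t. s * (cos t * p (of_real s * cis t) + sin t * q (of_real s * cis t)) * 1))"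
  have dw: "((\<lambda>t. 1) has_real_derivative 0) (at t)" "((\<lambda>t. 0) has_real_derivative - (0 * 1)) (at t)" for t :: real
    by auto
  note cm = circle_means[where w = "\<lambda>_. 1" and w' = "\<lambda>_. 0" and \<nu> = 0, OF P s dw refl refl m_def k_def]
  obtain m1 k1 where
    dm: "\<forall>r\<in>{0..s}. (m has_real_derivative m1 r) (at r within {0..s})"
    and dk: "\<forall>r\<in>{0..s}. (k has_real_derivative k1 r) (at r within {0..s})"
    and m1: "\<forall>r\<in>{0..s}. r * m1 r = k r"
    and k1: "\<forall>r\<in>{0..s}.
      r * k1 r = r^2 * integral {0..2*pi} (\<lambda>t. (a (of_real r * cis t) + d (of_real r * cis t)) * 1) + 0 * m r"
    and "m1 0 = integral {0..2*pi} (\<lambda>t. (cos t * p 0 + sin t * q 0) * 1)"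
    by (rule cm)
  note dm = bspec[OF dm] and dk = bspec[OF dk] and m1 = bspec[OF m1] and k1 = bspec[OF k1]
  have at: "at r within {0..s} = at r" if "0 < r" "r < s" for r
    using that by (intro at_within_interior) auto
  have k1: "k1 r \<ge> 0" if "0 < r" "r < s" for r
  proof -
    have "0 \<le> integral {0..2*pi} (\<lambda>t. (a (of_real r * cis t) + d (of_real r * cis t)) * 1)"
    proof (intro integral_nonneg)
      have "continuous_on {0..2*pi} (\<lambda>t. a (of_real r * cis t))" "continuous_on {0..2*pi} (\<lambda>t. d (of_real r * cis t))"
        using P that s unfolding C2_planar_def by (auto intro: continuous_on_circle)
      then show "(\<lambda>t. (a (of_real r * cis t) + d (of_real r * cis t)) * 1) integrable_on {0..2*pi}"
        by (intro integrable_continuous_interval continuous_intros)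
    qed (use that s in \<open>auto intro!: sub simp: norm_mult\<close>)
    then have "0 \<le> r * k1 r" using k1[of r] that by simp
    then show ?thesis using that by (simp add: zero_le_mult_iff)
  qed
  have kk: "k r \<ge> 0" if "r \<in> {0..s}" for r
  proof -
    have "k 0 \<le> k r"
    proof (rule DERIV_nonneg_imp_increasing_open[of 0 r k])
      show "\<exists>y. (k has_real_derivative y) (at x) \<and> 0 \<le> y" if "0 < x" "x < r" for x
        using dk[of x] k1[of x] at[of x] that \<open>r \<in> {0..s}\<close> by auto
      show "continuous_on {0..r} k"
        using continuous_on_subset[OF DERIV_continuous_on[OF dk]] that by auto
    qed (use that in auto)
    then show ?thesis by (simp add: k_def)
  qed
  have "m 0 \<le> m s"
  proof (rule DERIV_nonneg_imp_increasing_open[of 0 s m])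
    fix x assume x: "0 < x" "x < s"
    have "0 \<le> x * m1 x" using m1[of x] kk[of x] x by simp
    then show "\<exists>y. (m has_real_derivative y) (at x) \<and> 0 \<le> y"
      using dm[of x] at[of x] x by (auto simp: zero_le_mult_iff)
  qed (use s DERIV_continuous_on[OF dm] in auto)
  then show ?thesis by (simp add: m_def)
qed

text \<open>With \<open>\<nu> = 1\<close> the mean against \<open>cos\<close> solves the Euler
  equation \<open>s (s m')' = m\<close>, whose solutions are combinations of \<open>s\<close> and
  \<open>1/s\<close>. Regularity at 0 leaves \<open>m s = pi * p 0 * s\<close>, and
  \<open>|m s|\<close> is at most the mean of \<open>|W|\<close>.\<close>

lemma harmonic_gradient_bound:
  assumes P: "C2_planar (ball 0 \<rho>) W p q a b c d" and s: "0 < s" "s < \<rho>"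
    and harm: "\<And>z. z \<in> ball 0 \<rho> \<Longrightarrow> a z + d z = 0"
  shows "pi * s * \<bar>p 0\<bar> \<le> integral {0..2*pi} (\<lambda>t. \<bar>W (of_real s * cis t)\<bar>)"
proof -
  define m where "m = (\<lambda>s. integral {0..2*pi} (\<lambda>t. W (of_real s * cis t) * cos t))"
  define k where "k = (\<lambda>s. integral {0..2*pi} (\<lambda>t. s * (cos t * p (of_real s * cis t) + sin t * q (of_real s * cis t)) * cos t))"
  have dw: "(cos has_real_derivative - sin t) (at t)" "((\<lambda>t. - sin t) has_real_derivative - (1 * cos t)) (at t)" for t :: real
    by (auto intro!: derivative_eq_intros)
  have per: "cos (2 * pi) = cos 0" "- sin (2 * pi) = - sin 0" by auto
  note cm = circle_means[where w = cos and w' = "\<lambda>t. - sin t" and \<nu> = 1, OF P s dw per m_def k_def]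
  obtain m1 k1 where
    dm: "\<forall>r\<in>{0..s}. (m has_real_derivative m1 r) (at r within {0..s})"
    and dk: "\<forall>r\<in>{0..s}. (k has_real_derivative k1 r) (at r within {0..s})"
    and m1: "\<forall>r\<in>{0..s}. r * m1 r = k r"
    and k1: "\<forall>r\<in>{0..s}.
      r * k1 r = r^2 * integral {0..2*pi} (\<lambda>t. (a (of_real r * cis t) + d (of_real r * cis t)) * cos t) + 1 * m r"
    and m10: "m1 0 = integral {0..2*pi} (\<lambda>t. (cos t * p 0 + sin t * q 0) * cos t)"
    by (rule cm)
  note dm = bspec[OF dm] and dk = bspec[OF dk] and m1 = bspec[OF m1] and k1 = bspec[OF k1]
  have k1: "r * k1 r = m r" if "r \<in> {0..s}" for r
    using k1[OF that] that s harm by (simp add: norm_mult)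
  have "((\<lambda>t. (cos t * p 0 + sin t * q 0) * cos t) has_integral
      ((2*pi/2 + sin (2*pi) * cos (2*pi) / 2) * p 0 + sin (2*pi)^2/2 * q 0)
      - ((0/2 + sin 0 * cos 0 / 2) * p 0 + sin 0^2/2 * q 0)) {0..2*pi}"
  proof (rule fundamental_theorem_of_calculus)
    fix t :: real
    have "((\<lambda>t. (t/2 + sin t * cos t / 2) * p 0 + sin t^2/2 * q 0) has_real_derivative
       (1/2 + (cos t * cos t - sin t * sin t)/2) * p 0 + sin t * cos t * q 0) (at t within {0..2*pi})"
      by (auto intro!: derivative_eq_intros simp: algebra_simps add_divide_distrib diff_divide_distrib)
    moreover have "1/2 + (cos t * cos t - sin t * sin t)/2 = cos t * cos t"
      using sin_cos_squared_add[of t] by (simp add: power2_eq_square field_simps)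
    ultimately have "((\<lambda>t. (t/2 + sin t * cos t / 2) * p 0 + sin t^2/2 * q 0) has_real_derivative
       (cos t * p 0 + sin t * q 0) * cos t) (at t within {0..2*pi})"
      by (simp add: algebra_simps)
    then show "((\<lambda>t. (t/2 + sin t * cos t / 2) * p 0 + sin t^2/2 * q 0) has_vector_derivative
       (cos t * p 0 + sin t * q 0) * cos t) (at t within {0..2*pi})"
      by (simp add: has_real_derivative_iff_has_vector_derivative)
  qed simp
  then have m10: "m1 0 = pi * p 0" unfolding m10 by (simp add: integral_unique)
  \<comment> \<open>\<open>r * (k r - m r)\<close> is constant and zero at \<open>r = 0\<close>,
    which excludes the solution \<open>1/s\<close>. Then \<open>r m' = m\<close>, so that
    \<open>m r / r\<close> is constant.\<close>
  have "((\<lambda>r. r * (k r - m r)) has_real_derivative 0) (at r within {0..s})" if "r \<in> {0..s}" for r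
    using dk[OF that] dm[OF that] m1[OF that] k1[OF that]
    by (auto intro!: derivative_eq_intros simp: algebra_simps)
  then have J: "r * (k r - m r) = 0 * (k 0 - m 0)" if "r \<in> {0..s}" for r
    using has_derivative_zero_unique[of "{0..s}" "\<lambda>r. r * (k r - m r)" 0 r] that s
    unfolding has_field_derivative_def by (simp add: lambda_zero)
  have km: "k r = m r" if "0 < r" "r \<le> s" for r using J[of r] that by simp
  have "((\<lambda>r. m r / r) has_real_derivative 0) (at r within {0<..s})" if "r \<in> {0<..s}" for r
  proof -
    have "(m has_real_derivative m1 r) (at r within {0<..s})" using that by (intro DERIV_subset[OF dm]) auto
    then show ?thesis using m1[of r] km[of r] that
      by (auto intro!: derivative_eq_intros simp: algebra_simps)
  qed
  then have quot: "m r / r = m s / s" if "r \<in> {0<..s}" for r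
    using has_derivative_zero_unique[of "{0<..s}" "\<lambda>r. m r / r" s r] that s
    unfolding has_field_derivative_def by (simp add: lambda_zero)
  have m0: "m 0 = 0"
    using J[of s] integral_unique[OF fundamental_theorem_of_calculus[of 0 "2*pi" "\<lambda>t. W 0 * sin t" "\<lambda>t. W 0 * cos t"]]
    unfolding m_def by (auto intro!: derivative_eq_intros simp: has_real_derivative_iff_has_vector_derivative[symmetric])
  have lin: "m s / s * r = m r" if "r \<in> {0..s}" for r
    using quot[of r] m0 that by (cases "r = 0") (auto simp: field_simps)
  \<comment> \<open>The slope of the linear function \<open>m\<close> is compared with
    \<open>m1 0\<close> through uniqueness of the one-sided derivative at 0.\<close>
  have "((\<lambda>r. m s / s * r) has_real_derivative m s / s) (at 0 within {0..s})"
    using s by (auto intro!: derivative_eq_intros)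
  then have "(m has_real_derivative m s / s) (at 0 within {0..s})"
    by (rule has_field_derivative_transform_within[OF _ zero_less_one]) (use s lin in auto)
  moreover have "at 0 within {0..s} \<noteq> bot" using s by (simp add: trivial_limit_within islimpt_Icc)
  ultimately have "m1 0 = m s / s"
    using dm[of 0] s unfolding has_field_derivative_iff by (auto intro: tendsto_unique)
  then have ms: "m s = pi * s * p 0" using m10 s by (simp add: field_simps)
  have c: "continuous_on {0..2*pi} (\<lambda>t. W (of_real s * cis t))"
  proof (rule continuous_on_circle)
    show "continuous_on (ball 0 \<rho>) W"
      using P unfolding C2_planar_def by (auto intro!: continuous_at_imp_continuous_on has_derivative_continuous)
  qed (use s in auto)
  have "norm (m s) \<le> integral {0..2*pi} (\<lambda>t. \<bar>W (of_real s * cis t)\<bar>)"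
    unfolding m_def
    by (intro integral_norm_bound_integral integrable_continuous_interval continuous_intros c)
       (auto simp: abs_mult intro!: mult_left_le)
  then show ?thesis using s by (simp add: ms abs_mult)
qed

section \<open>A maximum principle\<close>

text \<open>If \<open>b > 0\<close>, then \<open>g'\<close>, which vanishes at the maximum, is
  positive just to the right of it, and \<open>g\<close> increases there. This argument uses the
  second derivative at the single point 0.\<close>

lemma second_derivative_nonpos_at_max:
  fixes g :: "real \<Rightarrow> real"
  assumes e: "e > 0" and g: "\<And>t. \<bar>t\<bar> < e \<Longrightarrow> (g has_real_derivative g' t) (at t)"
    and g': "(g' has_real_derivative b) (at 0)" and max: "\<And>t. \<bar>t\<bar> < e \<Longrightarrow> g t \<le> g 0"
  shows "b \<le> 0"
proof (rule ccontr)
  assume "\<not> b \<le> 0"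
  then obtain d where d: "d > 0" "\<And>h. 0 < h \<Longrightarrow> h < d \<Longrightarrow> g' 0 < g' (0 + h)"
    using DERIV_pos_inc_right[OF g'] by (auto simp: not_le)
  have "g' 0 = 0" using DERIV_local_max[OF g[of 0] e] e max by simp
  define h where "h = min d e / 2"
  have h: "0 < h" "h < d" "h < e" using d(1) e by (auto simp: h_def min_def)
  have "g 0 < g h"
  proof (rule DERIV_pos_imp_increasing_open[OF h(1)])
    show "\<exists>y. (g has_real_derivative y) (at x) \<and> 0 < y" if "0 < x" "x < h" for x
      using that h g[of x] d(2)[of x] \<open>g' 0 = 0\<close> by auto
    show "continuous_on {0..h} g"
      using h by (intro continuous_at_imp_continuous_on ballI DERIV_isCont[OF g]) auto
  qed
  then show False using max[of h] h by simp
qed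

text \<open>\<open>N t\<close> is \<open>|z0 + t v|^2\<close> for a unit vector \<open>v\<close>,
  with \<open>n = |z0|^2\<close> and \<beta> the inner product of \<open>v\<close> and
  \<open>z0\<close>. The left-hand side of the conclusion is the second derivative at 0 of
  \<open>log Q + A \<Phi> - log |z| + |z|^2\<close> along this line.\<close>

lemma log_second_derivative_at_max:
  fixes Q \<Phi> :: "real \<Rightarrow> real" and n \<beta> :: real
  defines "N \<equiv> \<lambda>t. n + 2 * \<beta> * t + t^2"
  assumes e: "e > 0"
    and Q: "\<And>t. \<bar>t\<bar> < e \<Longrightarrow> (Q has_real_derivative Q1 t) (at t)" "(Q1 has_real_derivative Q2) (at 0)"
    and \<Phi>: "\<And>t. \<bar>t\<bar> < e \<Longrightarrow> (\<Phi> has_real_derivative \<Phi>1 t) (at t)" "(\<Phi>1 has_real_derivative \<Phi>2) (at 0)"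
    and pos: "\<And>t. \<bar>t\<bar> < e \<Longrightarrow> 0 < Q t" "\<And>t. \<bar>t\<bar> < e \<Longrightarrow> 0 < N t"
    and max: "\<And>t. \<bar>t\<bar> < e \<Longrightarrow>
      ln (Q t) + A * \<Phi> t - ln (N t) / 2 + N t \<le> ln (Q 0) + A * \<Phi> 0 - ln (N 0) / 2 + N 0"
  shows "Q2 / Q 0 - (Q1 0 / Q 0)^2 + A * \<Phi>2 - 1 / n + 2 * (\<beta> / n)^2 + 2 \<le> 0"
proof (rule second_derivative_nonpos_at_max[OF e])
  define g where "g t = ln (Q t) + A * \<Phi> t - ln (N t) / 2 + N t" for t
  define g' where "g' t = Q1 t / Q t + A * \<Phi>1 t - (\<beta> + t) / N t + 2 * (\<beta> + t)" for t
  have N: "(N has_real_derivative 2 * (\<beta> + t)) (at t)" for t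
    unfolding N_def by (auto intro!: derivative_eq_intros)
  show "(g has_real_derivative g' t) (at t)" if t: "\<bar>t\<bar> < e" for t
  proof -
    note lnQ = DERIV_chain2[OF DERIV_ln_divide[OF pos(1)[OF t]] Q(1)[OF t]]
      and lnN = DERIV_chain2[OF DERIV_ln_divide[OF pos(2)[OF t]] N]
    from DERIV_add[OF DERIV_diff[OF DERIV_add[OF lnQ DERIV_cmult[OF \<Phi>(1)[OF t], of A]] DERIV_cdivide[OF lnN, of 2]] N]
    show ?thesis unfolding g_def g'_def by (rule DERIV_cong) (use pos(2)[OF t] in \<open>simp add: field_simps\<close>)
  qed
  have e0: "\<bar>0\<bar> < e" using e by simp
  have n: "N 0 = n" "n > 0" using pos(2)[OF e0] by (auto simp: N_def)
  have q: "Q 0 > 0" using pos(1)[OF e0] .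
  have 1: "((\<lambda>t. Q1 t / Q t) has_real_derivative (Q2 * Q 0 - Q1 0 * Q1 0) / (Q 0 * Q 0)) (at 0)"
    using q by (intro DERIV_divide Q(2) Q(1)[OF e0]) auto
  have "((\<lambda>t. \<beta> + t) has_real_derivative 1) (at 0)" by (auto intro!: derivative_eq_intros)
  then have 2: "((\<lambda>t. (\<beta> + t) / N t) has_real_derivative (1 * N 0 - (\<beta> + 0) * (2 * (\<beta> + 0))) / (N 0 * N 0)) (at 0)"
    using n by (intro DERIV_divide N) auto
  have 3: "((\<lambda>t. 2 * (\<beta> + t)) has_real_derivative 2) (at 0)" by (auto intro!: derivative_eq_intros)
  from DERIV_add[OF DERIV_diff[OF DERIV_add[OF 1 DERIV_cmult[OF \<Phi>(2), of A]] 2] 3]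
  show "(g' has_real_derivative Q2 / Q 0 - (Q1 0 / Q 0)^2 + A * \<Phi>2 - 1 / n + 2 * (\<beta> / n)^2 + 2) (at 0)"
    unfolding g'_def using q n by (elim DERIV_cong) (simp add: field_simps power2_eq_square)
  show "g t \<le> g 0" if "\<bar>t\<bar> < e" for t using max[OF that] by (simp add: g_def)
qed

lemma DERIV_along_line:
  fixes g :: "complex \<Rightarrow> real"
  assumes "(g has_derivative (\<lambda>k. Re k * x + Im k * y)) (at (z + of_real t * v))"
  shows "((\<lambda>t. g (z + of_real t * v)) has_real_derivative Re v * x + Im v * y) (at t)"
proof -
  have "((\<lambda>t. z + of_real t * v) has_derivative (\<lambda>h. of_real h * v)) (at t)"
    by (auto intro!: derivative_eq_intros)
  from has_derivative_compose[OF this assms] show ?thesis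
    unfolding has_field_derivative_def by (rule has_derivative_eq_rhs) (auto simp: algebra_simps)
qed

text \<open>The function compared here is \<open>exp\<close> of the strictly subharmonic function
  \<open>log Q + A \<Phi> - log |z| + |z|\<^sup>2\<close>.\<close>

lemma log_subharmonic_no_local_max:
  assumes Q: "C2_planar S Q p1 q1 a1 b1 c1 d1" and \<Phi>: "C2_planar S \<Phi> p2 q2 a2 b2 c2 d2"
    and z0: "z0 \<in> S" "z0 \<noteq> 0" "Q z0 > 0" and A: "A \<ge> 0"
    and sub: "0 \<le> a2 z0 + d2 z0" "(p1 z0)^2 + (q1 z0)^2 \<le> Q z0 * (a1 z0 + d1 z0)"
    and max: "\<forall>\<^sub>F z in nhds z0. Q z * exp (A * \<Phi> z) * (exp ((norm z)^2) / norm z)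
        \<le> Q z0 * exp (A * \<Phi> z0) * (exp ((norm z0)^2) / norm z0)"
  shows False
proof -
  have D: "\<And>z. z \<in> S \<Longrightarrow> (Q has_derivative (\<lambda>k. Re k * p1 z + Im k * q1 z)) (at z)"
    "\<And>z. z \<in> S \<Longrightarrow> (p1 has_derivative (\<lambda>k. Re k * a1 z + Im k * b1 z)) (at z)"
    "\<And>z. z \<in> S \<Longrightarrow> (q1 has_derivative (\<lambda>k. Re k * c1 z + Im k * d1 z)) (at z)"
    "\<And>z. z \<in> S \<Longrightarrow> (\<Phi> has_derivative (\<lambda>k. Re k * p2 z + Im k * q2 z)) (at z)"
    "\<And>z. z \<in> S \<Longrightarrow> (p2 has_derivative (\<lambda>k. Re k * a2 z + Im k * b2 z)) (at z)"
    "\<And>z. z \<in> S \<Longrightarrow> (q2 has_derivative (\<lambda>k. Re k * c2 z + Im k * d2 z)) (at z)"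
    and S: "open S" using Q \<Phi> by (auto simp: C2_planar_def)
  have "isCont Q z0" by (rule has_derivative_continuous[OF D(1)[OF z0(1)]])
  then have "\<forall>\<^sub>F z in nhds z0. Q z > 0"
    using z0(3) order_tendstoD(1)[of Q "Q z0" "nhds z0" 0] by (simp add: isCont_def tendsto_at_iff_tendsto_nhds)
  moreover have "\<forall>\<^sub>F z in nhds z0. z \<in> S \<and> z \<noteq> 0"
    using S z0 by (intro eventually_conj eventually_nhds_in_open t1_space_nhds) auto
  ultimately have "\<forall>\<^sub>F z in nhds z0. z \<in> S \<and> z \<noteq> 0 \<and> Q z > 0 \<and> Q z * exp (A * \<Phi> z) * (exp ((norm z)^2) / norm z)
        \<le> Q z0 * exp (A * \<Phi> z0) * (exp ((norm z0)^2) / norm z0)"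
    using max by eventually_elim auto
  then obtain e where e: "e > 0" and E: "\<And>z. dist z z0 < e \<Longrightarrow> z \<in> S \<and> z \<noteq> 0 \<and> Q z > 0 \<and>
      Q z * exp (A * \<Phi> z) * (exp ((norm z)^2) / norm z) \<le> Q z0 * exp (A * \<Phi> z0) * (exp ((norm z0)^2) / norm z0)"
    unfolding eventually_nhds_metric by blast
  define n where "n = (norm z0)^2"
  have n: "n > 0" using z0 by (simp add: n_def)
  have ln_eq: "ln (Q z * exp (A * \<Phi> z) * (exp ((norm z)^2) / norm z)) = ln (Q z) + A * \<Phi> z - ln ((norm z)^2) / 2 + (norm z)^2"
    if "Q z > 0" "z \<noteq> 0" for z
    using that by (simp add: ln_mult ln_div ln_realpow)
  have key: "ln (Q z) + A * \<Phi> z - ln ((norm z)^2) / 2 + (norm z)^2 \<le> ln (Q z0) + A * \<Phi> z0 - ln ((norm z0)^2) / 2 + (norm z0)^2"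
    if "dist z z0 < e" for z
    using E[OF that] z0(2,3) by (subst (1 2) ln_eq[symmetric]) (auto intro!: ln_mono mult_pos_pos divide_pos_pos)
  have line: "Q2 / Q z0 - (Q1 / Q z0)^2 + A * \<Phi>2 - 1 / n + 2 * (\<beta> / n)^2 + 2 \<le> 0"
    if v: "norm v = 1" "\<beta> = Re v * Re z0 + Im v * Im z0"
      and Q1: "Q1 = Re v * p1 z0 + Im v * q1 z0"
      and Q2: "Q2 = Re v * (Re v * a1 z0 + Im v * b1 z0) + Im v * (Re v * c1 z0 + Im v * d1 z0)"
      and \<Phi>2: "\<Phi>2 = Re v * (Re v * a2 z0 + Im v * b2 z0) + Im v * (Re v * c2 z0 + Im v * d2 z0)"
    for v Q1 Q2 \<Phi>2 \<beta>
  proof -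
    let ?l = "\<lambda>t. z0 + of_real t * v"
    have N: "(norm (?l t))^2 = n + 2 * \<beta> * t + t^2" for t
    proof -
      have "(norm (?l t))^2 = n + 2 * \<beta> * t + t^2 * ((Re v)^2 + (Im v)^2)"
        unfolding n_def v(2) cmod_power2 by (simp add: power2_eq_square algebra_simps)
      then show ?thesis using v(1) cmod_power2[of v] by simp
    qed
    have d: "dist (?l t) z0 < e" if "\<bar>t\<bar> < e" for t using that v by (simp add: dist_norm norm_mult)
    have "Q2 / Q (?l 0) - ((Re v * p1 (?l 0) + Im v * q1 (?l 0)) / Q (?l 0))^2 + A * \<Phi>2 - 1 / n + 2 * (\<beta> / n)^2 + 2 \<le> 0"
    proof (rule log_second_derivative_at_max[OF e, where Q = "\<lambda>t. Q (?l t)" and \<Phi> = "\<lambda>t. \<Phi> (?l t)"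
          and ?Q1.0 = "\<lambda>t. Re v * p1 (?l t) + Im v * q1 (?l t)" and ?\<Phi>1.0 = "\<lambda>t. Re v * p2 (?l t) + Im v * q2 (?l t)"])
      fix t assume t: "\<bar>t\<bar> < e"
      note Et = E[OF d[OF t]]
      have "0 < (norm (?l t))^2" using Et by simp
      then show "0 < n + 2 * \<beta> * t + t\<^sup>2" unfolding N .
      from Et show "((\<lambda>t. Q (?l t)) has_real_derivative Re v * p1 (?l t) + Im v * q1 (?l t)) (at t)"
        "((\<lambda>t. \<Phi> (?l t)) has_real_derivative Re v * p2 (?l t) + Im v * q2 (?l t)) (at t)"
        "0 < Q (?l t)"
        by (auto intro!: DERIV_along_line D)
      show "ln (Q (?l t)) + A * \<Phi> (?l t) - ln (n + 2 * \<beta> * t + t\<^sup>2) / 2 + (n + 2 * \<beta> * t + t\<^sup>2)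
         \<le> ln (Q (?l 0)) + A * \<Phi> (?l 0) - ln (n + 2 * \<beta> * 0 + 0\<^sup>2) / 2 + (n + 2 * \<beta> * 0 + 0\<^sup>2)"
        using key[OF d[OF t]] unfolding N by (simp add: n_def)
    next
      have "z0 + of_real 0 * v \<in> S" using z0 by simp
      note DD = D(2)[OF this] D(3)[OF this] D(5)[OF this] D(6)[OF this]
      show "((\<lambda>t. Re v * p1 (?l t) + Im v * q1 (?l t)) has_real_derivative Q2) (at 0)"
        using DERIV_add[OF DERIV_cmult[OF DERIV_along_line[OF DD(1)]] DERIV_cmult[OF DERIV_along_line[OF DD(2)]]]
        by (simp add: Q2)
      show "((\<lambda>t. Re v * p2 (?l t) + Im v * q2 (?l t)) has_real_derivative \<Phi>2) (at 0)"
        using DERIV_add[OF DERIV_cmult[OF DERIV_along_line[OF DD(3)]] DERIV_cmult[OF DERIV_along_line[OF DD(4)]]]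
        by (simp add: \<Phi>2)
    qed
    then show ?thesis by (simp add: Q1)
  qed
  \<comment> \<open>The directions 1 and \<open>\<i>\<close>; adding the two inequalities replaces
    second derivatives by Laplacians.\<close>
  have L1: "a1 z0 / Q z0 - (p1 z0 / Q z0)^2 + A * a2 z0 - 1 / n + 2 * (Re z0 / n)^2 + 2 \<le> 0"
    by (rule line[of 1]) auto
  have L2: "d1 z0 / Q z0 - (q1 z0 / Q z0)^2 + A * d2 z0 - 1 / n + 2 * (Im z0 / n)^2 + 2 \<le> 0"
    by (rule line[of \<i>]) auto
  \<comment> \<open>Harmonicity of \<open>log |z|\<close> away from 0: with this identity its
    contributions to \<open>L1\<close> and \<open>L2\<close> cancel.\<close>
  have "(Re z0 / n)^2 + (Im z0 / n)^2 = n / n^2" unfolding n_def cmod_power2 by (simp add: power_divide add_divide_distrib)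
  also have "\<dots> = 1 / n" using n by (simp add: power2_eq_square)
  finally have n3: "(Re z0 / n)^2 + (Im z0 / n)^2 = 1 / n" .
  \<comment> \<open>The assumption on \<open>Q\<close> is
    \<open>|grad Q|^2 <= Q * Laplacian Q\<close>, that is, subharmonicity of \<open>log Q\<close> at
    \<open>z0\<close>.\<close>
  have "(p1 z0 / Q z0)^2 + (q1 z0 / Q z0)^2 = ((p1 z0)^2 + (q1 z0)^2) / (Q z0)^2" by (simp add: power_divide add_divide_distrib)
  also have "\<dots> \<le> (Q z0 * (a1 z0 + d1 z0)) / (Q z0)^2" using sub(2) by (intro divide_right_mono) auto
  also have "\<dots> = a1 z0 / Q z0 + d1 z0 / Q z0" using z0(3) by (simp add: power2_eq_square field_simps)
  finally have q3: "(p1 z0 / Q z0)^2 + (q1 z0 / Q z0)^2 \<le> a1 z0 / Q z0 + d1 z0 / Q z0" .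
  have "0 \<le> A * (a2 z0 + d2 z0)" using A sub(1) by simp
  then have "0 \<le> A * a2 z0 + A * d2 z0" by (simp add: algebra_simps)
  \<comment> \<open>The left-hand sides of \<open>L1\<close> and \<open>L2\<close> add up to at
    least 4, the Laplacian of \<open>|z|^2\<close>.\<close>
  then show False using L1 L2 n3 q3 by linarith
qed

section \<open>Localisation of conformal harmonic discs\<close>

lemma CH_discD:
  assumes "f \<in> CH_disc \<Omega>"
  shows "continuous_on (ball 0 1) f" "z \<in> ball 0 1 \<Longrightarrow> f differentiable (at z)"
    "z \<in> ball 0 1 \<Longrightarrow> norm (pd_x f z) = norm (pd_y f z)" "z \<in> ball 0 1 \<Longrightarrow> pd_x f z \<bullet> pd_y f z = 0"
    "z \<in> ball 0 1 \<Longrightarrow> f z \<in> \<Omega>"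
proof -
  have "C2_on (ball 0 1) f" using assms by (simp add: CH_disc_def harmonic_map_on_def)
  then obtain f' f'' where F: "C2_derivs (ball 0 1) f f' f''" by (auto simp: C2_on_iff)
  show "continuous_on (ball 0 1) f" by (rule C2_derivsD(5)[OF F])
  show "f differentiable (at z)" if "z \<in> ball 0 1"
    using C2_derivsD(1)[OF F that] by (rule differentiableI)
qed (use assms in \<open>auto simp: CH_disc_def conformal_on_def\<close>)

lemma C2_on_const: "C2_on S (\<lambda>_. c)"
  unfolding C2_on_iff C2_derivs_def
  by (intro exI[of _ "\<lambda>_. 0"]) (auto intro!: derivative_eq_intros simp: zero_blinfun.rep_eq)

lemma hess_const [simp]: "hess (\<lambda>_. c) x v w = 0"
  by (simp add: hess_def frechet_derivative_const)

text \<open>Bessel's inequality for \<open>a / |a|\<close> and \<open>b / |b|\<close>, multiplied by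
  the common value \<open>|a|^2\<close>.\<close>

lemma conformal_bessel:
  fixes a b w :: "'a::real_inner"
  assumes "norm a = norm b" "a \<bullet> b = 0"
  shows "(w \<bullet> a)^2 + (w \<bullet> b)^2 \<le> (w \<bullet> w) * (a \<bullet> a)"
proof (cases "a = 0")
  case True then show ?thesis using assms by auto
next
  case False
  define n where "n = a \<bullet> a"
  have n: "n > 0" "b \<bullet> b = n" using False assms by (auto simp: n_def norm_eq)
  \<comment> \<open>\<open>n\<close> times the component of \<open>w\<close> orthogonal to
    \<open>a\<close> and \<open>b\<close>; its squared norm is nonnegative.\<close>
  define r where "r = n *\<^sub>R w - (w \<bullet> a) *\<^sub>R a - (w \<bullet> b) *\<^sub>R b"
  have "r \<bullet> r = n * (n * (w \<bullet> w) - ((w \<bullet> a)^2 + (w \<bullet> b)^2))"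
    unfolding r_def using assms(2) n(2)
    by (simp add: inner_diff_left inner_diff_right inner_commute[of b a] inner_commute[of a w] inner_commute[of b w]
        n_def[symmetric] power2_eq_square algebra_simps)
  then have "0 \<le> n * (n * (w \<bullet> w) - ((w \<bullet> a)^2 + (w \<bullet> b)^2))" by (metis inner_ge_zero)
  then have "0 \<le> n * (w \<bullet> w) - ((w \<bullet> a)^2 + (w \<bullet> b)^2)" using n(1) by (simp add: zero_le_mult_iff)
  then show ?thesis by (simp add: n_def mult.commute)
qed

text \<open>The inequality expresses subharmonicity of \<open>log |f - x|^2\<close> in a form that
  stays meaningful at zeros of \<open>f - x\<close>. The Laplacian of \<open>|f - x|^2\<close> is
  \<open>4 |f_x|^2\<close>, its gradient is twice the pair of inner products of \<open>f - x\<close>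
  with \<open>f_x\<close> and \<open>f_y\<close>, and Bessel's inequality compares the two.\<close>

lemma CH_disc_dist_planar:
  fixes x :: "'a::euclidean_space"
  assumes f: "f \<in> CH_disc \<Omega>" and S: "open S" "S \<subseteq> ball 0 1"
  obtains p q a b c d where "C2_planar S (\<lambda>z. (f z - x) \<bullet> (f z - x)) p q a b c d"
    "\<forall>z\<in>S. (p z)^2 + (q z)^2 \<le> ((f z - x) \<bullet> (f z - x)) * (a z + d z)"
proof -
  define u where "u y = 0 - (-1) * ((y - x) \<bullet> (y - x))" for y
  note Q = C2_on_minus_dist[OF C2_on_const[of UNIV "0::real"] open_UNIV, where e = "-1" and x = x, folded u_def]
  obtain p q a b c d where P: "C2_planar S (\<lambda>z. u (f z)) p q a b c d"
    and pq: "\<forall>z\<in>S. p z = frechet_derivative u (at (f z)) (pd_x f z)"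
      "\<forall>z\<in>S. q z = frechet_derivative u (at (f z)) (pd_y f z)"
    and ad: "\<forall>z\<in>S. a z + d z = hess u (f z) (pd_x f z) (pd_x f z) + hess u (f z) (pd_y f z) (pd_y f z)"
    by (rule CH_disc_compose[OF f Q(1) open_UNIV S subset_UNIV])
  have *: "norm (pd_x f z) = norm (pd_y f z)" "pd_x f z \<bullet> pd_y f z = 0" if "z \<in> S" for z
    using CH_discD(3,4)[OF f] that S(2) by auto
  show thesis
  proof (rule that; (rule ballI)?)
    show "C2_planar S (\<lambda>z. (f z - x) \<bullet> (f z - x)) p q a b c d" using P by (simp add: u_def)
    fix z assume z: "z \<in> S"
    have "a z + d z = 2 * (pd_x f z \<bullet> pd_x f z) + 2 * (pd_y f z \<bullet> pd_y f z)"
      using bspec[OF ad z] Q(2) by simp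
    then have a: "a z + d z = 4 * (pd_x f z \<bullet> pd_x f z)" using *(1)[OF z] by (simp add: norm_eq)
    have "p z = 2 * ((f z - x) \<bullet> pd_x f z)" "q z = 2 * ((f z - x) \<bullet> pd_y f z)"
      using bspec[OF pq(1) z] bspec[OF pq(2) z] Q(3) by (simp_all add: frechet_derivative_const)
    then show "(p z)^2 + (q z)^2 \<le> ((f z - x) \<bullet> (f z - x)) * (a z + d z)"
      using conformal_bessel[OF *[OF z], of "f z - x"] unfolding a by (simp add: power_mult_distrib)
  qed
qed

text \<open>A Sibony-type argument: \<open>log |f - x|\<^sup>2 + A \<phi>(f)\<close> is subharmonic where it is defined, and for
  suitable \<open>A\<close> it can be glued across \<open>|f - x| = R\<close> to the constant \<open>log k\<close>, because \<open>\<phi>\<close> is much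
  more negative there than on \<open>|f - x| \<le> \<delta>\<close>.\<close>

lemma localisation:
  fixes \<Omega> V :: "'a::euclidean_space set"
  assumes u: "C2_on V u" and V: "open V" "cball p R0 \<subseteq> V" and R0: "R0 > 0" and up: "u p = 0"
    and neg: "\<And>y. y \<in> \<Omega> \<Longrightarrow> y \<in> V \<Longrightarrow> u y \<le> 0" and \<kappa>: "\<kappa> > 0"
    and pos: "\<And>y a b. \<lbrakk>y \<in> cball p R0; norm a = norm b; a \<bullet> b = 0\<rbrakk> \<Longrightarrow> \<kappa> * (a \<bullet> a) \<le> hess u y a a + hess u y b b"
  obtains \<delta> r where "\<delta> > 0" "r > 0" "r \<le> 1"
    "\<And>f. \<lbrakk>f \<in> CH_disc \<Omega>; f 0 \<in> ball p \<delta>\<rbrakk> \<Longrightarrow> f ` ball 0 r \<subseteq> ball p R0"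
proof -
  define R where "R = R0 / 2"
  \<comment> \<open>As \<open>|f - x|^2\<close> has Laplacian \<open>4 |f_x|^2\<close>, this is the
    largest \<epsilon> for which the lower bound by \<kappa> keeps
    \<open>u(f) - \<epsilon> |f - x|^2\<close> subharmonic.\<close>
  define \<epsilon> where "\<epsilon> = \<kappa> / 4"
  have R: "R > 0" and \<epsilon>: "\<epsilon> > 0" using R0 \<kappa> by (auto simp: R_def \<epsilon>_def)
  have pV: "p \<in> V" using V R0 by auto
  have "isCont u p" using C2_on_continuous[OF u] V(1) pV by (simp add: continuous_on_eq_continuous_at)
  moreover have "0 < \<epsilon> * R^2 / 4" using R \<epsilon> by simp
  ultimately obtain \<eta> where \<eta>: "\<eta> > 0" and "\<forall>y. dist y p < \<eta> \<longrightarrow> dist (u y) (u p) < \<epsilon> * R^2 / 4"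
    unfolding continuous_at_eps_delta by blast
  then have \<eta>: "\<eta> > 0" "\<And>y. dist y p < \<eta> \<Longrightarrow> \<bar>u y\<bar> < \<epsilon> * R^2 / 4"
    by (simp_all add: up dist_real_def)
  \<comment> \<open>For \<open>|x - p| < \<delta>\<close>, the sphere
    \<open>|y - x| = \<delta>\<close> stays where \<open>u > - \<epsilon> R^2 / 4\<close>, and the
    ball \<open>|y - x| <= R\<close> stays in \<open>cball p R0\<close>.\<close>
  define \<delta> where "\<delta> = min (\<eta> / 3) (R / 2)"
  have \<delta>: "\<delta> > 0" "2 * \<delta> \<le> R" "2 * \<delta> < \<eta>" using \<eta>(1) R by (auto simp: \<delta>_def)
  \<comment> \<open>Chosen so that both spheres give the same threshold. Where
    \<open>|f - x| = \<delta>\<close>, \<phi> is at least \<open>- \<epsilon> R^2 / 2\<close> and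
    \<open>v >= \<delta>^2 * (\<delta>^2 / R^2) = k\<close>; where \<open>|f - x| = R\<close>,
    \<phi> is at most \<open>- \<epsilon> R^2\<close> and
    \<open>v <= R^2 * (\<delta>^2 / R^2)^2 = k\<close>.\<close>
  define A where "A = 2 * ln (R^2 / \<delta>^2) / (\<epsilon> * R^2)"
  define k where "k = \<delta>^2 * (\<delta>^2 / R^2)"
  have d2R: "\<delta>^2 \<le> R^2 / 4" using power_mono[of "2 * \<delta>" R 2] \<delta> by (simp add: power_mult_distrib)
  have d2R': "\<delta>^2 \<le> R^2" using d2R zero_le_power2[of R] by linarith
  have ratio: "\<delta>^2 / R^2 \<le> 1" using d2R' R by simp
  have kpos: "k > 0" using R \<delta>(1) by (simp add: k_def)
  have "1 \<le> R^2 / \<delta>^2" using d2R' \<delta>(1) by (simp add: field_simps)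
  then have A: "A \<ge> 0" using R \<epsilon> by (simp add: A_def)
  have eA: "A * (\<epsilon> * R^2) = 2 * ln (R^2 / \<delta>^2)" using R \<epsilon> by (simp add: A_def)
  have lnr: "- ln (R^2 / \<delta>^2) = ln (\<delta>^2 / R^2)" using R \<delta>(1) by (simp add: ln_div)
  have expA: "exp (A * (- (\<epsilon> * R^2) / 2)) = \<delta>^2 / R^2" "exp (A * (- (\<epsilon> * R^2))) = (\<delta>^2 / R^2)^2"
  proof -
    have "A * (- (\<epsilon> * R^2) / 2) = ln (\<delta>^2 / R^2)" using eA lnr by simp
    then show "exp (A * (- (\<epsilon> * R^2) / 2)) = \<delta>^2 / R^2" using R \<delta>(1) by simp
    have "A * (- (\<epsilon> * R^2)) = of_nat 2 * ln (\<delta>^2 / R^2)" using eA lnr by simp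
    then show "exp (A * (- (\<epsilon> * R^2))) = (\<delta>^2 / R^2)^2"
      using R \<delta>(1) exp_of_nat_mult[of 2 "ln (\<delta>^2 / R^2)"] by simp
  qed
  \<comment> \<open>From the bound \<open>E z <= 4 R^2 |z|\<close> proved below,
    \<open>|z| < r\<close> gives \<open>E z < k\<close>, and \<open>E\<close> is at least
    \<open>k\<close> wherever \<open>|f - x| > \<delta>\<close>.\<close>
  define r where "r = min (1/2) (k / (4 * R^2))"
  show thesis
  proof (rule that[of \<delta> r])
    show "\<delta> > 0" "r > 0" "r \<le> 1" using \<delta> R kpos by (auto simp: r_def)
    fix f assume f: "f \<in> CH_disc \<Omega>" and f0: "f 0 \<in> ball p \<delta>"
    note fD = CH_discD[OF f]
    define x where "x = f 0"
    have xp: "dist x p < \<delta>" using f0 by (simp add: x_def dist_commute)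
    define \<phi> where "\<phi> y = u y - \<epsilon> * ((y - x) \<bullet> (y - x))" for y
    note \<phi>D = C2_on_minus_dist[OF u V(1), where e = \<epsilon> and x = x, folded \<phi>_def]
    define q where "q z = (f z - x) \<bullet> (f z - x)" for z
    \<comment> \<open>The exponential of \<open>log |f - x|^2 + A \<phi>(f)\<close>, continuous also
      where \<open>f = x\<close>.\<close>
    define v where "v z = q z * exp (A * \<phi> (f z))" for z
    define E where "E z = (if norm (f z - x) \<le> \<delta> then v z else if norm (f z - x) \<le> R then max (v z) k else k)" for z
    have q_eq: "q z = (norm (f z - x))^2" for z by (simp add: q_def power2_norm_eq_inner)
    have q0: "q z \<ge> 0" for z by (simp add: q_def)
    have inB: "y \<in> cball p R0" if "norm (y - x) \<le> R" for y
    proof -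
      have "dist y p \<le> dist y x + dist x p" by (rule dist_triangle)
      then show ?thesis using that xp \<delta> by (simp add: dist_norm R_def norm_minus_commute)
    qed
    have \<phi>le: "\<phi> (f z) \<le> - (\<epsilon> * q z)" if "z \<in> ball 0 1" "norm (f z - x) \<le> R" for z
      using neg[of "f z"] fD(5)[OF that(1)] inB[OF that(2)] V(2) by (auto simp: \<phi>_def q_def)
    have vle: "v z \<le> q z" if "z \<in> ball 0 1" "norm (f z - x) \<le> R" for z
    proof -
      have "0 \<le> \<epsilon> * q z" using \<epsilon> q0[of z] by simp
      then have "A * \<phi> (f z) \<le> 0" using \<phi>le[OF that] A by (intro mult_nonneg_nonpos) auto
      then have "q z * exp (A * \<phi> (f z)) \<le> q z * 1" using q0 by (intro mult_left_mono) auto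
      then show ?thesis by (simp add: v_def)
    qed
    have inner: "k \<le> v z" if "norm (f z - x) = \<delta>" for z
    proof -
      have "dist (f z) p \<le> dist (f z) x + dist x p" by (rule dist_triangle)
      then have "dist (f z) p < \<eta>" using that xp \<delta> by (simp add: dist_norm)
      from \<eta>(2)[OF this] have "u (f z) \<ge> - (\<epsilon> * R^2 / 4)" by linarith
      moreover have "\<epsilon> * q z \<le> \<epsilon> * (R^2 / 4)" using d2R \<epsilon> that by (intro mult_left_mono) (auto simp: q_eq)
      ultimately have "- (\<epsilon> * R^2) / 2 \<le> \<phi> (f z)" by (simp add: \<phi>_def q_def)
      from mult_left_mono[OF this A] have "exp (A * (- (\<epsilon> * R^2) / 2)) \<le> exp (A * \<phi> (f z))"
        by (simp only: exp_le_cancel_iff)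
      then have "\<delta>^2 / R^2 \<le> exp (A * \<phi> (f z))" unfolding expA .
      from mult_left_mono[OF this zero_le_power2[of \<delta>]] show ?thesis
        unfolding k_def v_def q_eq that .
    qed
    have outer: "v z \<le> k" if "z \<in> ball 0 1" "norm (f z - x) = R" for z
    proof -
      have "\<phi> (f z) \<le> - (\<epsilon> * R^2)" using \<phi>le[OF that(1)] that by (simp add: q_eq)
      from mult_left_mono[OF this A] have "exp (A * \<phi> (f z)) \<le> exp (A * (- (\<epsilon> * R^2)))"
        by (simp only: exp_le_cancel_iff)
      then have "exp (A * \<phi> (f z)) \<le> (\<delta>^2 / R^2)^2" unfolding expA .
      from mult_left_mono[OF this zero_le_power2[of R]] have "v z \<le> R^2 * (\<delta>^2 / R^2)^2"
        unfolding v_def q_eq that .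
      also have "\<dots> = k" using R by (simp add: k_def power2_eq_square)
      finally show ?thesis .
    qed
    have kR: "k \<le> R^2" 
    proof -
      have "k \<le> \<delta>^2 * 1" unfolding k_def using ratio by (intro mult_left_mono) auto
      then show ?thesis using d2R' by linarith
    qed
    have vR: "v z \<le> R^2" if "z \<in> ball 0 1" "norm (f z - x) \<le> R" for z
      using vle[OF that] that power_mono[of "norm (f z - x)" R 2] by (simp add: q_eq)
    have \<delta>R: "\<delta> < R" using \<delta> R by simp
    have ER: "E z \<le> R^2" if "z \<in> ball 0 1" for z
      using vR[OF that] kR \<delta>R by (auto simp: E_def)
    have contv: "continuous_on {z \<in> ball 0 1. norm (f z - x) \<le> R} v"
    proof -
      have cf: "continuous_on {z \<in> ball 0 1. norm (f z - x) \<le> R} f" by (rule continuous_on_subset[OF fD(1)]) auto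
      show ?thesis unfolding v_def q_def
        by (intro continuous_intros cf continuous_on_compose2[OF C2_on_continuous[OF \<phi>D(1)] cf]) (use inB V(2) in auto)
    qed
    have contn: "continuous_on (ball 0 1) (\<lambda>z. norm (f z - x))" by (intro continuous_intros fD(1))
    have contE: "continuous_on (ball 0 1) E"
      unfolding E_def
    proof (rule continuous_on_cases_le)
      show "continuous_on {z \<in> ball 0 1. norm (f z - x) \<le> \<delta>} v"
        by (rule continuous_on_subset[OF contv]) (use \<delta>R in auto)
      show "continuous_on {z \<in> ball 0 1. \<delta> \<le> norm (f z - x)} (\<lambda>z. if norm (f z - x) \<le> R then max (v z) k else k)"
      proof (rule continuous_on_cases_le)
        show "continuous_on {z \<in> {z \<in> ball 0 1. \<delta> \<le> norm (f z - x)}. norm (f z - x) \<le> R} (\<lambda>z. max (v z) k)"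
          by (intro continuous_on_max continuous_on_const continuous_on_subset[OF contv]) auto
      qed (use outer in \<open>auto intro: continuous_on_subset[OF contn]\<close>)
      show "v z = (if norm (f z - x) \<le> R then max (v z) k else k)" if "z \<in> ball 0 1" "norm (f z - x) = \<delta>" for z
        using inner[OF that(2)] that \<delta>R by auto
    qed (rule contn)
    \<comment> \<open>Dividing by \<open>|z|\<close> as in the Schwarz lemma; the factor
      \<open>exp (|z|^2)\<close> makes the logarithm strictly subharmonic, so that an interior
      maximum is contradictory.\<close>
    define h :: "complex \<Rightarrow> real" where "h z = exp ((norm z)^2) / norm z" for z
    have hpos: "h z > 0" if "z \<noteq> 0" for z using that by (simp add: h_def)
    have conth: "continuous_on T h" if "0 \<notin> T" for T
      unfolding h_def using that by (intro continuous_intros) auto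
    \<comment> \<open>\<open>E\<close> is \<open>O(|z|^2)\<close> at 0 because \<open>f\<close> is
      differentiable there, which outweighs the pole of \<open>h\<close>.\<close>
    have lin: "\<exists>\<tau>>0. \<forall>z. norm z < \<tau> \<and> z \<noteq> 0 \<longrightarrow> z \<in> ball 0 1 \<and> E z * h z < g" if g: "g > 0" for g
    proof -
      obtain f' where f': "(f has_derivative f') (at 0)" using fD(2)[of 0] by (auto simp: differentiable_def)
      then have bl: "bounded_linear f'" by (rule has_derivative_bounded_linear)
      obtain d where d: "d > 0" "\<And>y. norm (y - 0) < d \<Longrightarrow> norm (f y - f 0 - f' (y - 0)) \<le> 1 * norm (y - 0)"
        using f'[unfolded has_derivative_at_alt] zero_less_one by blast
      define B where "B = onorm f' + 1"
      have B: "B > 0" using onorm_pos_le[OF bl] by (simp add: B_def)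
      have fB: "norm (f y - x) \<le> B * norm y" if "norm y < d" for y
      proof -
        have "norm (f y - x) \<le> norm (f y - f 0 - f' y) + norm (f' y)"
          unfolding x_def by (metis diff_add_cancel norm_triangle_ineq)
        also have "\<dots> \<le> norm y + onorm f' * norm y" using d(2)[of y] that onorm[OF bl, of y] by simp
        finally show ?thesis by (simp add: B_def algebra_simps)
      qed
      define \<tau> where "\<tau> = min (min d 1) (min (\<delta> / B) (g / (B^2 * 4)))"
      have \<tau>: "\<tau> > 0" using d B \<delta> g by (simp add: \<tau>_def)
      have "z \<in> ball 0 1 \<and> E z * h z < g" if z: "norm z < \<tau>" "z \<noteq> 0" for z
      proof
        have zz: "norm z < d" "norm z < 1" "norm z < \<delta> / B" "norm z < g / (B^2 * 4)" using z by (auto simp: \<tau>_def)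
        show zD: "z \<in> ball 0 1" using zz by simp
        have "norm (f z - x) \<le> \<delta>" using fB[OF zz(1)] zz(3) B by (simp add: field_simps)
        then have "E z \<le> q z" using vle[OF zD] \<delta>R by (simp add: E_def)
        also have "q z \<le> (B * norm z)^2" unfolding q_eq using fB[OF zz(1)] by (intro power_mono) auto
        finally have "E z * h z \<le> (B * norm z)^2 * h z" using hpos[OF z(2)] by (intro mult_right_mono) auto
        also have "\<dots> = B^2 * norm z * exp ((norm z)^2)" using z(2) by (simp add: h_def power2_eq_square)
        also have "\<dots> \<le> B^2 * norm z * 3"
        proof (intro mult_left_mono)
          have "exp ((norm z)^2) \<le> exp (1::real)" using zz(2) by (simp add: power_le_one)
          then show "exp ((norm z)^2) \<le> 3" using exp_le by linarith
        qed simp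
        also have "\<dots> < g"
        proof -
          have "B^2 * norm z * 4 < g" using zz(4) B by (simp add: field_simps)
          moreover have "0 \<le> B^2 * norm z" by simp
          ultimately show ?thesis by linarith
        qed
        finally show "E z * h z < g" .
      qed
      with \<tau> show ?thesis by blast
    qed
    \<comment> \<open>If the bound failed at \<open>z1\<close>, then \<open>E * h\<close> would
      exceed \<open>4 R^2\<close> there, while it is small near 0 and at most \<open>4 R^2\<close>
      on \<open>|z| = 1/2\<close>; its maximum would be attained in between.\<close>
    have claim: "E z1 \<le> 4 * R^2 * norm z1" if z1: "norm z1 < 1/2" for z1
    proof (rule ccontr)
      assume "\<not> E z1 \<le> 4 * R^2 * norm z1"
      then have E1: "E z1 > 4 * R^2 * norm z1" by simp
      have "E 0 = 0" using \<delta>(1) by (simp add: E_def v_def q_def x_def)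
      then have z1n: "z1 \<noteq> 0" using E1 by auto
      define g where "g = E z1 * h z1"
      have g: "g > 4 * R^2"
      proof -
        have "0 \<le> 4 * R^2 * norm z1" by simp
        then have "0 \<le> E z1" using E1 by linarith
        then have "0 \<le> E z1 / norm z1" by simp
        from mult_left_mono[OF _ this, of 1 "exp ((norm z1)^2)"]
        have E1exp: "E z1 / norm z1 \<le> E z1 / norm z1 * exp ((norm z1)^2)" by simp
        have "4 * R^2 < E z1 / norm z1" using E1 z1n by (simp add: field_simps)
        also have "\<dots> \<le> E z1 / norm z1 * exp ((norm z1)^2)"
          by (rule E1exp)
        finally show ?thesis by (simp add: g_def h_def)
      qed
      have gpos: "g > 0" using g zero_le_power2[of R] by linarith
      obtain \<tau> where \<tau>: "\<tau> > 0" "\<And>z. norm z < \<tau> \<Longrightarrow> z \<noteq> 0 \<Longrightarrow> E z * h z < g" using lin[OF gpos] by blast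
      \<comment> \<open>The removed disc lies where \<open>E * h < g\<close>, so the maximum over
        the closed annulus \<open>T\<close> is not on its inner circle.\<close>
      define \<sigma> where "\<sigma> = min \<tau> (norm z1) / 2"
      have \<sigma>: "\<sigma> > 0" "\<sigma> < \<tau>" "\<sigma> < norm z1" using \<tau>(1) z1n by (auto simp: \<sigma>_def min_def)
      define T :: "complex set" where "T = cball 0 (1/2) - ball 0 \<sigma>"
      have T: "compact T" "z1 \<in> T" "0 \<notin> T" using \<sigma> z1 by (auto simp: T_def intro: compact_diff)
      have "continuous_on T (\<lambda>z. E z * h z)"
        by (intro continuous_intros conth T continuous_on_subset[OF contE]) (auto simp: T_def)
      then obtain z0 where z0: "z0 \<in> T" "\<And>z. z \<in> T \<Longrightarrow> E z * h z \<le> E z0 * h z0"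
        using continuous_attains_sup[OF T(1)] T(2) by blast
      have G0: "g \<le> E z0 * h z0" using z0(2)[OF T(2)] by (simp add: g_def)
      have z0n: "z0 \<noteq> 0" using z0(1) T(3) by auto
      have z0D: "z0 \<in> ball 0 1" using z0(1) by (auto simp: T_def)
      have z0l: "\<sigma> < norm z0" using \<tau>(2)[of z0] G0 z0n \<sigma> z0(1) by (fastforce simp: T_def)
      have z0u: "norm z0 < 1/2"
      proof (rule ccontr)
        assume "\<not> norm z0 < 1/2"
        then have n: "norm z0 = 1/2" using z0(1) by (auto simp: T_def)
        have "exp ((1/2)^2::real) \<le> 2" using exp_bound[of "(1/2)^2"] by (simp add: power2_eq_square)
        then have "h z0 \<le> 4" unfolding h_def n by simp
        then have "E z0 * h z0 \<le> R^2 * 4" using ER[OF z0D] hpos[OF z0n]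
          by (intro mult_mono) auto
        then show False using G0 g by simp
      qed
      have "\<forall>\<^sub>F z in nhds z0. z \<in> ball 0 (1/2) - cball 0 \<sigma>"
        using z0l z0u by (intro eventually_nhds_in_open) auto
      then have locmax: "\<forall>\<^sub>F z in nhds z0. E z * h z \<le> E z0 * h z0 \<and> z \<in> ball 0 1"
        by eventually_elim (auto intro!: z0(2) simp: T_def)
      have nlim: "((\<lambda>z. norm (f z - x)) \<longlongrightarrow> norm (f z0 - x)) (nhds z0)"
      proof -
        have "isCont (\<lambda>z. norm (f z - x)) z0"
          using contn z0D unfolding continuous_on_eq_continuous_at[OF open_ball] by blast
        then show ?thesis unfolding isCont_def by (rule tendsto_at_iff_tendsto_nhds[THEN iffD1])
      qed
      have E0: "E z0 > 0" using G0 gpos hpos[OF z0n] by (meson less_le_trans zero_less_mult_pos2)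
      show False
      \<comment> \<open>Either \<open>E z0 = v z0\<close> or \<open>E z0 = k\<close>. In both cases
        the respective branch lies below \<open>E\<close> near \<open>z0\<close>, hence inherits the
        local maximum after multiplication by \<open>h\<close>.\<close>
      proof (cases "norm (f z0 - x) < R \<and> (norm (f z0 - x) \<le> \<delta> \<or> k \<le> v z0)")
        case True
        then have Ev: "E z0 = v z0" by (auto simp: E_def)
        have ev: "\<forall>\<^sub>F z in nhds z0. v z * h z \<le> v z0 * h z0"
          using locmax order_tendstoD(2)[OF nlim conjunct1[OF True]]
        proof eventually_elim
          case (elim z)
          have "v z \<le> E z" using elim by (auto simp: E_def)
          then have "v z * h z \<le> E z * h z" by (cases "z = 0") (auto simp: h_def intro!: mult_right_mono divide_right_mono)
          with elim Ev show ?case by simp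
        qed
        define S where "S = ball 0 1 \<inter> f -` ball x R"
        have "open S" unfolding S_def by (intro continuous_open_preimage fD(1) open_ball)
        moreover have "f z \<in> V" if "z \<in> S" for z
          using that inB[of "f z"] V(2) by (auto simp: S_def dist_norm norm_minus_commute)
        ultimately have S: "open S" "S \<subseteq> ball 0 1" "f ` S \<subseteq> V" "z0 \<in> S"
          using True z0D by (auto simp: S_def dist_norm norm_minus_commute)
        obtain p1 q1 a1 b1 c1 d1 where P1: "C2_planar S q p1 q1 a1 b1 c1 d1"
          "\<forall>z\<in>S. (p1 z)^2 + (q1 z)^2 \<le> q z * (a1 z + d1 z)"
          unfolding q_def by (rule CH_disc_dist_planar[OF f S(1,2), of x])
        obtain p2 q2 a2 b2 c2 d2 where P2: "C2_planar S (\<lambda>z. \<phi> (f z)) p2 q2 a2 b2 c2 d2"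
          "\<forall>z\<in>S. a2 z + d2 z = hess \<phi> (f z) (pd_x f z) (pd_x f z) + hess \<phi> (f z) (pd_y f z) (pd_y f z)"
          by (rule CH_disc_compose[OF f \<phi>D(1) V(1) S(1,2,3)])
        have "0 \<le> a2 z0 + d2 z0"
        proof -
          have c: "norm (pd_x f z0) = norm (pd_y f z0)" "pd_x f z0 \<bullet> pd_y f z0 = 0" using fD(3,4) z0D by auto
          have "f z0 \<in> cball p R0" using True by (intro inB) simp
          note pos[OF this c]
          moreover have "pd_y f z0 \<bullet> pd_y f z0 = pd_x f z0 \<bullet> pd_x f z0" using c(1) by (simp add: norm_eq)
          moreover have "f z0 \<in> V" using S by auto
          ultimately show ?thesis unfolding bspec[OF P2(2) S(4)] using \<phi>D(2) by (simp add: \<epsilon>_def)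
        qed
        moreover have "q z0 > 0" using E0 Ev q0[of z0] by (cases "q z0 = 0") (auto simp: v_def)
        ultimately show False
          using log_subharmonic_no_local_max[OF P1(1) P2(1) S(4) z0n _ A _ bspec[OF P1(2) S(4)]] ev
          by (simp add: v_def h_def mult.assoc)
      next
        case False
        then have gt: "norm (f z0 - x) > \<delta>" and Ek: "E z0 = k"
          using outer[OF z0D] \<delta>R by (auto simp: E_def not_less max_def)
        have ev: "\<forall>\<^sub>F z in nhds z0. k * h z \<le> k * h z0"
          using locmax order_tendstoD(1)[OF nlim gt]
        proof eventually_elim
          case (elim z)
          have "k \<le> E z" using elim by (auto simp: E_def)
          then have "k * h z \<le> E z * h z" by (cases "z = 0") (auto simp: h_def intro!: mult_right_mono divide_right_mono)
          with elim Ek show ?case by simp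
        qed
        \<comment> \<open>The constant branch enters as \<open>Q = k\<close> and
          \<open>\<Phi> = 0\<close>; the contradiction then comes from \<open>|z|^2\<close>
          alone.\<close>
        have "C2_planar UNIV (\<lambda>_. k) (\<lambda>_. 0) (\<lambda>_. 0) (\<lambda>_. 0) (\<lambda>_. 0) (\<lambda>_. 0) (\<lambda>_. 0)"
          "C2_planar UNIV (\<lambda>_. 0) (\<lambda>_. 0) (\<lambda>_. 0) (\<lambda>_. 0) (\<lambda>_. 0) (\<lambda>_. 0) (\<lambda>_. 0)"
          by (auto simp: C2_planar_def)
        from log_subharmonic_no_local_max[OF this UNIV_I z0n kpos A] show False using ev by (simp add: h_def)
      qed
    qed
    show "f ` ball 0 r \<subseteq> ball p R0"
    proof
      fix y assume "y \<in> f ` ball 0 r"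
      then obtain z where z: "y = f z" "norm z < r" by auto
      have zr: "norm z < 1/2" "norm z < k / (4 * R^2)" using z by (auto simp: r_def)
      have "4 * R^2 * norm z < k" using zr(2) R by (simp add: field_simps)
      then have "E z < k" using claim[OF zr(1)] by linarith
      then have "norm (f z - x) \<le> \<delta>" by (auto simp: E_def split: if_splits)
      moreover have "dist (f z) p \<le> dist (f z) x + dist x p" by (rule dist_triangle)
      ultimately show "y \<in> ball p R0" using xp \<delta>(2) R0 z by (simp add: dist_norm R_def norm_minus_commute)
    qed
  qed
qed

section \<open>Estimate of the normal derivative\<close>

text \<open>The mean value theorem for \<open>u - u' x\<close>, whose derivative is at most
  \<open>M |y - x|\<close> on the segment. Uniformity in the base point matters because that point
  will be the centre of an arbitrary disc.\<close>

lemma C2_derivs_taylor: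
  fixes u :: "'a::euclidean_space \<Rightarrow> real"
  assumes D: "C2_derivs V u u' u''" and K: "cball p R \<subseteq> V"
  obtains M where "M \<ge> 0"
    "\<And>x y. \<lbrakk>x \<in> cball p R; y \<in> cball p R\<rbrakk> \<Longrightarrow> \<bar>u y - u x - u' x (y - x)\<bar> \<le> M * ((y - x) \<bullet> (y - x))"
proof -
  have "bounded (u'' ` cball p R)"
    by (intro compact_imp_bounded compact_continuous_image continuous_on_subset[OF C2_derivsD(3)[OF D] K] compact_cball)
  then obtain M where M: "M > 0" "\<And>x. x \<in> cball p R \<Longrightarrow> norm (u'' x) \<le> M"
    unfolding bounded_pos by auto
  have lip: "norm (u' y - u' x) \<le> M * norm (y - x)" if "x \<in> cball p R" "y \<in> cball p R" for x y
    using that M(2) K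
    by (intro differentiable_bound[OF convex_cball, where f' = "\<lambda>x. blinfun_apply (u'' x)"])
       (auto intro!: has_derivative_at_withinI[OF C2_derivsD(2)[OF D]] simp flip: norm_blinfun.rep_eq)
  show thesis
  proof (rule that)
    show "M \<ge> 0" using M by simp
    fix x y assume xy: "x \<in> cball p R" "y \<in> cball p R"
    have seg: "closed_segment x y \<subseteq> cball p R" using xy by (simp add: closed_segment_subset)
    define g where "g w = u w - u' x w" for w
    have "norm (g y - g x) \<le> (M * norm (y - x)) * norm (y - x)"
    proof (rule differentiable_bound[OF convex_closed_segment, where f' = "\<lambda>w. blinfun_apply (u' w - u' x)"])
      fix w assume w: "w \<in> closed_segment x y"
      then have wB: "w \<in> cball p R" using seg by auto
      have "(g has_derivative blinfun_apply (u' w - u' x)) (at w)"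
        unfolding g_def
        by (rule has_derivative_eq_rhs[OF has_derivative_diff[OF C2_derivsD(1)[OF D]
              bounded_linear_imp_has_derivative[OF blinfun.bounded_linear_right]]])
          (use wB K in \<open>auto simp: blinfun.diff_left\<close>)
      then show "(g has_derivative blinfun_apply (u' w - u' x)) (at w within closed_segment x y)"
        by (rule has_derivative_at_withinI)
      have "onorm (blinfun_apply (u' w - u' x)) \<le> M * norm (w - x)"
        using lip[OF xy(1) wB] by (simp flip: norm_blinfun.rep_eq)
      also have "\<dots> \<le> M * norm (y - x)"
        using M(1) segment_bound[OF w] by (intro mult_left_mono) auto
      finally show "onorm (blinfun_apply (u' w - u' x)) \<le> M * norm (y - x)" .
    qed auto
    moreover have "g y - g x = u y - u x - u' x (y - x)" by (simp add: g_def blinfun.diff_right)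
    ultimately show "\<bar>u y - u x - u' x (y - x)\<bar> \<le> M * ((y - x) \<bullet> (y - x))"
      by (simp add: dot_square_norm power2_eq_square mult.assoc)
  qed
qed

lemma C2_on_affine:
  fixes L :: "'a::real_normed_vector \<Rightarrow>\<^sub>L 'b::real_normed_vector"
  shows "C2_on S (\<lambda>y. L y - c)" and "hess (\<lambda>y. L y - c) x v w = 0"
    and "frechet_derivative (\<lambda>y. L y - c) (at x) = blinfun_apply L"
proof -
  have D: "C2_derivs T (\<lambda>y. L y - c) (\<lambda>_. L) (\<lambda>_. 0)" for T
    unfolding C2_derivs_def
    by (auto intro!: derivative_eq_intros bounded_linear_imp_has_derivative blinfun.bounded_linear_right simp: zero_blinfun.rep_eq)
  then show "C2_on S (\<lambda>y. L y - c)" unfolding C2_on_iff by blast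
  show "hess (\<lambda>y. L y - c) x v w = 0"
    using C2_derivsD(7)[OF D open_UNIV UNIV_I] by simp
  show "frechet_derivative (\<lambda>y. L y - c) (at x) = blinfun_apply L"
    using C2_derivsD(6)[OF D UNIV_I] by simp
qed

text \<open>A linear functional of a harmonic map is harmonic, and the shift by \<open>c\<close>
  leaves its gradient unchanged. Applied to the differential of the barrier near \<open>p\<close>
  and to inner products on bounded domains.\<close>

lemma CH_disc_gradient_bound:
  fixes L :: "'a::euclidean_space \<Rightarrow>\<^sub>L real"
  assumes f: "f \<in> CH_disc \<Omega>" and s: "0 < s" "s < 1"
  shows "pi * s * \<bar>L (pd_x f 0)\<bar> \<le> integral {0..2*pi} (\<lambda>t. \<bar>L (f (of_real s * cis t) - c)\<bar>)"
proof -
  define u where "u y = L y - L c" for y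
  note A = C2_on_affine[where c = "L c" and L = L, folded u_def]
  obtain p q a b c d where P: "C2_planar (ball 0 1) (\<lambda>z. u (f z)) p q a b c d"
    and p: "\<forall>z\<in>ball 0 1. p z = frechet_derivative u (at (f z)) (pd_x f z)"
    and "\<forall>z\<in>ball 0 1. q z = frechet_derivative u (at (f z)) (pd_y f z)"
    and ad: "\<forall>z\<in>ball 0 1. a z + d z = hess u (f z) (pd_x f z) (pd_x f z) + hess u (f z) (pd_y f z) (pd_y f z)"
    by (rule CH_disc_compose[OF f A(1) open_UNIV open_ball subset_refl subset_UNIV])
  have "a z + d z = 0" if "z \<in> ball 0 1" for z using bspec[OF ad that] A(2) by simp
  from harmonic_gradient_bound[OF P s this] show ?thesis
    using bspec[OF p, of 0] A(3) by (simp add: u_def blinfun.diff_right)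
qed

text \<open>The mean value inequality for \<open>u \<circ> f - \<epsilon> |f - x|\<^sup>2\<close> bounds the circle means of \<open>|u \<circ> f|\<close> and of
  \<open>|f - x|\<^sup>2\<close> by a multiple of \<open>- u x\<close>; by Taylor's formula the same holds for the harmonic function
  \<open>du\<^sub>x (f - x)\<close>.\<close>

lemma normal_derivative_bound:
  fixes \<Omega> V :: "'a::euclidean_space set"
  assumes u: "C2_on V u" and V: "open V" "cball p R0 \<subseteq> V" and R0: "R0 > 0" and up: "u p = 0"
    and neg: "\<And>y. y \<in> \<Omega> \<Longrightarrow> y \<in> V \<Longrightarrow> u y \<le> 0" and \<kappa>: "\<kappa> > 0"
    and pos: "\<And>y a b. \<lbrakk>y \<in> cball p R0; norm a = norm b; a \<bullet> b = 0\<rbrakk> \<Longrightarrow> \<kappa> * (a \<bullet> a) \<le> hess u y a a + hess u y b b"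
  obtains \<delta> C where "\<delta> > 0" "C > 0"
    "\<And>f. \<lbrakk>f \<in> CH_disc \<Omega>; f 0 \<in> ball p \<delta>\<rbrakk> \<Longrightarrow> \<bar>frechet_derivative u (at (f 0)) (pd_x f 0)\<bar> \<le> C * (- u (f 0))"
proof -
  obtain \<delta> r where \<delta>: "\<delta> > 0" and r: "r > 0" "r \<le> 1"
    and loc: "\<And>f. \<lbrakk>f \<in> CH_disc \<Omega>; f 0 \<in> ball p \<delta>\<rbrakk> \<Longrightarrow> f ` ball 0 r \<subseteq> ball p R0"
    using localisation[OF u V R0 up neg \<kappa> pos] by blast
  obtain u' u'' where D: "C2_derivs V u u' u''" using u by (auto simp: C2_on_iff)
  obtain M where M: "M \<ge> 0" and taylor: "\<And>x y. \<lbrakk>x \<in> cball p R0; y \<in> cball p R0\<rbrakk> \<Longrightarrow>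
      \<bar>u y - u x - u' x (y - x)\<bar> \<le> M * ((y - x) \<bullet> (y - x))"
    using C2_derivs_taylor[OF D V(2)] by blast
  define \<epsilon> where "\<epsilon> = \<kappa> / 4"
  have \<epsilon>: "\<epsilon> > 0" using \<kappa> by (simp add: \<epsilon>_def)
  define s where "s = r / 2"
  have s: "0 < s" "s < r" "s < 1" using r by (auto simp: s_def)
  \<comment> \<open>The three terms \<open>2 pi\<close>, \<open>2 pi\<close> and
    \<open>2 pi M / \<epsilon>\<close> of the final estimate, divided by the \<open>pi * s\<close>
    of the gradient bound.\<close>
  define C where "C = (4 + 2 * M / \<epsilon>) / s"
  show thesis
  proof (rule that[of \<delta> C])
    show "\<delta> > 0" "C > 0" using \<delta> M \<epsilon> s by (auto simp: C_def intro!: divide_pos_pos add_pos_nonneg)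
    fix f assume f: "f \<in> CH_disc \<Omega>" and f0: "f 0 \<in> ball p \<delta>"
    note fD = CH_discD[OF f]
    define x where "x = f 0"
    have im: "f z \<in> cball p R0" "f z \<in> V" "u (f z) \<le> 0" if "z \<in> ball 0 r" for z
    proof -
      have "f z \<in> ball p R0" using loc[OF f f0] that by blast
      then show "f z \<in> cball p R0" by simp
      then show V: "f z \<in> V" using V(2) by blast
      show "u (f z) \<le> 0" using that r(2) by (intro neg[OF fD(5) V]) auto
    qed
    have xB: "x \<in> cball p R0" "x \<in> V" using im[of 0] r by (auto simp: x_def)
    define \<phi> where "\<phi> y = u y - \<epsilon> * ((y - x) \<bullet> (y - x))" for y
    note \<phi>D = C2_on_minus_dist[OF u V(1), where e = \<epsilon> and x = x, folded \<phi>_def]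
    have rD: "ball 0 r \<subseteq> (ball 0 1 :: complex set)" using r(2) by auto
    have "f ` ball 0 r \<subseteq> V" using im by auto
    then obtain p1 q1 a b c d where P: "C2_planar (ball 0 r) (\<lambda>z. \<phi> (f z)) p1 q1 a b c d"
      and "\<forall>z\<in>ball 0 r. p1 z = frechet_derivative \<phi> (at (f z)) (pd_x f z)"
      and "\<forall>z\<in>ball 0 r. q1 z = frechet_derivative \<phi> (at (f z)) (pd_y f z)"
      and ad: "\<forall>z\<in>ball 0 r. a z + d z = hess \<phi> (f z) (pd_x f z) (pd_x f z) + hess \<phi> (f z) (pd_y f z) (pd_y f z)"
      by (rule CH_disc_compose[OF f \<phi>D(1) V(1) open_ball rD])
    have sub: "0 \<le> a z + d z" if z: "z \<in> ball 0 r" for z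
    proof -
      have c: "norm (pd_x f z) = norm (pd_y f z)" "pd_x f z \<bullet> pd_y f z = 0" using fD(3,4) z rD by auto
      note pos[OF im(1)[OF z] c]
      moreover have "pd_y f z \<bullet> pd_y f z = pd_x f z \<bullet> pd_x f z" using c(1) by (simp add: norm_eq)
      ultimately show ?thesis unfolding bspec[OF ad z] using \<phi>D(2)[OF im(2)[OF z]] by (simp add: \<epsilon>_def)
    qed
    let ?z = "\<lambda>t. of_real s * cis t :: complex"
    have zb: "?z t \<in> ball 0 r" for t using s by (simp add: norm_mult)
    have cf: "continuous_on {0..2*pi} (\<lambda>t. f (?z t))"
      using s by (intro continuous_on_circle[OF continuous_on_subset[OF fD(1) rD]]) auto
    have cu: "continuous_on {0..2*pi} (\<lambda>t. u (f (?z t)))"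
      by (rule continuous_on_compose2[OF C2_on_continuous[OF u] cf]) (use im zb in auto)
    define Iu where "Iu = integral {0..2*pi} (\<lambda>t. - u (f (?z t)))"
    define Iq where "Iq = integral {0..2*pi} (\<lambda>t. (f (?z t) - x) \<bullet> (f (?z t) - x))"
    have iu: "(\<lambda>t. - u (f (?z t))) integrable_on {0..2*pi}"
      and iq: "(\<lambda>t. (f (?z t) - x) \<bullet> (f (?z t) - x)) integrable_on {0..2*pi}"
      by (intro integrable_continuous_interval continuous_intros cu cf)+
    have nn: "0 \<le> Iu" "0 \<le> Iq"
      unfolding Iu_def Iq_def by (rule integral_nonneg[OF iu], use im(3)[OF zb] in simp)
        (rule integral_nonneg[OF iq], simp)
    \<comment> \<open>\<phi> and \<open>u\<close> agree at \<open>x\<close>, so this inequality puts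
      the sum of the nonnegative \<open>Iu\<close> and \<open>\<epsilon> * Iq\<close> below
      \<open>2 pi (- u x)\<close>.\<close>
    have "2 * pi * \<phi> (f 0) \<le> integral {0..2*pi} (\<lambda>t. \<phi> (f (?z t)))"
      by (rule subharmonic_mean_le[OF P s(1,2) sub])
    also have "\<dots> = integral {0..2*pi} (\<lambda>t. - (- u (f (?z t))) - \<epsilon> * ((f (?z t) - x) \<bullet> (f (?z t) - x)))"
      by (simp add: \<phi>_def)
    also have "\<dots> = - Iu - \<epsilon> * Iq"
      unfolding Iu_def Iq_def
      by (intro integral_unique has_integral_diff has_integral_neg has_integral_mult_right integrable_integral iu iq)
    finally have mean: "Iu + \<epsilon> * Iq \<le> 2 * pi * (- u x)" by (simp add: \<phi>_def x_def)
    have Iu: "Iu \<le> 2 * pi * (- u x)" using mean nn \<epsilon> by (smt (verit) mult_nonneg_nonneg)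
    have "Iq * \<epsilon> \<le> 2 * pi * (- u x)" using mean nn by (simp add: mult.commute)
    then have Iq: "Iq \<le> 2 * pi * (- u x) / \<epsilon>" by (simp only: pos_le_divide_eq[OF \<epsilon>])
    have "pi * s * \<bar>u' x (pd_x f 0)\<bar> \<le> integral {0..2*pi} (\<lambda>t. \<bar>u' x (f (?z t) - x)\<bar>)"
      by (rule CH_disc_gradient_bound[OF f s(1,3)])
    also have "\<dots> \<le> integral {0..2*pi} (\<lambda>t. - u (f (?z t)) + (- u x) + M * ((f (?z t) - x) \<bullet> (f (?z t) - x)))"
    proof (rule integral_le)
      show "(\<lambda>t. \<bar>u' x (f (?z t) - x)\<bar>) integrable_on {0..2*pi}"
        by (intro integrable_continuous_interval continuous_intros cf)
      show "(\<lambda>t. - u (f (?z t)) + (- u x) + M * ((f (?z t) - x) \<bullet> (f (?z t) - x))) integrable_on {0..2*pi}"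
        by (intro integrable_continuous_interval continuous_intros cu cf)
      \<comment> \<open>Both values of \<open>u\<close> are at most 0, so their difference is
        bounded by the sum of their absolute values.\<close>
      show "\<bar>u' x (f (?z t) - x)\<bar> \<le> - u (f (?z t)) + (- u x) + M * ((f (?z t) - x) \<bullet> (f (?z t) - x))" for t
        using taylor[OF xB(1) im(1)[OF zb[of t]]] im(3)[OF zb[of t]] im(3)[of 0] r(1) by (simp add: x_def)
    qed
    also have "\<dots> = Iu + 2 * pi * (- u x) + M * Iq"
    proof (rule integral_unique, unfold Iu_def Iq_def, intro has_integral_add has_integral_mult_right integrable_integral iu iq)
      show "((\<lambda>t. - u x) has_integral 2 * pi * (- u x)) {0..2*pi}"
        using has_integral_const_real[of "- u x" 0 "2*pi"] by simp
    qed
    also have "\<dots> \<le> 2 * pi * (- u x) + 2 * pi * (- u x) + M * (2 * pi * (- u x) / \<epsilon>)"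
      using Iu Iq M by (intro add_mono mult_left_mono) auto
    also have "\<dots> = pi * s * (C * (- u x))"
      using s \<epsilon> by (simp add: C_def field_simps)
    finally have "\<bar>u' x (pd_x f 0)\<bar> \<le> C * (- u x)"
      using mult_le_cancel_left_pos[OF mult_pos_pos[OF pi_gt_zero s(1)]] by blast
    then show "\<bar>frechet_derivative u (at (f 0)) (pd_x f 0)\<bar> \<le> C * (- u (f 0))"
      using C2_derivsD(6)[OF D xB(2)] by (simp add: x_def)
  qed
qed

section \<open>Bounds for the minimal pseudometric\<close>

lemma CH_discI:
  assumes D: "C2_derivs (ball 0 1) f f' f''"
    and "\<And>z. z \<in> ball 0 1 \<Longrightarrow> f'' z 1 1 + f'' z \<i> \<i> = 0"
    and "\<And>z. z \<in> ball 0 1 \<Longrightarrow> norm (f' z 1) = norm (f' z \<i>)" "\<And>z. z \<in> ball 0 1 \<Longrightarrow> f' z 1 \<bullet> f' z \<i> = 0"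
    and "\<And>z. z \<in> ball 0 1 \<Longrightarrow> f z \<in> \<Omega>"
  shows "f \<in> CH_disc \<Omega>"
proof -
  have "C1_on (ball 0 1) f" unfolding C1_on_def using C2_derivsD(1,4)[OF D] by blast
  moreover have "C2_on (ball 0 1) f" using D C2_on_iff by blast
  ultimately show ?thesis
    unfolding CH_disc_def harmonic_map_on_def conformal_on_def pd_x_def pd_y_def
    using assms(2-5) by (auto simp: C2_derivsD(6)[OF D] C2_derivsD(7)[OF D open_ball])
qed

text \<open>The pseudometric admits only \<open>r > 0\<close>; precomposition with
  \<open>z -> - z\<close> is what makes it even in \<open>v\<close>, and hence lengths invariant
  under reversal.\<close>

lemma CH_disc_reflect:
  assumes f: "f \<in> CH_disc \<Omega>"
  shows "(\<lambda>z. f (- z)) \<in> CH_disc \<Omega>" "pd_x (\<lambda>z. f (- z)) 0 = - pd_x f 0"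
proof -
  have harm: "harmonic_map_on (ball 0 1) f" using f by (simp add: CH_disc_def)
  then have "C2_on (ball 0 1) f" by (simp add: harmonic_map_on_def)
  then obtain f' f'' where F: "C2_derivs (ball 0 1) f f' f''" by (auto simp: C2_on_iff)
  have neg: "((\<lambda>z. g (- z)) has_derivative (\<lambda>h. g' (- h))) (at z)" if "(g has_derivative g') (at (- z))"
    for g :: "complex \<Rightarrow> 'b::real_normed_vector" and g' z
    using has_derivative_compose[OF has_derivative_minus[OF has_derivative_ident] that] by simp
  have D: "C2_derivs (ball 0 1) (\<lambda>z. f (- z)) (\<lambda>z. - f' (- z)) (\<lambda>z. f'' (- z))"
    unfolding C2_derivs_def
  proof (intro conjI ballI)
    fix z :: complex assume z: "z \<in> ball 0 1"
    then have mz: "- z \<in> ball 0 1" by simp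
    show "((\<lambda>z. f (- z)) has_derivative blinfun_apply (- f' (- z))) (at z)"
      by (rule has_derivative_eq_rhs[OF neg[OF C2_derivsD(1)[OF F mz]]])
         (simp add: fun_eq_iff blinfun.minus_left blinfun.minus_right)
    show "((\<lambda>z. - f' (- z)) has_derivative blinfun_apply (f'' (- z))) (at z)"
      by (rule has_derivative_eq_rhs[OF has_derivative_minus[OF neg[OF C2_derivsD(2)[OF F mz]]]])
         (simp add: fun_eq_iff blinfun.minus_right)
  next
    show "continuous_on (ball 0 1) (\<lambda>z. f'' (- z))"
      by (rule continuous_on_compose2[OF C2_derivsD(3)[OF F]]) (auto intro!: continuous_intros)
  qed
  show "(\<lambda>z. f (- z)) \<in> CH_disc \<Omega>"
  proof (rule CH_discI[OF D])
    fix z :: complex assume "z \<in> ball 0 1"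
    then have mz: "- z \<in> ball 0 1" by simp
    show "f'' (- z) 1 1 + f'' (- z) \<i> \<i> = 0"
    proof -
      have "hess f (- z) 1 1 + hess f (- z) \<i> \<i> = 0" using harm mz unfolding harmonic_map_on_def by blast
      then show ?thesis unfolding C2_derivsD(7)[OF F open_ball mz] .
    qed
    show "norm ((- f' (- z)) 1) = norm ((- f' (- z)) \<i>)" "(- f' (- z)) 1 \<bullet> (- f' (- z)) \<i> = 0"
      using CH_discD(3,4)[OF f mz] C2_derivsD(6)[OF F mz] by (simp_all add: pd_x_def pd_y_def blinfun.minus_left)
    show "f (- z) \<in> \<Omega>" by (rule CH_discD(5)[OF f mz])
  qed
  have "0 \<in> (ball 0 1 :: complex set)" by simp
  then show "pd_x (\<lambda>z. f (- z)) 0 = - pd_x f 0"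
    using C2_derivsD(6)[OF D] C2_derivsD(6)[OF F] by (simp add: pd_x_def blinfun.minus_left)
qed

lemma exists_orthogonal_same_norm:
  fixes v :: "'a::euclidean_space"
  assumes "2 \<le> DIM('a)"
  obtains w where "norm w = norm v" "v \<bullet> w = 0"
proof -
  have "dim {v} < DIM('a)" using assms dim_le_card[of "{v}"] by (simp add: dim_singleton)
  then obtain y where y: "y \<noteq> 0" "\<And>x. x \<in> span {v} \<Longrightarrow> orthogonal y x"
    using orthogonal_to_subspace_exists[of "{v}"] by blast
  show thesis
  proof (rule that)
    show "norm ((norm v / norm y) *\<^sub>R y) = norm v" using y(1) by simp
    show "v \<bullet> ((norm v / norm y) *\<^sub>R y) = 0"
      using y(2)[of v] by (simp add: orthogonal_def inner_commute span_base)
  qed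
qed

text \<open>The linear map sending 1 to \<open>v\<close> and \<open>\<i>\<close> to an orthogonal
  vector of the same length multiplies norms by \<open>|v|\<close>. These discs make the sets in the
  infimum nonempty and give the Euclidean upper bound.\<close>

lemma affine_CH_disc:
  fixes x v :: "'a::euclidean_space"
  assumes dim: "2 \<le> DIM('a)" and B: "ball x d \<subseteq> \<Omega>" and v: "norm v \<le> d" "d > 0"
  obtains f where "f \<in> CH_disc \<Omega>" "f 0 = x" "pd_x f 0 = v"
proof -
  obtain w where w: "norm w = norm v" "v \<bullet> w = 0" using exists_orthogonal_same_norm[OF dim] .
  define L where "L = Blinfun (\<lambda>z. Re z *\<^sub>R v + Im z *\<^sub>R w)"
  have L [simp]: "blinfun_apply L z = Re z *\<^sub>R v + Im z *\<^sub>R w" for z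
    unfolding L_def by (subst bounded_linear_Blinfun_apply) (auto intro!: bounded_linear_intros bounded_linear_Re bounded_linear_Im)
  define f where "f z = L z - (- x)" for z
  have D: "C2_derivs (ball 0 1) f (\<lambda>_. L) (\<lambda>_. 0)"
    unfolding C2_derivs_def f_def
    by (auto intro!: derivative_eq_intros bounded_linear_imp_has_derivative blinfun.bounded_linear_right simp: zero_blinfun.rep_eq simp del: L)
  have nL: "norm (L z) = norm z * norm v" for z
  proof -
    have "norm (L z)^2 = (Re z)^2 * (norm v)^2 + (Im z)^2 * (norm w)^2"
      unfolding L power2_norm_eq_inner using w(2)
      by (simp add: inner_add_left inner_add_right inner_commute[of w v] power2_eq_square)
    also have "\<dots> = (norm z * norm v)^2" by (simp add: w(1) power_mult_distrib cmod_power2 algebra_simps)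
    finally show ?thesis by (rule power2_eq_imp_eq) auto
  qed
  show thesis
  proof (rule that)
    show "f \<in> CH_disc \<Omega>"
    proof (rule CH_discI[OF D])
      fix z :: complex assume z: "z \<in> ball 0 1"
      have "norm (L z) < d"
      proof (cases "v = 0")
        case False
        then have "norm z * norm v < 1 * norm v" using z by (intro mult_strict_right_mono) auto
        then show ?thesis using v unfolding nL by simp
      qed (use v in \<open>simp add: nL del: L\<close>)
      then have "f z \<in> ball x d" by (simp add: f_def dist_norm del: L)
      then show "f z \<in> \<Omega>" using B by blast
    qed (use w in auto)
    show "f 0 = x" by (simp add: f_def)
    show "pd_x f 0 = v" using C2_derivsD(6)[OF D, of 0] by (simp add: pd_x_def)
  qed
qed

lemma minimal_pseudometric_le:
  assumes "f \<in> CH_disc \<Omega>" "f 0 = x" "pd_x f 0 = r *\<^sub>R v" "r > 0"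
  shows "minimal_pseudometric \<Omega> x v \<le> 1 / r"
  unfolding minimal_pseudometric_def
proof (rule cInf_lower)
  show "bdd_below {1 / r |r. 0 < r \<and> (\<exists>f\<in>CH_disc \<Omega>. f 0 = x \<and> pd_x f 0 = r *\<^sub>R v)}"
    by (auto intro!: bdd_belowI[of _ 0])
qed (use assms in blast)

text \<open>A lower bound for a real \<open>Inf\<close> requires a nonempty set; a small affine disc
  provides an element.\<close>

lemma minimal_pseudometric_geI:
  fixes \<Omega> :: "'a::euclidean_space set"
  assumes dim: "2 \<le> DIM('a)" and \<Omega>: "open \<Omega>" "x \<in> \<Omega>"
    and le: "\<And>f r. \<lbrakk>f \<in> CH_disc \<Omega>; f 0 = x; pd_x f 0 = r *\<^sub>R v; r > 0\<rbrakk> \<Longrightarrow> c \<le> 1 / r"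
  shows "c \<le> minimal_pseudometric \<Omega> x v"
  unfolding minimal_pseudometric_def
proof (rule cInf_greatest)
  obtain d where d: "d > 0" "ball x d \<subseteq> \<Omega>" using \<Omega> by (meson openE)
  \<comment> \<open>The added 1 covers \<open>v = 0\<close>.\<close>
  define r where "r = d / (norm v + 1)"
  have n: "norm v + 1 > 0" by (simp add: add_nonneg_pos)
  have "norm (r *\<^sub>R v) \<le> d" using d(1) n by (simp add: r_def divide_le_eq mult_left_mono)
  then obtain f where "f \<in> CH_disc \<Omega>" "f 0 = x" "pd_x f 0 = r *\<^sub>R v"
    using affine_CH_disc[OF dim d(2) _ d(1)] by blast
  moreover have "r > 0" using d(1) n by (simp add: r_def)
  ultimately show "{1 / r |r. 0 < r \<and> (\<exists>f\<in>CH_disc \<Omega>. f 0 = x \<and> pd_x f 0 = r *\<^sub>R v)} \<noteq> {}" by blast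
qed (use le in blast)

lemma minimal_pseudometric_le_norm:
  fixes \<Omega> :: "'a::euclidean_space set"
  assumes dim: "2 \<le> DIM('a)" and B: "ball x d \<subseteq> \<Omega>" "d > 0"
  shows "minimal_pseudometric \<Omega> x v \<le> norm v / d"
proof (cases "v = 0")
  case True
  obtain f where f: "f \<in> CH_disc \<Omega>" "f 0 = x" "pd_x f 0 = 0"
    using affine_CH_disc[OF dim B(1), of 0] B(2) by auto
  \<comment> \<open>For \<open>v = 0\<close> the same disc is admissible with every
    \<open>r > 0\<close>, so the infimum is at most every positive number.\<close>
  have "minimal_pseudometric \<Omega> x v \<le> 0 + e" if "e > 0" for e
    using minimal_pseudometric_le[OF f(1,2), of "1 / e" v] f(3) True that by simp
  then have "minimal_pseudometric \<Omega> x v \<le> 0" by (rule field_le_epsilon)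
  then show ?thesis using True by simp
next
  case False
  then have "norm ((d / norm v) *\<^sub>R v) \<le> d" using B by simp
  then obtain f where "f \<in> CH_disc \<Omega>" "f 0 = x" "pd_x f 0 = (d / norm v) *\<^sub>R v"
    using affine_CH_disc[OF dim B(1) _ B(2)] by blast
  from minimal_pseudometric_le[OF this] show ?thesis using False B by simp
qed

text \<open>A disc with parameter \<open>r\<close> for \<open>v\<close> has parameter
  \<open>r / |c|\<close> for \<open>c v\<close>, after reflection when \<open>c < 0\<close>.\<close>

lemma minimal_pseudometric_scaleR_le:
  fixes \<Omega> :: "'a::euclidean_space set"
  assumes dim: "2 \<le> DIM('a)" and \<Omega>: "open \<Omega>" "x \<in> \<Omega>" and c: "c \<noteq> 0"
  shows "minimal_pseudometric \<Omega> x (c *\<^sub>R v) \<le> \<bar>c\<bar> * minimal_pseudometric \<Omega> x v"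
proof -
  have "minimal_pseudometric \<Omega> x (c *\<^sub>R v) / \<bar>c\<bar> \<le> minimal_pseudometric \<Omega> x v"
  proof (rule minimal_pseudometric_geI[OF dim \<Omega>])
    fix f r assume f: "f \<in> CH_disc \<Omega>" "f 0 = x" "pd_x f 0 = r *\<^sub>R v" "r > 0"
    have "\<exists>g\<in>CH_disc \<Omega>. g 0 = x \<and> pd_x g 0 = (r / \<bar>c\<bar>) *\<^sub>R (c *\<^sub>R v)"
    proof (cases "c > 0")
      case True then show ?thesis using f by auto
    next
      case False
      then have "(r / \<bar>c\<bar>) *\<^sub>R (c *\<^sub>R v) = - (r *\<^sub>R v)" using c by simp
      then show ?thesis using f CH_disc_reflect[OF f(1)]
        by (intro bexI[of _ "\<lambda>z. f (- z)"]) auto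
    qed
    then obtain g where "g \<in> CH_disc \<Omega>" "g 0 = x" "pd_x g 0 = (r / \<bar>c\<bar>) *\<^sub>R (c *\<^sub>R v)" by blast
    then have "minimal_pseudometric \<Omega> x (c *\<^sub>R v) \<le> 1 / (r / \<bar>c\<bar>)"
      by (rule minimal_pseudometric_le) (use f(4) c in simp)
    then show "minimal_pseudometric \<Omega> x (c *\<^sub>R v) / \<bar>c\<bar> \<le> 1 / r"
      using c f(4) by (simp add: field_simps)
  qed
  then show ?thesis using c by (simp add: field_simps)
qed

section \<open>Lengths and distances\<close>

text \<open>Off a finite set containing both endpoints, the derivative within \<open>{0..1}\<close>
  that defines the speed is a two-sided derivative.\<close>

lemma piecewise_smooth_path_regular:
  assumes "piecewise_smooth_path \<gamma>"
  obtains S where "finite S" "continuous_on {0..1} \<gamma>" "0 \<in> S" "1 \<in> S"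
    "\<And>t. t \<in> {0..1} - S \<Longrightarrow> (\<gamma> has_vector_derivative vector_derivative \<gamma> (at t within {0..1})) (at t)"
proof -
  obtain N and s :: "nat \<Rightarrow> real" where s0: "s 0 = 0" and sN: "s N = 1"
    and s: "\<And>i. i < N \<Longrightarrow> s i < s (Suc i) \<and> smooth_on_interval (s i) (s (Suc i)) \<gamma>"
    using assms unfolding piecewise_smooth_path_def by blast
  have "n \<le> N \<Longrightarrow> s 0 \<le> s n \<and> continuous_on {s 0..s n} \<gamma> \<and>
      (\<exists>S. finite S \<and> (\<forall>t\<in>{s 0..s n} - S. \<gamma> differentiable at t))" for n
  proof (induction n)
    case 0
    then show ?case by (auto intro!: exI[of _ "{s 0}"])
  next
    case (Suc n)
    then obtain S where IH: "s 0 \<le> s n" "continuous_on {s 0..s n} \<gamma>" "finite S"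
      "\<forall>t\<in>{s 0..s n} - S. \<gamma> differentiable at t" by auto
    have lt: "s n < s (Suc n)" and "smooth_on_interval (s n) (s (Suc n)) \<gamma>" using s[of n] Suc.prems by auto
    then obtain D :: "nat \<Rightarrow> real \<Rightarrow> 'a" where D: "D 0 = \<gamma>"
      "\<And>k t. t \<in> {s n..s (Suc n)} \<Longrightarrow> (D k has_vector_derivative D (Suc k) t) (at t within {s n..s (Suc n)})"
      unfolding smooth_on_interval_def by blast
    have D0: "(\<gamma> has_vector_derivative D 1 t) (at t within {s n..s (Suc n)})" if "t \<in> {s n..s (Suc n)}" for t
      using D(2)[OF that, of 0] D(1) by simp
    have un: "{s 0..s (Suc n)} = {s 0..s n} \<union> {s n..s (Suc n)}" using IH(1) lt by auto
    have "continuous_on {s n..s (Suc n)} \<gamma>" using D0 by (rule continuous_on_vector_derivative)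
    then have "continuous_on {s 0..s (Suc n)} \<gamma>"
      unfolding un using IH(2) by (intro continuous_on_closed_Un) auto
    moreover have "\<gamma> differentiable at t" if "t \<in> {s 0..s (Suc n)} - (S \<union> {s n, s (Suc n)})" for t
    proof (cases "t < s n")
      case True then show ?thesis using IH(4) that by auto
    next
      case False
      then have t: "t \<in> {s n<..<s (Suc n)}" using that by auto
      then have "(\<gamma> has_vector_derivative D 1 t) (at t)"
        using D0[of t] at_within_interior[of t "{s n..s (Suc n)}"] by auto
      then show ?thesis by (rule differentiableI_vector)
    qed
    ultimately show ?case using IH(1,3) lt by (intro conjI exI[of _ "S \<union> {s n, s (Suc n)}"]) auto
  qed
  from this[of N] obtain S where S: "finite S" "continuous_on {0..1} \<gamma>" "\<And>t. t \<in> {0..1} - S \<Longrightarrow> \<gamma> differentiable at t"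
    using s0 sN by auto
  show thesis
  proof (rule that[of "S \<union> {0, 1}"])
    fix t assume t: "t \<in> {0..1} - (S \<union> {0, 1})"
    then have "(\<gamma> has_vector_derivative vector_derivative \<gamma> (at t)) (at t)"
      using S(3) vector_derivative_works by auto
    moreover from this have "vector_derivative \<gamma> (at t within {0..1}) = vector_derivative \<gamma> (at t)"
      using t by (intro vector_derivative_at_within_ivl) auto
    ultimately show "(\<gamma> has_vector_derivative vector_derivative \<gamma> (at t within {0..1})) (at t)" by simp
  qed (use S in auto)
qed

lemma smooth_on_interval_affine:
  fixes \<gamma> :: "real \<Rightarrow> 'a::real_normed_vector"
  assumes "smooth_on_interval a b \<gamma>"
    and maps: "\<And>t. t \<in> {a'..b'} \<Longrightarrow> c * t + d \<in> {a..b}"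
    and eq: "\<And>t. t \<in> {a'..b'} \<Longrightarrow> \<gamma>' t = \<gamma> (c * t + d)"
  shows "smooth_on_interval a' b' \<gamma>'"
proof -
  obtain D :: "nat \<Rightarrow> real \<Rightarrow> 'a" where D: "D 0 = \<gamma>"
    "\<And>k t. t \<in> {a..b} \<Longrightarrow> (D k has_vector_derivative D (Suc k) t) (at t within {a..b})"
    using assms(1) unfolding smooth_on_interval_def by blast
  \<comment> \<open>\<open>smooth_on_interval\<close> asks for equality of \<open>E 0\<close> and
    \<open>\<gamma>'\<close> as functions, while \<open>\<gamma>'\<close> is an affine
    reparametrisation only on the interval; hence the separate case \<open>k = 0\<close>.\<close>
  define E where "E k t = (if k = 0 then \<gamma>' t else c ^ k *\<^sub>R D k (c * t + d))" for k :: nat and t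
  have E: "E k t = c ^ k *\<^sub>R D k (c * t + d)" if "t \<in> {a'..b'}" for k t
    using eq[OF that] D(1) by (simp add: E_def)
  have "(E k has_vector_derivative E (Suc k) t) (at t within {a'..b'})" if t: "t \<in> {a'..b'}" for k t
  proof -
    have "((\<lambda>t. c * t + d) has_vector_derivative c) (at t within {a'..b'})"
      by (auto intro!: derivative_eq_intros simp flip: has_real_derivative_iff_has_vector_derivative)
    moreover have "(D k has_vector_derivative D (Suc k) (c * t + d)) (at (c * t + d) within (\<lambda>t. c * t + d) ` {a'..b'})"
      using maps by (intro has_vector_derivative_within_subset[OF D(2)[OF maps[OF t]]]) blast
    ultimately have "((\<lambda>t. D k (c * t + d)) has_vector_derivative c *\<^sub>R D (Suc k) (c * t + d)) (at t within {a'..b'})"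
      using vector_diff_chain_within[of "\<lambda>t. c * t + d"] by (simp add: o_def)
    then have "((\<lambda>t. c ^ k *\<^sub>R D k (c * t + d)) has_vector_derivative c ^ k *\<^sub>R c *\<^sub>R D (Suc k) (c * t + d)) (at t within {a'..b'})"
      by (rule bounded_linear.has_vector_derivative[OF bounded_linear_scaleR_right])
    then have "(E k has_vector_derivative c ^ k *\<^sub>R c *\<^sub>R D (Suc k) (c * t + d)) (at t within {a'..b'})"
      using has_vector_derivative_transform[of t "{a'..b'}" "E k" "\<lambda>t. c ^ k *\<^sub>R D k (c * t + d)"] t E[of _ k] by blast
    then show ?thesis using E[OF t, of "Suc k"] by (simp add: mult.commute)
  qed
  moreover have "E 0 = \<gamma>'" by (simp add: E_def fun_eq_iff)
  ultimately show ?thesis unfolding smooth_on_interval_def by blast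
qed

lemma partition_mono:
  fixes s :: "nat \<Rightarrow> real"
  assumes "\<And>i. i < N \<Longrightarrow> s i < s (Suc i)" "i \<le> j" "j \<le> N"
  shows "s i \<le> s j"
  using assms(2,3)
proof (induction j rule: dec_induct)
  case (step n)
  then show ?case using assms(1)[of n] by simp
qed simp

lemma piecewise_smooth_path_join:
  fixes \<gamma>1 \<gamma>2 :: "real \<Rightarrow> 'a::real_normed_vector"
  assumes "piecewise_smooth_path \<gamma>1" "piecewise_smooth_path \<gamma>2" and eq: "pathfinish \<gamma>1 = pathstart \<gamma>2"
  shows "piecewise_smooth_path (\<gamma>1 +++ \<gamma>2)"
proof -
  obtain N1 and s1 :: "nat \<Rightarrow> real" where s1: "s1 0 = 0" "s1 N1 = 1"
    "\<And>i. i < N1 \<Longrightarrow> s1 i < s1 (Suc i)" "\<And>i. i < N1 \<Longrightarrow> smooth_on_interval (s1 i) (s1 (Suc i)) \<gamma>1"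
    using assms(1) unfolding piecewise_smooth_path_def by blast
  obtain N2 and s2 :: "nat \<Rightarrow> real" where s2: "s2 0 = 0" "s2 N2 = 1"
    "\<And>i. i < N2 \<Longrightarrow> s2 i < s2 (Suc i)" "\<And>i. i < N2 \<Longrightarrow> smooth_on_interval (s2 i) (s2 (Suc i)) \<gamma>2"
    using assms(2) unfolding piecewise_smooth_path_def by blast
  \<comment> \<open>At \<open>i = N1\<close> both formulas give \<open>1/2\<close>.\<close>
  define s where "s i = (if i \<le> N1 then s1 i / 2 else 1 / 2 + s2 (i - N1) / 2)" for i
  have "s i < s (Suc i) \<and> smooth_on_interval (s i) (s (Suc i)) (\<gamma>1 +++ \<gamma>2)" if i: "i < N1 + N2" for i
  proof (cases "i < N1")
    case True
    then have e: "s i = s1 i / 2" "s (Suc i) = s1 (Suc i) / 2" by (auto simp: s_def)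
    have "s1 (Suc i) \<le> s1 N1" using True by (intro partition_mono[of N1 s1]) (auto intro: s1(3))
    then have l1: "s1 (Suc i) \<le> 1" using s1(2) by simp
    have "smooth_on_interval (s i) (s (Suc i)) (\<gamma>1 +++ \<gamma>2)"
    proof (rule smooth_on_interval_affine[OF s1(4)[OF True], where c = 2 and d = 0])
      show "(\<gamma>1 +++ \<gamma>2) t = \<gamma>1 (2 * t + 0)" if "t \<in> {s i..s (Suc i)}" for t
        using that l1 e by (simp add: joinpaths_def)
    qed (auto simp: e)
    with s1(3)[OF True] show ?thesis unfolding e by simp
  next
    case False
    define j where "j = i - N1"
    have j: "j < N2" using False i by (simp add: j_def)
    have e: "s i = 1/2 + s2 j / 2" "s (Suc i) = 1/2 + s2 (Suc j) / 2"
      using False s1(2) s2(1) by (auto simp: s_def j_def Suc_diff_le not_less)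
    have "s2 0 \<le> s2 j" using j by (intro partition_mono[of N2 s2]) (auto intro: s2(3))
    then have l0: "0 \<le> s2 j" using s2(1) by simp
    have "smooth_on_interval (s i) (s (Suc i)) (\<gamma>1 +++ \<gamma>2)"
    proof (rule smooth_on_interval_affine[OF s2(4)[OF j], where c = 2 and d = "-1"])
      show "(\<gamma>1 +++ \<gamma>2) t = \<gamma>2 (2 * t + - 1)" if "t \<in> {s i..s (Suc i)}" for t
      proof (cases "t = 1/2")
        case True
        show ?thesis unfolding True using eq by (simp add: joinpaths_def pathfinish_def pathstart_def)
      next
        case False
        then have "t > 1/2" using that l0 e by auto
        then show ?thesis by (simp add: joinpaths_def)
      qed
    qed (auto simp: e)
    with s2(3)[OF j] show ?thesis unfolding e by simp
  qed
  moreover have "s 0 = 0" "s (N1 + N2) = 1"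
    using s1(1,2) s2(1,2) by (cases "N2 = 0"; simp add: s_def)+
  ultimately show ?thesis unfolding piecewise_smooth_path_def by blast
qed

lemma piecewise_smooth_path_reverse:
  fixes \<gamma> :: "real \<Rightarrow> 'a::real_normed_vector"
  assumes "piecewise_smooth_path \<gamma>"
  shows "piecewise_smooth_path (reversepath \<gamma>)"
proof -
  obtain N and s :: "nat \<Rightarrow> real" where s: "s 0 = 0" "s N = 1"
    "\<And>i. i < N \<Longrightarrow> s i < s (Suc i)" "\<And>i. i < N \<Longrightarrow> smooth_on_interval (s i) (s (Suc i)) \<gamma>"
    using assms unfolding piecewise_smooth_path_def by blast
  define s' where "s' i = 1 - s (N - i)" for i
  have "s' i < s' (Suc i) \<and> smooth_on_interval (s' i) (s' (Suc i)) (reversepath \<gamma>)" if i: "i < N" for i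
  proof -
    define j where "j = N - Suc i"
    have j: "j < N" "N - i = Suc j" "N - Suc i = j" using i by (auto simp: j_def)
    have "smooth_on_interval (s' i) (s' (Suc i)) (reversepath \<gamma>)"
      by (rule smooth_on_interval_affine[OF s(4)[OF j(1)], where c = "-1" and d = 1])
         (auto simp: s'_def j(2,3) reversepath_def)
    with s(3)[OF j(1)] show ?thesis by (simp add: s'_def j(2,3))
  qed
  moreover have "s' 0 = 0" "s' N = 1" using s by (auto simp: s'_def)
  ultimately show ?thesis unfolding piecewise_smooth_path_def by blast
qed

lemma piecewise_smooth_linepath: "piecewise_smooth_path (linepath x y)"
proof -
  define D where "D k = (if k = 0 then linepath x y else if k = 1 then (\<lambda>_. y - x) else (\<lambda>_. 0))" for k :: nat
  have "smooth_on_interval 0 1 (linepath x y)"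
    unfolding smooth_on_interval_def
  proof (intro exI[of _ D] conjI allI ballI)
    fix k :: nat and t :: real
    show "(D k has_vector_derivative D (Suc k) t) (at t within {0..1})"
    proof (cases "k = 0")
      case True then show ?thesis using has_vector_derivative_linepath_within by (simp add: D_def)
    next
      case False
      then show ?thesis by (cases "k = 1") (auto simp: D_def)
    qed
  qed (simp add: D_def)
  then show ?thesis
    unfolding piecewise_smooth_path_def by (intro exI[of _ 1] exI[of _ real]) auto
qed

section \<open>Length of paths and the extended minimal distance\<close>

definition minimal_speed :: "'a::euclidean_space set \<Rightarrow> (real \<Rightarrow> 'a) \<Rightarrow> real \<Rightarrow> real" where
  "minimal_speed \<Omega> \<gamma> t = minimal_pseudometric \<Omega> (\<gamma> t) (vector_derivative \<gamma> (at t within {0..1}))"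

definition minimal_length :: "'a::euclidean_space set \<Rightarrow> (real \<Rightarrow> 'a) \<Rightarrow> ennreal" where
  "minimal_length \<Omega> \<gamma> = (\<integral>\<^sup>+t\<in>{0..1}. ennreal (minimal_speed \<Omega> \<gamma> t) \<partial>lborel)"

definition minimal_paths :: "'a::euclidean_space set \<Rightarrow> 'a \<Rightarrow> 'a \<Rightarrow> (real \<Rightarrow> 'a) set" where
  "minimal_paths \<Omega> x y = {\<gamma>. piecewise_smooth_path \<gamma> \<and> path_image \<gamma> \<subseteq> \<Omega> \<and> pathstart \<gamma> = x \<and> pathfinish \<gamma> = y}"

text \<open>\<open>enn2real\<close> sends \<infinity> to 0, which would spoil inequalities; they are
  proved for this extended value and transferred once it is known to be finite.\<close>

definition minimal_edist :: "'a::euclidean_space set \<Rightarrow> 'a \<Rightarrow> 'a \<Rightarrow> ennreal" where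
  "minimal_edist \<Omega> x y = (INF \<gamma>\<in>minimal_paths \<Omega> x y. minimal_length \<Omega> \<gamma>)"

lemma minimal_pseudodistance_eq: "minimal_pseudodistance \<Omega> x y = enn2real (minimal_edist \<Omega> x y)"
  by (simp add: minimal_pseudodistance_def minimal_edist_def minimal_paths_def minimal_length_def minimal_speed_def)

text \<open>Measurability of the speed is nowhere established, so lengths are lower integrals, to be
  estimated through the measurable functions below the integrand.\<close>

lemma nn_integral_leI:
  assumes "\<And>g. g \<in> borel_measurable M \<Longrightarrow> g \<le> f \<Longrightarrow> (\<integral>\<^sup>+x. g x \<partial>M) \<le> c"
  shows "(\<integral>\<^sup>+x. f x \<partial>M) \<le> c"
  unfolding nn_integral_def
proof (rule SUP_least)
  fix g assume "g \<in> {g. simple_function M g \<and> g \<le> f}"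
  then have g: "simple_function M g" "g \<le> f" by auto
  show "integral\<^sup>S M g \<le> c"
    using assms[OF borel_measurable_simple_function[OF g(1)] g(2)] nn_integral_eq_simple_integral[OF g(1)] by simp
qed

text \<open>Stated for a measurable \<open>g\<close> below the speed of \<beta>, because the change
  of variables is available for measurable functions; reversal and concatenation follow by taking
  suprema over such \<open>g\<close>.\<close>

lemma minimal_length_reparametrize:
  fixes \<Omega> :: "'a::euclidean_space set" and g :: "real \<Rightarrow> ennreal"
  assumes dim: "2 \<le> DIM('a)" and \<Omega>: "open \<Omega>" and \<gamma>: "piecewise_smooth_path \<gamma>" "path_image \<gamma> \<subseteq> \<Omega>"
    and c: "c \<noteq> 0" and maps: "\<And>s. s \<in> {0..1} \<Longrightarrow> a + c * s \<in> {0..1}"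
    and eq: "\<And>s. s \<in> {0..1} \<Longrightarrow> \<beta> (a + c * s) = \<gamma> s"
    and g: "g \<in> borel_measurable borel" "\<And>s. s \<in> {0..1} \<Longrightarrow> g (a + c * s) \<le> ennreal (minimal_speed \<Omega> \<beta> (a + c * s))"
      "\<And>s. s \<notin> {0..1} \<Longrightarrow> g (a + c * s) = 0"
  shows "(\<integral>\<^sup>+t. g t \<partial>lborel) \<le> minimal_length \<Omega> \<gamma>"
proof -
  obtain S where S: "finite S" "0 \<in> S" "1 \<in> S"
    "\<And>t. t \<in> {0..1} - S \<Longrightarrow> (\<gamma> has_vector_derivative vector_derivative \<gamma> (at t within {0..1})) (at t)"
    using piecewise_smooth_path_regular[OF \<gamma>(1)] by metis
  have "(\<integral>\<^sup>+t. g t \<partial>lborel) = ennreal \<bar>c\<bar> * (\<integral>\<^sup>+s. g (a + c * s) \<partial>lborel)"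
    using nn_integral_real_affine[OF g(1) c, of a] by simp
  also have "\<dots> = (\<integral>\<^sup>+s. ennreal \<bar>c\<bar> * g (a + c * s) \<partial>lborel)"
    using g(1) by (subst nn_integral_cmult) auto
  also have "\<dots> \<le> minimal_length \<Omega> \<gamma>"
    unfolding minimal_length_def
  proof (rule nn_integral_mono_AE)
    have "AE s in lborel. s \<notin> S" by (rule AE_not_in[OF finite_imp_null_set_lborel[OF S(1)]])
    then show "AE s in lborel. ennreal \<bar>c\<bar> * g (a + c * s) \<le> ennreal (minimal_speed \<Omega> \<gamma> s) * indicator {0..1} s"
    proof eventually_elim
      case (elim s)
      show ?case
      proof (cases "s \<in> {0..1}")
        case False then show ?thesis using g(3) by simp
      next
        case True
        then have s: "0 < s" "s < 1" using elim S(2,3) by (auto simp: less_le)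
        let ?t = "a + c * s" and ?v = "vector_derivative \<gamma> (at s within {0..1})"
        have dv: "(\<gamma> has_vector_derivative ?v) (at s)" using S(4) True elim by simp
        have inv_eq: "(a + c * s - a) / c = s" using c by simp
        \<comment> \<open>Near an interior point, \<beta> is \<gamma> after the inverse affine map,
          so its derivative there is that of \<gamma> divided by \<open>c\<close>.\<close>
        have "((\<lambda>t. (t - a) / c) has_vector_derivative 1 / c) (at ?t)"
          using c by (auto intro!: derivative_eq_intros simp flip: has_real_derivative_iff_has_vector_derivative)
        from vector_diff_chain_at[OF this, of \<gamma> ?v] dv
        have "((\<lambda>t. \<gamma> ((t - a) / c)) has_vector_derivative (1 / c) *\<^sub>R ?v) (at ?t)"
          by (simp only: inv_eq o_def)
        moreover have "open ((\<lambda>t. (t - a) / c) -` {0<..<1})"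
          using c by (intro open_vimage) (auto intro!: continuous_intros)
        moreover have "?t \<in> (\<lambda>t. (t - a) / c) -` {0<..<1}" using s c by simp
        moreover have "\<gamma> ((t - a) / c) = \<beta> t" if "t \<in> (\<lambda>t. (t - a) / c) -` {0<..<1}" for t
          using eq[of "(t - a) / c"] that c by simp
        ultimately have "(\<beta> has_vector_derivative (1 / c) *\<^sub>R ?v) (at ?t)"
          by (rule has_vector_derivative_transform_within_open)
        then have "vector_derivative \<beta> (at ?t within {0..1}) = (1 / c) *\<^sub>R ?v"
          using maps[OF True] by (intro vector_derivative_at_within_ivl) auto
        then have "minimal_speed \<Omega> \<beta> ?t = minimal_pseudometric \<Omega> (\<gamma> s) ((1 / c) *\<^sub>R ?v)"
          using eq[OF True] by (simp add: minimal_speed_def)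
        also have "\<dots> \<le> \<bar>1 / c\<bar> * minimal_speed \<Omega> \<gamma> s"
          unfolding minimal_speed_def using True \<gamma>(2) c
          by (intro minimal_pseudometric_scaleR_le[OF dim \<Omega>]) (auto simp: path_image_def)
        finally have "\<bar>c\<bar> * minimal_speed \<Omega> \<beta> ?t \<le> minimal_speed \<Omega> \<gamma> s" using c by (simp add: field_simps)
        then have "ennreal \<bar>c\<bar> * ennreal (minimal_speed \<Omega> \<beta> ?t) \<le> ennreal (minimal_speed \<Omega> \<gamma> s)"
          by (simp flip: ennreal_mult' add: ennreal_leI)
        moreover have "ennreal \<bar>c\<bar> * g ?t \<le> ennreal \<bar>c\<bar> * ennreal (minimal_speed \<Omega> \<beta> ?t)"
          using g(2)[OF True] by (rule mult_left_mono) simp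
        ultimately show ?thesis using True by simp
      qed
    qed
  qed
  finally show ?thesis .
qed

lemma minimal_length_reverse:
  fixes \<Omega> :: "'a::euclidean_space set"
  assumes dim: "2 \<le> DIM('a)" and \<Omega>: "open \<Omega>" and \<gamma>: "piecewise_smooth_path \<gamma>" "path_image \<gamma> \<subseteq> \<Omega>"
  shows "minimal_length \<Omega> (reversepath \<gamma>) \<le> minimal_length \<Omega> \<gamma>"
  unfolding minimal_length_def[of _ "reversepath \<gamma>"]
proof (rule nn_integral_leI)
  fix g :: "real \<Rightarrow> ennreal"
  assume g: "g \<in> borel_measurable lborel" "g \<le> (\<lambda>t. ennreal (minimal_speed \<Omega> (reversepath \<gamma>) t) * indicator {0..1} t)"
  have g': "g t \<le> ennreal (minimal_speed \<Omega> (reversepath \<gamma>) t) * indicator {0..1} t" for t using g(2) by (simp add: le_fun_def)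
  show "(\<integral>\<^sup>+t. g t \<partial>lborel) \<le> minimal_length \<Omega> \<gamma>"
  proof (rule minimal_length_reparametrize[OF dim \<Omega> \<gamma>, where c = "-1" and a = 1])
    show "g (1 + - 1 * s) \<le> ennreal (minimal_speed \<Omega> (reversepath \<gamma>) (1 + - 1 * s))" if "s \<in> {0..1}" for s
      using g'[of "1 + - 1 * s"] that by simp
    show "g (1 + - 1 * s) = 0" if "s \<notin> {0..1}" for s
      using g'[of "1 + - 1 * s"] that by (auto simp: indicator_def split: if_splits)
  qed (use g in \<open>auto simp: reversepath_def\<close>)
qed

text \<open>Every measurable function below the speed of the joined path splits at
  \<open>1/2\<close> into two measurable ones; additivity of the integral is applied to these, and
  each half is reparametrised.\<close>

lemma minimal_length_join:
  fixes \<Omega> :: "'a::euclidean_space set"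
  assumes dim: "2 \<le> DIM('a)" and \<Omega>: "open \<Omega>" and \<gamma>1: "piecewise_smooth_path \<gamma>1" "path_image \<gamma>1 \<subseteq> \<Omega>"
    and \<gamma>2: "piecewise_smooth_path \<gamma>2" "path_image \<gamma>2 \<subseteq> \<Omega>" and eq: "pathfinish \<gamma>1 = pathstart \<gamma>2"
  shows "minimal_length \<Omega> (\<gamma>1 +++ \<gamma>2) \<le> minimal_length \<Omega> \<gamma>1 + minimal_length \<Omega> \<gamma>2"
  unfolding minimal_length_def[of _ "\<gamma>1 +++ \<gamma>2"]
proof (rule nn_integral_leI)
  fix g :: "real \<Rightarrow> ennreal"
  assume g: "g \<in> borel_measurable lborel" "g \<le> (\<lambda>t. ennreal (minimal_speed \<Omega> (\<gamma>1 +++ \<gamma>2) t) * indicator {0..1} t)"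
  have g': "g t \<le> ennreal (minimal_speed \<Omega> (\<gamma>1 +++ \<gamma>2) t) * indicator {0..1} t" for t using g(2) by (simp add: le_fun_def)
  have gz: "g t = 0" if "t \<notin> {0..1}" for t using g'[of t] that by simp
  have gl: "g t \<le> ennreal (minimal_speed \<Omega> (\<gamma>1 +++ \<gamma>2) t)" for t
    using g'[of t] by (cases "t \<in> {0..1}") auto
  have [measurable]: "g \<in> borel_measurable borel" using g(1) by simp
  define g1 where "g1 t = g t * indicator {..1/2} t" for t
  define g2 where "g2 t = g t * indicator {1/2<..} t" for t
  have meas: "g1 \<in> borel_measurable borel" "g2 \<in> borel_measurable borel" unfolding g1_def g2_def by measurable
  have "(\<integral>\<^sup>+t. g t \<partial>lborel) = (\<integral>\<^sup>+t. g1 t + g2 t \<partial>lborel)"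
    by (intro nn_integral_cong) (auto simp: g1_def g2_def indicator_def)
  also have "\<dots> = (\<integral>\<^sup>+t. g1 t \<partial>lborel) + (\<integral>\<^sup>+t. g2 t \<partial>lborel)"
    using meas by (intro nn_integral_add) auto
  also have "\<dots> \<le> minimal_length \<Omega> \<gamma>1 + minimal_length \<Omega> \<gamma>2"
  proof (rule add_mono)
    show "(\<integral>\<^sup>+t. g1 t \<partial>lborel) \<le> minimal_length \<Omega> \<gamma>1"
    proof (rule minimal_length_reparametrize[OF dim \<Omega> \<gamma>1, where c = "1/2" and a = 0 and \<beta> = "\<gamma>1 +++ \<gamma>2"])
      show "g1 (0 + 1/2 * s) \<le> ennreal (minimal_speed \<Omega> (\<gamma>1 +++ \<gamma>2) (0 + 1/2 * s))" for s
        using gl[of "0 + 1/2 * s"] by (auto simp: g1_def indicator_def)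
      show "g1 (0 + 1/2 * s) = 0" if "s \<notin> {0..1}" for s
        using gz[of "0 + 1/2 * s"] that by (auto simp: g1_def indicator_def)
    qed (use meas in \<open>auto simp: joinpaths_def\<close>)
    show "(\<integral>\<^sup>+t. g2 t \<partial>lborel) \<le> minimal_length \<Omega> \<gamma>2"
    proof (rule minimal_length_reparametrize[OF dim \<Omega> \<gamma>2, where c = "1/2" and a = "1/2" and \<beta> = "\<gamma>1 +++ \<gamma>2"])
      show "g2 (1/2 + 1/2 * s) \<le> ennreal (minimal_speed \<Omega> (\<gamma>1 +++ \<gamma>2) (1/2 + 1/2 * s))" for s
        using gl[of "1/2 + 1/2 * s"] by (auto simp: g2_def indicator_def)
      show "g2 (1/2 + 1/2 * s) = 0" if "s \<notin> {0..1}" for s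
        using gz[of "1/2 + 1/2 * s"] that by (auto simp: g2_def indicator_def)
      show "(\<gamma>1 +++ \<gamma>2) (1/2 + 1/2 * s) = \<gamma>2 s" if "s \<in> {0..1}" for s
        using that eq by (cases "s = 0") (auto simp: joinpaths_def pathfinish_def pathstart_def field_simps)
    qed (use meas in auto)
  qed
  finally show "(\<integral>\<^sup>+t. g t \<partial>lborel) \<le> minimal_length \<Omega> \<gamma>1 + minimal_length \<Omega> \<gamma>2" .
qed

lemma minimal_edist_commute:
  fixes \<Omega> :: "'a::euclidean_space set"
  assumes "2 \<le> DIM('a)" "open \<Omega>"
  shows "minimal_edist \<Omega> x y = minimal_edist \<Omega> y x"
proof -
  have "minimal_edist \<Omega> y x \<le> minimal_edist \<Omega> x y" for x y
    unfolding minimal_edist_def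
  proof (rule INF_mono)
    fix \<gamma> assume \<gamma>: "\<gamma> \<in> minimal_paths \<Omega> x y"
    then have "reversepath \<gamma> \<in> minimal_paths \<Omega> y x"
      by (auto simp: minimal_paths_def piecewise_smooth_path_reverse)
    moreover have "minimal_length \<Omega> (reversepath \<gamma>) \<le> minimal_length \<Omega> \<gamma>"
      using \<gamma> by (intro minimal_length_reverse assms) (auto simp: minimal_paths_def)
    ultimately show "\<exists>\<beta>\<in>minimal_paths \<Omega> y x. minimal_length \<Omega> \<beta> \<le> minimal_length \<Omega> \<gamma>" by blast
  qed
  then show ?thesis by (simp add: antisym)
qed

lemma minimal_edist_triangle:
  fixes \<Omega> :: "'a::euclidean_space set"
  assumes "2 \<le> DIM('a)" "open \<Omega>"
  shows "minimal_edist \<Omega> x z \<le> minimal_edist \<Omega> x y + minimal_edist \<Omega> y z"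
proof (rule ennreal_le_epsilon)
  fix e :: real assume fin: "minimal_edist \<Omega> x y + minimal_edist \<Omega> y z < top" and e: "e > 0"
  have lt: "minimal_edist \<Omega> p q < minimal_edist \<Omega> p q + ennreal (e / 2)" if "minimal_edist \<Omega> p q < top" for p q
    using that e by (cases "minimal_edist \<Omega> p q") (auto simp flip: ennreal_plus simp: ennreal_less_iff)
  have near: "\<exists>\<gamma>\<in>minimal_paths \<Omega> p q. minimal_length \<Omega> \<gamma> < minimal_edist \<Omega> p q + ennreal (e / 2)"
    if "minimal_edist \<Omega> p q < top" for p q
    using lt[OF that] unfolding minimal_edist_def[of _ p q] INF_less_iff .
  have "minimal_edist \<Omega> x y < top" "minimal_edist \<Omega> y z < top" using fin by (auto simp: ennreal_add_less_top)
  then obtain \<gamma>1 \<gamma>2 where \<gamma>1: "\<gamma>1 \<in> minimal_paths \<Omega> x y" "minimal_length \<Omega> \<gamma>1 < minimal_edist \<Omega> x y + ennreal (e / 2)"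
    and \<gamma>2: "\<gamma>2 \<in> minimal_paths \<Omega> y z" "minimal_length \<Omega> \<gamma>2 < minimal_edist \<Omega> y z + ennreal (e / 2)"
    using near by metis
  have "\<gamma>1 +++ \<gamma>2 \<in> minimal_paths \<Omega> x z"
    using \<gamma>1(1) \<gamma>2(1) by (auto simp: minimal_paths_def piecewise_smooth_path_join path_image_join)
  then have "minimal_edist \<Omega> x z \<le> minimal_length \<Omega> (\<gamma>1 +++ \<gamma>2)" unfolding minimal_edist_def by (rule INF_lower)
  also have "\<dots> \<le> minimal_length \<Omega> \<gamma>1 + minimal_length \<Omega> \<gamma>2"
    using \<gamma>1(1) \<gamma>2(1) by (intro minimal_length_join assms) (auto simp: minimal_paths_def)
  also have "\<dots> \<le> (minimal_edist \<Omega> x y + ennreal (e / 2)) + (minimal_edist \<Omega> y z + ennreal (e / 2))"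
    using \<gamma>1(2) \<gamma>2(2) by (intro add_mono) auto
  also have "\<dots> = minimal_edist \<Omega> x y + minimal_edist \<Omega> y z + ennreal e"
  proof -
    have "ennreal e = ennreal (e / 2) + ennreal (e / 2)" using e by (simp flip: ennreal_plus)
    then show ?thesis by (simp add: ac_simps)
  qed
  finally show "minimal_edist \<Omega> x z \<le> minimal_edist \<Omega> x y + minimal_edist \<Omega> y z + ennreal e" .
qed

text \<open>The factor 2 leaves a ball of radius \<open>d\<close> inside \<Omega> around each point
  of the segment, where the pseudometric is at most the Euclidean norm divided by
  \<open>d\<close>.\<close>

lemma minimal_edist_le_segment:
  fixes \<Omega> :: "'a::euclidean_space set"
  assumes dim: "2 \<le> DIM('a)" and B: "ball x (2 * d) \<subseteq> \<Omega>" "d > 0" and y: "dist x y \<le> d"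
  shows "minimal_edist \<Omega> x y \<le> ennreal (dist x y / d)"
proof -
  have sub: "ball w d \<subseteq> \<Omega>" if "w \<in> closed_segment x y" for w
  proof -
    have "dist x w \<le> d" using segment_bound(1)[OF that] y by (simp add: dist_norm norm_minus_commute)
    then have "dist x v < 2 * d" if "dist w v < d" for v
      using dist_triangle[of x v w] that by linarith
    then have "ball w d \<subseteq> ball x (2 * d)" by auto
    then show ?thesis using B by blast
  qed
  have img: "w \<in> \<Omega>" if "w \<in> closed_segment x y" for w using sub[OF that] B(2) by auto
  have "linepath x y \<in> minimal_paths \<Omega> x y"
    using img by (auto simp: minimal_paths_def piecewise_smooth_linepath)
  then have "minimal_edist \<Omega> x y \<le> minimal_length \<Omega> (linepath x y)" unfolding minimal_edist_def by (rule INF_lower)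
  also have "\<dots> \<le> (\<integral>\<^sup>+t. ennreal (dist x y / d) * indicator {0..1} t \<partial>(lborel :: real measure))"
    unfolding minimal_length_def
  proof (rule nn_integral_mono)
    fix t :: real
    show "ennreal (minimal_speed \<Omega> (linepath x y) t) * indicator {0..1} t \<le> ennreal (dist x y / d) * indicator {0..1} t"
    proof (cases "t \<in> {0..1}")
      case True
      then have "vector_derivative (linepath x y) (at t within {0..1}) = y - x"
        by (intro vector_derivative_at_within_ivl has_vector_derivative_linepath_within) auto
      moreover have "linepath x y t \<in> closed_segment x y" using True by (rule linepath_in_path)
      ultimately have "minimal_speed \<Omega> (linepath x y) t \<le> norm (y - x) / d"
        unfolding minimal_speed_def using minimal_pseudometric_le_norm[OF dim sub B(2)] by simp
      then show ?thesis using True by (simp add: dist_norm norm_minus_commute ennreal_leI)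
    qed simp
  qed
  also have "\<dots> = ennreal (dist x y / d)" by (simp add: nn_integral_cmult_indicator)
  finally show ?thesis .
qed

text \<open>Nearby points are at finite distance, so the points at finite distance from
  \<open>x\<close> and the remaining ones form two open sets; connectedness leaves the
  first.\<close>

lemma minimal_edist_finite:
  fixes \<Omega> :: "'a::euclidean_space set"
  assumes dim: "2 \<le> DIM('a)" and \<Omega>: "open \<Omega>" "connected \<Omega>" and xy: "x \<in> \<Omega>" "y \<in> \<Omega>"
  shows "minimal_edist \<Omega> x y < top"
proof -
  have nbhd: "\<exists>d>0. ball w d \<subseteq> \<Omega> \<and> (\<forall>v\<in>ball w d. minimal_edist \<Omega> w v < top)" if w: "w \<in> \<Omega>" for w
  proof -
    obtain d where d: "d > 0" "ball w d \<subseteq> \<Omega>" using \<Omega>(1) w by (meson openE)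
    have "minimal_edist \<Omega> w v < top" if "v \<in> ball w (d / 2)" for v
      using minimal_edist_le_segment[OF dim, of w "d / 2" \<Omega> v] d that by (auto intro: le_less_trans)
    then show ?thesis using d by (intro exI[of _ "d / 2"]) (auto simp: subset_iff)
  qed
  note tri = minimal_edist_triangle[OF dim \<Omega>(1)] and com = minimal_edist_commute[OF dim \<Omega>(1)]
  have fin: "minimal_edist \<Omega> p r < top" if "minimal_edist \<Omega> p q < top" "minimal_edist \<Omega> q r < top" for p q r
    using tri[of p r q] that by (meson ennreal_add_less_top le_less_trans)
  define A where "A = {w \<in> \<Omega>. minimal_edist \<Omega> x w < top}"
  define B where "B = {w \<in> \<Omega>. \<not> minimal_edist \<Omega> x w < top}"
  have "open A" unfolding open_contains_ball
  proof
    fix w assume w: "w \<in> A"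
    then obtain d where "d > 0" "ball w d \<subseteq> \<Omega>" "\<forall>v\<in>ball w d. minimal_edist \<Omega> w v < top"
      using nbhd[of w] by (auto simp: A_def)
    then show "\<exists>e>0. ball w e \<subseteq> A" using w fin unfolding A_def by blast
  qed
  moreover have "open B" unfolding open_contains_ball
  proof
    fix w assume w: "w \<in> B"
    then obtain d where d: "d > 0" "ball w d \<subseteq> \<Omega>" "\<forall>v\<in>ball w d. minimal_edist \<Omega> w v < top"
      using nbhd[of w] by (auto simp: B_def)
    then have "\<forall>v\<in>ball w d. minimal_edist \<Omega> v w < top" using com by simp
    then show "\<exists>e>0. ball w e \<subseteq> B" using w d fin unfolding B_def by blast
  qed
  moreover have "A \<inter> B = {}" "\<Omega> \<subseteq> A \<union> B" by (auto simp: A_def B_def)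
  moreover have "x \<in> A"
  proof -
    obtain d where "d > 0" "\<forall>v\<in>ball x d. minimal_edist \<Omega> x v < top" using nbhd[OF xy(1)] by blast
    then show ?thesis using xy by (simp add: A_def)
  qed
  ultimately have "B \<inter> \<Omega> = {}" using connectedD[OF \<Omega>(2)] xy by blast
  then show ?thesis using xy by (auto simp: B_def)
qed

text \<open>A function whose differential is dominated by the pseudometric increases by at most the
  length. Only the arc over \<open>[a, b]\<close> has to stay in \<open>W\<close>, so functions
  defined near a boundary point qualify.\<close>

lemma minimal_length_ge:
  fixes \<Omega> W :: "'a::euclidean_space set" and H :: "'a \<Rightarrow> real"
  assumes \<gamma>: "piecewise_smooth_path \<gamma>" and ab: "0 \<le> a" "a \<le> b" "b \<le> 1" and W: "\<gamma> ` {a..b} \<subseteq> W"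
    and H: "\<And>y. y \<in> W \<Longrightarrow> (H has_derivative H' y) (at y)"
    and le: "\<And>y v. y \<in> W \<Longrightarrow> \<bar>H' y v\<bar> \<le> minimal_pseudometric \<Omega> y v"
  shows "ennreal (H (\<gamma> b) - H (\<gamma> a)) \<le> minimal_length \<Omega> \<gamma>"
proof -
  obtain S where S: "finite S" "continuous_on {0..1} \<gamma>"
    "\<And>t. t \<in> {0..1} - S \<Longrightarrow> (\<gamma> has_vector_derivative vector_derivative \<gamma> (at t within {0..1})) (at t)"
    using piecewise_smooth_path_regular[OF \<gamma>] by metis
  define F where "F t = H' (\<gamma> t) (vector_derivative \<gamma> (at t within {0..1}))" for t
  have ab01: "{a..b} \<subseteq> {0..1}" using ab by auto
  have F: "(F has_integral (H (\<gamma> b) - H (\<gamma> a))) {a..b}"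
  proof (rule fundamental_theorem_of_calculus_interior_strong[OF S(1) ab(2), where f = "\<lambda>t. H (\<gamma> t)"])
    fix t assume t: "t \<in> {a<..<b} - S"
    then have "t \<in> {0..1} - S" and tW: "\<gamma> t \<in> W" using ab W by auto
    from has_derivative_compose[OF S(3)[OF this(1), unfolded has_vector_derivative_def] H[OF tW]]
    show "((\<lambda>t. H (\<gamma> t)) has_vector_derivative F t) (at t)"
      unfolding has_vector_derivative_def F_def
      using linear_scale[OF has_derivative_linear[OF H[OF tW]]] by simp
  next
    have "continuous_on W H" using H by (auto intro!: continuous_at_imp_continuous_on has_derivative_continuous)
    then show "continuous_on {a..b} (\<lambda>t. H (\<gamma> t))"
      using W by (rule continuous_on_compose2[OF _ continuous_on_subset[OF S(2) ab01]])
  qed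
  have Fle: "\<bar>F t\<bar> \<le> minimal_speed \<Omega> \<gamma> t" if "t \<in> {a..b}" for t
    unfolding F_def minimal_speed_def using that W by (intro le) auto
  have "(\<integral>\<^sup>+t. ennreal (norm (F t)) \<partial>lebesgue_on {a..b}) = (\<integral>\<^sup>+t. ennreal (norm (F t)) * indicator {a..b} t \<partial>lborel)"
    by (subst nn_integral_restrict_space) (auto simp: nn_integral_completion)
  also have "\<dots> \<le> minimal_length \<Omega> \<gamma>"
    unfolding minimal_length_def using Fle ab01
    by (intro nn_integral_mono) (auto simp: indicator_def intro!: ennreal_leI)
  finally have nn: "(\<integral>\<^sup>+t. ennreal (norm (F t)) \<partial>lebesgue_on {a..b}) \<le> minimal_length \<Omega> \<gamma>" .
  \<comment> \<open>The fundamental theorem yields a gauge integral of \<open>F\<close>. Finite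
    length makes \<open>F\<close> absolutely integrable, hence a Lebesgue integral bounded by the
    length; for infinite length the claim is trivial.\<close>
  show ?thesis
  proof (cases "minimal_length \<Omega> \<gamma> < \<infinity>")
    case True
    have meas: "{a..b} \<in> sets lebesgue" by simp
    have "F \<in> borel_measurable (lebesgue_on {a..b})"
      using F by (intro integrable_imp_measurable) (auto simp: integrable_on_def)
    then have int: "integrable (lebesgue_on {a..b}) F"
      unfolding integrable_iff_bounded using nn True by (auto intro: le_less_trans)
    have "H (\<gamma> b) - H (\<gamma> a) = integral\<^sup>L (lebesgue_on {a..b}) F"
      using lebesgue_integral_eq_integral[OF int meas] integral_unique[OF F] by simp
    then have "ennreal (H (\<gamma> b) - H (\<gamma> a)) \<le> ennreal (norm (integral\<^sup>L (lebesgue_on {a..b}) F))"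
      by (auto intro!: ennreal_leI)
    also have "\<dots> \<le> (\<integral>\<^sup>+t. ennreal (norm (F t)) \<partial>lebesgue_on {a..b})"
      by (rule integral_norm_bound_ennreal[OF int])
    finally show ?thesis using nn by (rule order_trans)
  next
    case False
    then show ?thesis by (simp add: not_less top_unique)
  qed
qed

section \<open>Boundary points at infinite distance\<close>

lemma frontier_value_zero:
  assumes "C2_defining_function \<Omega> U u" "p \<in> frontier \<Omega>" "p \<in> U"
  shows "u p = 0"
  using assms unfolding C2_defining_function_def by blast

text \<open>Subtracting \<open>\<epsilon> |y - p|\<^sup>2\<close> from the defining function makes \<open>p\<close> an isolated zero on \<open>closure \<Omega>\<close>
  near \<open>p\<close>, which keeps \<open>log (- \<phi>)\<close> bounded below on the small spheres around \<open>p\<close>.\<close>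

lemma strongly_minimally_convex_at_barrier:
  fixes \<Omega> :: "'a::euclidean_space set"
  assumes dim: "2 \<le> DIM('a)" and \<Omega>: "open \<Omega>" and p: "p \<in> frontier \<Omega>" and sc: "strongly_minimally_convex_at \<Omega> p"
  obtains \<phi> \<epsilon> \<delta> C where "\<epsilon> > 0" "\<delta> > 0" "C > 0" "\<phi> p = 0" "isCont \<phi> p"
    "\<forall>y\<in>\<Omega> \<inter> ball p \<delta>. \<phi> y < 0 \<and> \<phi> y \<le> - (\<epsilon> * (dist y p)^2) \<and> \<phi> differentiable (at y)"
    "\<forall>y\<in>\<Omega> \<inter> ball p \<delta>. \<forall>v.
      \<bar>frechet_derivative \<phi> (at y) v\<bar> \<le> C * (- \<phi> y) * minimal_pseudometric \<Omega> y v"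
proof -
  obtain U u where pU: "p \<in> U" and df: "C2_defining_function \<Omega> U u" and sm: "strongly_mpsh_on U u"
    using sc unfolding strongly_minimally_convex_at_def by blast
  have U: "open U" and u: "C2_on U u" and neg: "\<And>y. y \<in> \<Omega> \<Longrightarrow> y \<in> U \<Longrightarrow> u y < 0"
    using df unfolding C2_defining_function_def by blast+
  have up: "u p = 0" by (rule frontier_value_zero[OF df p pU])
  obtain R where R: "R > 0" "cball p R \<subseteq> U" using U pU by (meson open_contains_cball)
  obtain \<kappa> where \<kappa>: "\<kappa> > 0"
    "\<And>x a b. \<lbrakk>x \<in> cball p R; norm a = norm b; a \<bullet> b = 0\<rbrakk> \<Longrightarrow> \<kappa> * (a \<bullet> a) \<le> hess u x a a + hess u x b b"
    using strongly_mpsh_uniform[OF sm compact_cball R(2)] by blast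
  \<comment> \<open>Subtracting \<open>\<epsilon> |y - p|^2\<close> costs
    \<open>4 \<epsilon> |a|^2\<close> on a conformal pair; half of \<kappa> is kept for the second
    subtraction, centred at \<open>f 0\<close>.\<close>
  define \<epsilon> where "\<epsilon> = \<kappa> / 8"
  have \<epsilon>: "\<epsilon> > 0" using \<kappa>(1) by (simp add: \<epsilon>_def)
  define \<phi> where "\<phi> y = u y - \<epsilon> * ((y - p) \<bullet> (y - p))" for y
  note \<phi>D = C2_on_minus_dist[OF u U, where e = \<epsilon> and x = p, folded \<phi>_def]
  have \<phi>neg: "\<phi> y < 0 \<and> \<phi> y \<le> - (\<epsilon> * (dist y p)^2)" if "y \<in> \<Omega>" "y \<in> U" for y
  proof -
    have "0 \<le> \<epsilon> * ((y - p) \<bullet> (y - p))" using \<epsilon> by simp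
    then show ?thesis using neg[OF that] by (simp add: \<phi>_def dist_norm power2_norm_eq_inner)
  qed
  have pos: "\<kappa> / 2 * (a \<bullet> a) \<le> hess \<phi> y a a + hess \<phi> y b b"
    if "y \<in> cball p R" "norm a = norm b" "a \<bullet> b = 0" for y a b
  proof -
    have "b \<bullet> b = a \<bullet> a" using that(2) by (simp add: norm_eq)
    moreover have "y \<in> U" using that(1) R by blast
    ultimately show ?thesis using \<kappa>(2)[OF that] \<phi>D(2) by (simp add: \<epsilon>_def)
  qed
  have \<phi>p: "\<phi> p = 0" using up by (simp add: \<phi>_def)
  obtain \<delta> C where \<delta>: "\<delta> > 0" and C: "C > 0"
    and bd: "\<And>f. \<lbrakk>f \<in> CH_disc \<Omega>; f 0 \<in> ball p \<delta>\<rbrakk> \<Longrightarrow> \<bar>frechet_derivative \<phi> (at (f 0)) (pd_x f 0)\<bar> \<le> C * (- \<phi> (f 0))"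
  proof (rule normal_derivative_bound[OF \<phi>D(1) U R(2,1) \<phi>p, of \<Omega> "\<kappa> / 2"])
    show "\<phi> y \<le> 0" if "y \<in> \<Omega>" "y \<in> U" for y using \<phi>neg[OF that] by simp
  qed (use \<kappa>(1) pos that in auto)
  obtain \<phi>' \<phi>'' where D: "C2_derivs U \<phi> \<phi>' \<phi>''" using \<phi>D(1) by (auto simp: C2_on_iff)
  show thesis
  proof (rule that[of \<epsilon> "min \<delta> R" C \<phi>]; (intro ballI allI)?)
    show "isCont \<phi> p" using has_derivative_continuous[OF C2_derivsD(1)[OF D pU]] .
    fix y assume y: "y \<in> \<Omega> \<inter> ball p (min \<delta> R)"
    then have yU: "y \<in> U" "y \<in> \<Omega>" "y \<in> ball p \<delta>" using R by auto
    show "\<phi> y < 0 \<and> \<phi> y \<le> - (\<epsilon> * (dist y p)^2) \<and> \<phi> differentiable (at y)"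
      using \<phi>neg[OF yU(2,1)] differentiableI[OF C2_derivsD(1)[OF D yU(1)]] by simp
    show "\<bar>frechet_derivative \<phi> (at y) v\<bar> \<le> C * (- \<phi> y) * minimal_pseudometric \<Omega> y v" for v
    proof -
      have Cp: "C * (- \<phi> y) > 0" using C \<phi>neg[OF yU(2,1)] by (simp add: mult_pos_neg)
      \<comment> \<open>In this form the estimate for each disc is a lower bound for
        \<open>1 / r\<close>, and so passes to the infimum.\<close>
      have "\<bar>frechet_derivative \<phi> (at y) v\<bar> / (C * (- \<phi> y)) \<le> minimal_pseudometric \<Omega> y v"
      proof (rule minimal_pseudometric_geI[OF dim \<Omega> yU(2)])
        fix f r assume f: "f \<in> CH_disc \<Omega>" "f 0 = y" "pd_x f 0 = r *\<^sub>R v" "r > 0"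
        have "frechet_derivative \<phi> (at y) (r *\<^sub>R v) = r * frechet_derivative \<phi> (at y) v"
          using C2_derivsD(6)[OF D yU(1)] by (simp add: blinfun.scaleR_right)
        then have "r * \<bar>frechet_derivative \<phi> (at y) v\<bar> \<le> C * (- \<phi> y)"
          using bd[OF f(1)] f yU(3) by (simp add: abs_mult)
        then show "\<bar>frechet_derivative \<phi> (at y) v\<bar> / (C * (- \<phi> y)) \<le> 1 / r"
          using f(4) Cp by (simp add: field_simps)
      qed
      then show ?thesis unfolding pos_divide_le_eq[OF Cp] by (simp only: mult.commute)
    qed
  qed (use \<epsilon> \<delta> R C \<phi>p in auto)
qed

text \<open>The last time with \<open>d <= h\<close> exists by compactness, and the intermediate
  value theorem forces equality there. For a path ending near \<open>p\<close> this isolates a final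
  arc inside the region of the barrier, whatever the path does before.\<close>

lemma last_entrance_time:
  fixes h :: "real \<Rightarrow> real"
  assumes "continuous_on {0..1} h" "d \<le> h 0" "h 1 < d"
  obtains a where "0 \<le> a" "a \<le> 1" "h a = d" "\<And>t. t \<in> {a..1} \<Longrightarrow> h t \<le> d"
proof -
  define T where "T = {0..1} \<inter> h -` {d..}"
  have "compact T"
    unfolding T_def compact_eq_bounded_closed
    by (auto intro: continuous_closed_preimage[OF assms(1)] bounded_subset[OF bounded_closed_interval])
  moreover have "0 \<in> T" using assms by (auto simp: T_def)
  ultimately obtain a where a: "a \<in> T" "\<And>t. t \<in> T \<Longrightarrow> t \<le> a"
    using compact_attains_sup[of T] by blast
  have a01: "0 \<le> a" "a \<le> 1" "d \<le> h a" using a(1) by (auto simp: T_def)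
  obtain t where t: "a \<le> t" "t \<le> 1" "h t = d"
    using IVT2'[of h 1 d a] a01 assms continuous_on_subset[OF assms(1), of "{a..1}"] by auto
  then have "t = a" using a(2)[of t] a01 by (auto simp: T_def)
  then have "h a = d" using t by simp
  moreover have "h t \<le> d" if "t \<in> {a..1}" for t
  proof (rule ccontr)
    assume "\<not> h t \<le> d"
    then have "t \<in> T" using that a01 by (auto simp: T_def)
    then show False using a(2)[of t] that \<open>h a = d\<close> \<open>\<not> h t \<le> d\<close> by auto
  qed
  ultimately show thesis using a01 that by blast
qed

lemma infinite_distance:
  fixes \<Omega> :: "'a::euclidean_space set"
  assumes dim: "2 \<le> DIM('a)" and \<Omega>: "open \<Omega>" "connected \<Omega>" and p: "p \<in> frontier \<Omega>"
    and sc: "strongly_minimally_convex_at \<Omega> p"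
  shows "at_infinite_minimal_distance p \<Omega>"
  unfolding at_infinite_minimal_distance_def
proof (intro ballI allI notI)
  fix x0 r assume x0: "x0 \<in> \<Omega>" and cl: "p \<in> closure {x \<in> \<Omega>. minimal_pseudodistance \<Omega> x0 x < r}"
  obtain \<phi> \<epsilon> \<delta> C where pos: "\<epsilon> > 0" "\<delta> > 0" "C > 0" and \<phi>p: "\<phi> p = 0" "isCont \<phi> p"
    and \<phi>: "\<forall>y\<in>\<Omega> \<inter> ball p \<delta>. \<phi> y < 0 \<and> \<phi> y \<le> - (\<epsilon> * (dist y p)^2) \<and> \<phi> differentiable (at y)"
    and bd: "\<forall>y\<in>\<Omega> \<inter> ball p \<delta>. \<forall>v.
      \<bar>frechet_derivative \<phi> (at y) v\<bar> \<le> C * (- \<phi> y) * minimal_pseudometric \<Omega> y v"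
    by (rule strongly_minimally_convex_at_barrier[OF dim \<Omega>(1) p sc])
  note \<phi> = bspec[OF \<phi>] and bd = spec[OF bspec[OF bd]]
  have "p \<notin> \<Omega>" using p \<Omega>(1) by (simp add: frontier_def interior_open)
  then have "dist x0 p > 0" using x0 by auto
  \<comment> \<open>Small enough for the sphere of radius \<open>d\<close> to lie in the domain of
    the barrier and for \<open>x0\<close> to be on or outside it.\<close>
  define d where "d = min (\<delta> / 2) (dist x0 p)"
  have d: "d > 0" "d < \<delta>" "d \<le> dist x0 p" using pos \<open>dist x0 p > 0\<close> by (auto simp: d_def)
  \<comment> \<open>If \<open>- \<phi> x < m\<close>, then
    \<open>ln (\<epsilon> d^2) - ln (- \<phi> x)\<close> exceeds \<open>C r\<close>, so
    \<open>H\<close> gains at least \<open>r\<close> between the sphere and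
    \<open>x\<close>.\<close>
  define m where "m = \<epsilon> * d^2 * exp (- (C * r))"
  have m: "m > 0" using pos d by (simp add: m_def)
  obtain \<eta> where \<eta>: "\<eta> > 0" "\<And>y. dist y p < \<eta> \<Longrightarrow> \<bar>\<phi> y\<bar> < m"
    using \<phi>p(2)[unfolded continuous_at_eps_delta, rule_format, OF m] \<phi>p(1) by (auto simp: dist_real_def)
  obtain x where x: "x \<in> \<Omega>" "minimal_pseudodistance \<Omega> x0 x < r" "dist x p < min \<eta> d"
  proof -
    have "min \<eta> d > 0" using \<eta>(1) d(1) by simp
    from cl[unfolded closure_approachable, rule_format, OF this] show ?thesis using that by blast
  qed
  have xB: "x \<in> \<Omega> \<inter> ball p \<delta>" using x d by (simp add: dist_commute)
  \<comment> \<open>Its differential is that of \<phi> divided by \<open>C * (- \<phi>)\<close>,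
    which the barrier estimate bounds by the pseudometric.\<close>
  define H where "H y = - (1 / C) * ln (- \<phi> y)" for y
  have "ennreal r \<le> minimal_edist \<Omega> x0 x"
    unfolding minimal_edist_def
  proof (rule INF_greatest)
    fix \<gamma> assume "\<gamma> \<in> minimal_paths \<Omega> x0 x"
    then have \<gamma>: "piecewise_smooth_path \<gamma>" "path_image \<gamma> \<subseteq> \<Omega>" "\<gamma> 0 = x0" "\<gamma> 1 = x"
      by (auto simp: minimal_paths_def pathstart_def pathfinish_def)
    have "continuous_on {0..1} \<gamma>" by (rule piecewise_smooth_path_regular[OF \<gamma>(1)])
    then have "continuous_on {0..1} (\<lambda>t. dist (\<gamma> t) p)" by (intro continuous_intros)
    then obtain a where a: "0 \<le> a" "a \<le> 1" "dist (\<gamma> a) p = d" "\<And>t. t \<in> {a..1} \<Longrightarrow> dist (\<gamma> t) p \<le> d"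
      using last_entrance_time[of "\<lambda>t. dist (\<gamma> t) p" d] \<gamma>(3,4) d(3) x(3) by auto
    have img: "\<gamma> t \<in> \<Omega> \<inter> ball p \<delta>" if "t \<in> {a..1}" for t
    proof -
      have "dist (\<gamma> t) p < \<delta>" using a(4)[OF that] d by simp
      moreover have "\<gamma> t \<in> \<Omega>" using \<gamma>(2) a that by (auto simp: path_image_def)
      ultimately show ?thesis by (simp add: dist_commute)
    qed
    have "ennreal (H (\<gamma> 1) - H (\<gamma> a)) \<le> minimal_length \<Omega> \<gamma>"
    proof (rule minimal_length_ge[OF \<gamma>(1) a(1,2), where W = "\<Omega> \<inter> ball p \<delta>"
          and H' = "\<lambda>y v. frechet_derivative \<phi> (at y) v / (C * (- \<phi> y))"])
      fix y assume y: "y \<in> \<Omega> \<inter> ball p \<delta>"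
      have ny: "\<phi> y < 0" and dy: "(\<phi> has_derivative frechet_derivative \<phi> (at y)) (at y)"
        using \<phi>[OF y] by (auto simp: frechet_derivative_works)
      have "((\<lambda>y. ln (- \<phi> y)) has_derivative (\<lambda>v. (- frechet_derivative \<phi> (at y) v) * inverse (- \<phi> y))) (at y)"
        using ny by (intro has_derivative_ln has_derivative_minus[OF dy]) auto
      from has_derivative_mult_right[OF this, of "- (1 / C)"]
      show "(H has_derivative (\<lambda>v. frechet_derivative \<phi> (at y) v / (C * (- \<phi> y)))) (at y)"
        unfolding H_def by (rule has_derivative_eq_rhs) (use ny pos in \<open>auto simp: fun_eq_iff field_simps\<close>)
      fix v
      have Cp: "C * (- \<phi> y) > 0" using pos(3) ny by (simp add: mult_pos_neg)
      have "\<bar>frechet_derivative \<phi> (at y) v / (C * (- \<phi> y))\<bar> = \<bar>frechet_derivative \<phi> (at y) v\<bar> / (C * (- \<phi> y))"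
        using Cp by (simp only: abs_divide abs_of_pos)
      also have "\<dots> \<le> minimal_pseudometric \<Omega> y v"
        using bd[OF y, of v] Cp by (simp only: pos_divide_le_eq mult.commute)
      finally show "\<bar>frechet_derivative \<phi> (at y) v / (C * (- \<phi> y))\<bar> \<le> minimal_pseudometric \<Omega> y v" .
    qed (use img in auto)
    moreover have "r \<le> H (\<gamma> 1) - H (\<gamma> a)"
    proof -
      have "\<gamma> a \<in> \<Omega> \<inter> ball p \<delta>" using img[of a] a(2) by simp
      from \<phi>[OF this] have "\<epsilon> * d^2 \<le> - \<phi> (\<gamma> a)" using a(3) by simp
      then have 1: "ln (\<epsilon> * d^2) \<le> ln (- \<phi> (\<gamma> a))" using pos(1) d(1) by (intro ln_mono) auto
      have "- \<phi> x > 0" "- \<phi> x < m" using \<phi>[OF xB] \<eta>(2)[of x] x(3) by auto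
      then have "ln (- \<phi> x) < ln m" using m by simp
      also have "ln m = ln (\<epsilon> * d^2) - C * r" using pos(1) d(1) by (simp add: m_def ln_mult)
      finally have "C * r \<le> ln (- \<phi> (\<gamma> a)) - ln (- \<phi> x)" using 1 by simp
      then have "r \<le> (ln (- \<phi> (\<gamma> a)) - ln (- \<phi> x)) / C" using pos(3) by (simp add: pos_le_divide_eq mult.commute)
      then show ?thesis by (simp add: H_def \<gamma>(4) diff_divide_distrib)
    qed
    ultimately show "ennreal r \<le> minimal_length \<Omega> \<gamma>" by (meson ennreal_leI order_trans)
  qed
  \<comment> \<open>Without finiteness the conversion to a real number could turn \<infinity> into
    0.\<close>
  moreover have "minimal_edist \<Omega> x0 x < top" by (rule minimal_edist_finite[OF dim \<Omega> x0 x(1)])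
  ultimately have "r \<le> minimal_pseudodistance \<Omega> x0 x"
    unfolding minimal_pseudodistance_eq by (cases "minimal_edist \<Omega> x0 x") (auto simp: ennreal_le_iff2)
  then show False using x(2) by simp
qed

section \<open>Bounded domains: Euclidean lower bound and completeness\<close>

lemma bounded_minimal_edist_ge:
  fixes \<Omega> :: "'a::euclidean_space set"
  assumes dim: "2 \<le> DIM('a)" and \<Omega>: "open \<Omega>" "bounded \<Omega>"
  obtains c where "c > 0" "\<And>x y. ennreal (c * dist x y) \<le> minimal_edist \<Omega> x y"
proof -
  obtain M where M: "M > 0" "\<And>x. x \<in> \<Omega> \<Longrightarrow> norm x \<le> M" using \<Omega>(2) unfolding bounded_pos by blast
  \<comment> \<open>On the circle of radius \<open>1/2\<close> the harmonic function given by a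
    vector \<open>e\<close> of norm at most 1 is bounded by \<open>M\<close>; the gradient bound
    becomes \<open>pi / 2 * r |<e, v>| <= 2 pi M\<close>, that is,
    \<open>r |<e, v>| <= 4 M\<close>.\<close>
  define c where "c = 1 / (4 * M)"
  have c: "c > 0" using M by (simp add: c_def)
  have low: "\<bar>c * (e \<bullet> v)\<bar> \<le> minimal_pseudometric \<Omega> w v" if e: "norm e \<le> 1" and w: "w \<in> \<Omega>" for e v w
  proof (rule minimal_pseudometric_geI[OF dim \<Omega>(1) w])
    fix f r assume f: "f \<in> CH_disc \<Omega>" "f 0 = w" "pd_x f 0 = r *\<^sub>R v" "r > 0"
    let ?z = "\<lambda>t. of_real (1/2) * cis t :: complex"
    have "pi * (1/2) * \<bar>blinfun_apply (blinfun_inner_left e) (pd_x f 0)\<bar>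
      \<le> integral {0..2*pi} (\<lambda>t. \<bar>blinfun_inner_left e (f (?z t) - 0)\<bar>)"
      by (rule CH_disc_gradient_bound[OF f(1)]) auto
    also have "\<dots> \<le> integral {0..2*pi} (\<lambda>t. M)"
    proof (rule integral_le)
      have "continuous_on {0..2*pi} (\<lambda>t. f (?z t))"
        by (rule continuous_on_circle[OF CH_discD(1)[OF f(1)]]) auto
      then show "(\<lambda>t. \<bar>blinfun_inner_left e (f (?z t) - 0)\<bar>) integrable_on {0..2*pi}"
        by (intro integrable_continuous_interval continuous_intros)
      fix t
      have "f (?z t) \<in> \<Omega>" by (rule CH_discD(5)[OF f(1)]) (simp add: norm_mult)
      then have "norm e * norm (f (?z t)) \<le> 1 * M" using M e by (intro mult_mono) auto
      then show "\<bar>blinfun_inner_left e (f (?z t) - 0)\<bar> \<le> M"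
        using Cauchy_Schwarz_ineq2[of e "f (?z t)"] by (simp add: inner_commute)
    qed auto
    also have "\<dots> = 2 * pi * M" by simp
    finally have "pi * (r * \<bar>e \<bullet> v\<bar>) \<le> pi * (4 * M)"
      using f by (simp add: abs_mult inner_commute)
    then have "r * \<bar>e \<bullet> v\<bar> \<le> 4 * M" using pi_gt_zero mult_le_cancel_left_pos by blast
    then show "\<bar>c * (e \<bullet> v)\<bar> \<le> 1 / r" using f(4) M by (simp add: c_def abs_mult field_simps)
  qed
  show thesis
  proof (rule that[OF c])
    fix x y
    show "ennreal (c * dist x y) \<le> minimal_edist \<Omega> x y"
      unfolding minimal_edist_def
    proof (rule INF_greatest)
      fix \<gamma> assume "\<gamma> \<in> minimal_paths \<Omega> x y"
      then have \<gamma>: "piecewise_smooth_path \<gamma>" "path_image \<gamma> \<subseteq> \<Omega>" "\<gamma> 0 = x" "\<gamma> 1 = y"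
        by (auto simp: minimal_paths_def pathstart_def pathfinish_def)
      \<comment> \<open>The direction from \<open>x\<close> to \<open>y\<close>: the linear function
        given by \<open>e\<close> grows along the path by exactly the Euclidean distance.\<close>
      define e where "e = sgn (y - x)"
      have "ennreal (c * (e \<bullet> \<gamma> 1) - c * (e \<bullet> \<gamma> 0)) \<le> minimal_length \<Omega> \<gamma>"
      proof (rule minimal_length_ge[OF \<gamma>(1), where W = \<Omega> and H' = "\<lambda>y v. c * (e \<bullet> v)"])
        show "\<gamma> ` {0..1} \<subseteq> \<Omega>" using \<gamma>(2) by (simp add: path_image_def)
        show "\<bar>c * (e \<bullet> v)\<bar> \<le> minimal_pseudometric \<Omega> w v" if "w \<in> \<Omega>" for w v
          using that by (intro low) (auto simp: e_def norm_sgn)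
      qed (auto intro!: derivative_eq_intros)
      moreover have "c * (e \<bullet> \<gamma> 1) - c * (e \<bullet> \<gamma> 0) = c * dist x y"
      proof -
        have "e \<bullet> (y - x) = norm (y - x)"
          by (cases "y = x") (auto simp: e_def sgn_div_norm dot_square_norm power2_eq_square)
        then show ?thesis unfolding \<gamma> by (simp add: dist_norm norm_minus_commute inner_diff_right flip: right_diff_distrib)
      qed
      ultimately show "ennreal (c * dist x y) \<le> minimal_length \<Omega> \<gamma>" by simp
    qed
  qed
qed

lemma bounded_complete_hyperbolic:
  fixes \<Omega> :: "'a::euclidean_space set"
  assumes dim: "2 \<le> DIM('a)" and \<Omega>: "open \<Omega>" "connected \<Omega>" "bounded \<Omega>"
    and inf: "\<And>p. p \<in> frontier \<Omega> \<Longrightarrow> at_infinite_minimal_distance p \<Omega>"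
  shows "complete_hyperbolic \<Omega>"
proof -
  let ?d = "minimal_pseudodistance \<Omega>"
  obtain c where c: "c > 0" "\<And>x y. ennreal (c * dist x y) \<le> minimal_edist \<Omega> x y"
    using bounded_minimal_edist_ge[OF dim \<Omega>(1,3)] by blast
  have fin: "minimal_edist \<Omega> x y < top" if "x \<in> \<Omega>" "y \<in> \<Omega>" for x y
    by (rule minimal_edist_finite[OF dim \<Omega>(1,2) that])
  have low: "c * dist x y \<le> ?d x y" if "x \<in> \<Omega>" "y \<in> \<Omega>" for x y
    using c(2)[of x y] fin[OF that] c(1) unfolding minimal_pseudodistance_eq
    by (cases "minimal_edist \<Omega> x y") (auto simp: ennreal_le_iff)
  have up: "?d x y \<le> dist x y / e" if "ball x (2 * e) \<subseteq> \<Omega>" "e > 0" "dist x y \<le> e" for x y e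
    using minimal_edist_le_segment[OF dim that] that(2) unfolding minimal_pseudodistance_eq
    by (metis divide_nonneg_pos enn2real_leI zero_le_dist)
  have com: "?d x y = ?d y x" for x y
    unfolding minimal_pseudodistance_eq using minimal_edist_commute[OF dim \<Omega>(1)] by metis
  interpret Metric_space \<Omega> ?d
  proof
    show "0 \<le> ?d x y" for x y by (simp add: minimal_pseudodistance_eq)
    show "?d x y = ?d y x" for x y by (rule com)
    show "?d x y = 0 \<longleftrightarrow> x = y" if xy: "x \<in> \<Omega>" "y \<in> \<Omega>" for x y
    proof
      assume "?d x y = 0"
      then have "c * dist x y \<le> 0" using low[OF xy] by simp
      then show "x = y" using c(1) by (simp add: mult_le_0_iff)
    next
      assume "x = y"
      obtain e where e: "e > 0" "ball x e \<subseteq> \<Omega>" using \<Omega>(1) xy by (meson openE)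
      have "?d x x \<le> dist x x / (e / 2)" using e by (intro up) auto
      then show "?d x y = 0" using \<open>x = y\<close> by (simp add: minimal_pseudodistance_eq order_antisym)
    qed
    show "?d x z \<le> ?d x y + ?d y z" if "x \<in> \<Omega>" "y \<in> \<Omega>" "z \<in> \<Omega>" for x y z
    proof -
      have "?d x z \<le> enn2real (minimal_edist \<Omega> x y + minimal_edist \<Omega> y z)"
        unfolding minimal_pseudodistance_eq
        using fin that by (intro enn2real_mono minimal_edist_triangle[OF dim \<Omega>(1)]) (auto simp: ennreal_add_less_top)
      then show ?thesis using fin that by (simp add: minimal_pseudodistance_eq enn2real_plus)
    qed
  qed
  have "mcomplete"
    unfolding mcomplete_def
  proof (intro allI impI)
    fix \<sigma> assume "MCauchy \<sigma>"
    then have \<sigma>: "\<And>n. \<sigma> n \<in> \<Omega>" "\<And>e. e > 0 \<Longrightarrow> \<exists>N. \<forall>n n'. N \<le> n \<longrightarrow> N \<le> n' \<longrightarrow> ?d (\<sigma> n) (\<sigma> n') < e"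
      by (auto simp: MCauchy_def)
    have "Cauchy \<sigma>"
    proof (rule metric_CauchyI)
      fix e :: real assume "e > 0"
      then obtain N where N: "\<forall>n n'. N \<le> n \<longrightarrow> N \<le> n' \<longrightarrow> ?d (\<sigma> n) (\<sigma> n') < c * e" using \<sigma>(2)[of "c * e"] c(1) by auto
      have "dist (\<sigma> m) (\<sigma> n) < e" if "N \<le> m" "N \<le> n" for m n
      proof -
        have "c * dist (\<sigma> m) (\<sigma> n) < c * e" using N that low[OF \<sigma>(1) \<sigma>(1)] by (meson le_less_trans)
        then show ?thesis using c(1) by simp
      qed
      then show "\<exists>N. \<forall>m\<ge>N. \<forall>n\<ge>N. dist (\<sigma> m) (\<sigma> n) < e" by blast
    qed
    then obtain l where l: "\<sigma> \<longlonglongrightarrow> l" by (auto simp: Cauchy_convergent_iff convergent_def)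
    have "l \<in> \<Omega>"
    proof (rule ccontr)
      assume "l \<notin> \<Omega>"
      moreover have "l \<in> closure \<Omega>" using \<sigma>(1) l by (auto simp: closure_sequential)
      ultimately have "l \<in> frontier \<Omega>" using \<Omega>(1) by (simp add: frontier_def interior_open)
      \<comment> \<open>From \<open>N\<close> on, the sequence stays in the unit minimal ball about
        \<open>\<sigma> N\<close>, whose closure cannot contain a point at infinite
        distance.\<close>
      obtain N where N: "\<forall>n n'. N \<le> n \<longrightarrow> N \<le> n' \<longrightarrow> ?d (\<sigma> n) (\<sigma> n') < 1" using \<sigma>(2)[of 1] by auto
      then have "\<forall>n. \<sigma> (n + N) \<in> {x \<in> \<Omega>. ?d (\<sigma> N) x < 1}" using \<sigma>(1) by simp
      moreover have "(\<lambda>n. \<sigma> (n + N)) \<longlonglongrightarrow> l" using l by (rule LIMSEQ_ignore_initial_segment)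
      ultimately have "l \<in> closure {x \<in> \<Omega>. ?d (\<sigma> N) x < 1}"
        unfolding closure_sequential by (intro exI[of _ "\<lambda>n. \<sigma> (n + N)"]) simp
      then show False using inf[OF \<open>l \<in> frontier \<Omega>\<close>] \<sigma>(1) unfolding at_infinite_minimal_distance_def by blast
    qed
    then obtain e where e: "e > 0" "ball l e \<subseteq> \<Omega>" using \<Omega>(1) by (meson openE)
    \<comment> \<open>At an interior limit, small Euclidean distance implies small minimal distance
      by the bound along segments.\<close>
    have "limitin mtopology \<sigma> l sequentially"
      unfolding limit_metric_sequentially
    proof (intro conjI allI impI)
      fix \<epsilon> :: real assume \<epsilon>: "\<epsilon> > 0"
      then have "min (e / 2) (\<epsilon> * (e / 2)) > 0" using e by simp
      then obtain N where N: "\<And>n. n \<ge> N \<Longrightarrow> dist (\<sigma> n) l < min (e / 2) (\<epsilon> * (e / 2))"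
        using l unfolding lim_sequentially by blast
      have "?d (\<sigma> n) l < \<epsilon>" if "n \<ge> N" for n
      proof -
        have "?d l (\<sigma> n) \<le> dist l (\<sigma> n) / (e / 2)"
          using N[OF that] e by (intro up) (auto simp: dist_commute)
        also have "\<dots> < \<epsilon>" using N[OF that] e by (simp add: dist_commute field_simps)
        finally show ?thesis by (simp add: com)
      qed
      then show "\<exists>N. \<forall>n\<ge>N. \<sigma> n \<in> \<Omega> \<and> ?d (\<sigma> n) l < \<epsilon>" using \<sigma>(1) by blast
    qed (rule \<open>l \<in> \<Omega>\<close>)
    then show "\<exists>x. limitin mtopology \<sigma> x sequentially" by blast
  qed
  then show ?thesis unfolding complete_hyperbolic_def using Metric_space_axioms by blast
qed

text \<open>The global defining function is strongly MPSH on \<open>V\<close> only; the conditions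
  on a defining function are local, so it may be restricted to this open set.\<close>

lemma strongly_minimally_convex_imp_at:
  assumes "strongly_minimally_convex \<Omega>" "p \<in> frontier \<Omega>"
  shows "strongly_minimally_convex_at \<Omega> p"
proof -
  obtain U u V where *: "C2_defining_function \<Omega> U u" "frontier \<Omega> \<subseteq> V" "V \<subseteq> U" "strongly_mpsh_on V u"
    using assms(1) unfolding strongly_minimally_convex_def by blast
  then have "C2_defining_function \<Omega> V u"
    unfolding C2_defining_function_def strongly_mpsh_on_def by blast
  then show ?thesis using * assms(2) unfolding strongly_minimally_convex_at_def by blast
qed

theorem theorem9p2:
  fixes \<Omega> :: "(real ^ 'n) set"
  assumes "CARD('n) \<ge> 3" and "is_domain \<Omega>"
  shows "(\<forall>p\<in>frontier \<Omega>. strongly_minimally_convex_at \<Omega> p \<longrightarrow> at_infinite_minimal_distance p \<Omega>) \<and>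
         (bounded \<Omega> \<and> strongly_minimally_convex \<Omega> \<longrightarrow> complete_hyperbolic \<Omega>)"
proof -
  have dim: "2 \<le> DIM(real ^ 'n)" using assms(1) by simp
  have \<Omega>: "open \<Omega>" "connected \<Omega>" using assms(2) by (auto simp: is_domain_def)
  show ?thesis
    using infinite_distance[OF dim \<Omega>] bounded_complete_hyperbolic[OF dim \<Omega>] strongly_minimally_convex_imp_at
    by blast
qed

end
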